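(* Consider a sequence of generalized linear variable selection problems indexed by the sample size $n$, as set up in the context, with $p_n$ covariates, model size bound $q_n$, true parameter $\beta_0(n)$ with support $J_0(n)$, $|J_0(n)|\le q_n$, and signal strength $\beta_{\min}(n)=\min_{j\in J_0(n)}|(\beta_0(n))_j|$. Suppose that $p_n=n^\kappa$ for $\kappa>0$, that $q_n=n^\psi$ for $0\le\psi<1/3$, that $\beta_{\min}(n)=n^{-\phi/2}$ for $0\le\phi<1-\psi$, and that $\kappa>\psi$. Assume that there are a fixed constant $a_0\in(0,\infty)$, a fixed decreasing function $c_{\mathrm{lower}}:[0,\infty)\to(0,\infty)$, a fixed increasing function $c_{\mathrm{upper}}:[0,\infty)\to(0,\infty)$ and a fixed constant $c_{\mathrm{change}}\in(0,\infty)$ (none depending on $n$) such that for every $n$: $\|\beta_0(n)\|_2\le a_0$, and for all $J\subset[p_n]$ with $J\supseteq J_0(n)$ and $|J|\le 2q_n$ and all $\beta,\beta'\in\mathbb{R}^J$, $$c_{\mathrm{lower}}(\|\beta\|_2)\,\mathbf{I}_J\preceq\tfrac1n H_J(\beta)\preceq c_{\mathrm{upper}}(\|\beta\|_2)\,\mathbf{I}_J,\qquad \tfrac1n\|H_J(\beta)-H_J(\beta')\|_{\mathrm{sp}}\le c_{\mathrm{change}}\cdot\|\beta-\beta'\|_2 .$$ Moreover, assume that for the considered family of prior densities $\{f_J:J\subset[p_n],|J|\le q_n\}$ there are constants $F_3,F_4\in(0,\infty)$ such that, uniformly for all $|J|\le q_n$ (and all $n$), $$\sup_{\beta}f_J(\beta)\le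 F_3<\infty,\qquad \inf_{\|\beta\|_2\le a_{\mathrm{MLE}}}f_J(\beta)\ge F_4>0,$$ where $a_{\mathrm{MLE}}$ is the constant described in the context. Let $\gamma\ge 0$ with $\gamma>1-\frac{1-2\psi}{2(\kappa-\psi)}$. Then fully Bayesian model selection is consistent, that is, the event $$J_0(n)=\arg\max\{\mathrm{Bayes}_\gamma(J):J\subset[p_n],|J|\le q_n\}$$ has probability tending to one as $n\to\infty$.
   Context: Model (for sample size $n$, $p=p_n$ covariates, model size bound $q=q_n$, true parameter $\beta_0=\beta_0(n)$, support $J_0=J_0(n)$; $n^\kappa$ and $n^\psi$ are understood as rounded to integers). $X\in\mathbb{R}^{n\times p}$ is a deterministic design matrix (which may depend on $n$) with $i$th row $X_i$ (viewed as a vector in $\mathbb{R}^p$). The responses $Y_1,\dots,Y_n$ are independent real random variables, $Y_i\sim p_{\theta_i}$, where $\{p_\theta:\theta\in\mathbb{R}\}$ is a univariate exponential family with densities $p_\theta(y)\propto\exp\{y\theta-\mathrm{b}(\theta)\}$ with respect to some measure on $\mathbb{R}$; the natural parameter space is all of $\mathbb{R}$ and $\mathrm{b}$ is the log-partition (cumulant) function. The true parameters are $\theta_i=X_i^T\beta_0$ for a vector $\beta_0\in\mathbb{R}^p$ with support $J_0\subset[p]:=\{1,\dots,p\}$ (i.e. $\beta_{0j}\ne0$ iff $j\in J_0$), and $|J_0|\le q$. The log-likelihood and its negative Hessian are, for $\beta\in\mathbb{R}^p$, $$\log L(\beta)=\sum_{i=1}^n \left(Y_i\cdot X_i^T\beta-\mathrm{b}(X_i^T\beta)\right),\qquad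 H(\beta)=\sum_{i=1}^n X_iX_i^T\,\mathrm{b}''(X_i^T\beta)\in\mathbb{R}^{p\times p}.$$ Submodels. A set $J\subset[p]$ is identified with the regression model using only the covariates in $J$. $\mathbb{R}^J$ is the space of vectors $(\beta_j:j\in J)$; a vector in $\mathbb{R}^J$ is identified with the vector in $\mathbb{R}^p$ obtained by filling in zeros outside $J$. $H_J(\beta)$ is the submatrix of $H(\beta)$ with rows and columns indexed by $J$, and $\mathbf{I}_J$ is the identity matrix of that size. $\hat\beta_J$ denotes the maximum likelihood estimator in model $J$, i.e. the maximizer of $L$ over $\mathbb{R}^J$; an assertion about $\hat\beta_J$ is understood to include its existence. $\preceq$ is the positive semidefinite order and $\|\cdot\|_{\mathrm{sp}}$ is the spectral norm. For each $J\subset[p]$ with $|J|\le q$, $f_J:\mathbb{R}^J\to[0,\infty)$ is a probability density function. Criterion. For $J\subset[p]$ with $|J|\le q$ and $\gamma\ge0$, $$\mathrm{Evidence}(J):=\int_{\mathbb{R}^J}L(\beta)f_J(\beta)\,d\beta,\qquad \mathrm{Bayes}_\gamma(J):=\binom{p}{|J|}^{-\gamma}\mathrm{Evidence}(J).$$ The constant $a_{\mathrm{MLE}}$. It is the constant in the following uniform bound on MLEs: there are constants $\nu,c_{\mathrm{sample}},a_{\mathrm{MLE}}\in(0,\infty)$, depending only on $(a_0,c_{\mathrm{lower}},c_{\mathrm{upper}},c_{\mathrm{change}})$, such that for every generalized linear regression problem with deterministic design matrix $X\in\mathbb{R}^{n\times p}$ with rows $X_i$, independent responses $Y_i\sim p_{\theta_i}$,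 $i=1,\dots,n$, from a univariate exponential family with densities $p_\theta(y)\propto\exp\{y\theta-\mathrm{b}(\theta)\}$, $\theta\in\mathbb{R}$, natural parameters $\theta_i=X_i^T\beta_0$, true parameter $\beta_0\in\mathbb{R}^p$ whose support $J_0$ satisfies $|J_0|\le q$, log-likelihood $\log L(\beta)=\sum_{i=1}^n(Y_i\cdot X_i^T\beta-\mathrm{b}(X_i^T\beta))$ and negative Hessian $H(\beta)=\sum_{i=1}^n X_iX_i^T\,\mathrm{b}''(X_i^T\beta)$ (with any $n,p,q$) which satisfies $\|\beta_0\|_2\le a_0$ and, for all $J\subset[p]$ with $|J|\le2q$ and all $\beta,\beta'\in\mathbb{R}^J$, $c_{\mathrm{lower}}(\|\beta\|_2)\mathbf{I}_J\preceq\frac1nH_J(\beta)\preceq c_{\mathrm{upper}}(\|\beta\|_2)\mathbf{I}_J$ and $\frac1n\|H_J(\beta)-H_J(\beta')\|_{\mathrm{sp}}\le c_{\mathrm{change}}\|\beta-\beta'\|_2$, if $n\ge c_{\mathrm{sample}}\,q^3\max\{\log(p),\log^3(n)\}$, then with probability at least $1-p^{-\nu}$ one has $\|\hat\beta_J\|_2\le a_{\mathrm{MLE}}$ for all $J\subset[p]$ with $|J|\le q$. Such a triple of constants is fixed. *)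

theory Defs
  imports "HOL-Probability.Probability"
begin

text \<open>
  The dimensions \<open>n\<close> and \<open>p\<close> vary along the sequence of problems, so vectors are functions
  \<open>nat \<Rightarrow> real\<close> and matrices functions \<open>nat \<Rightarrow> nat \<Rightarrow> real\<close>. Observations are indexed by
  \<open>{1..n}\<close> and covariates by \<open>{1..p}\<close>; \<open>X i\<close> is the \<open>i\<close>th row of the design matrix.
  The Euclidean norm on \<open>\<real>\<^sup>p\<close> is \<open>L2_set \<beta> {1..p}\<close>.
\<close>

definition coord_space :: "nat set \<Rightarrow> (nat \<Rightarrow> real) set" where
  "coord_space J = {\<beta>. \<forall>j. j \<notin> J \<longrightarrow> \<beta> j = 0}"

definition supp :: "(nat \<Rightarrow> real) \<Rightarrow> nat set" where
  "supp \<beta> = {j. \<beta> j \<noteq> 0}"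

text \<open>Only meaningful for nonempty finite support, since \<open>Min {}\<close> is unspecified.\<close>

definition beta_min :: "(nat \<Rightarrow> real) \<Rightarrow> real" where
  "beta_min \<beta> = Min ((\<lambda>j. \<bar>\<beta> j\<bar>) ` supp \<beta>)"


subsection \<open>Matrices with rows and columns indexed by a finite set\<close>

definition id_mat :: "nat \<Rightarrow> nat \<Rightarrow> real" where
  "id_mat j k = (if j = k then 1 else 0)"

definition psd_on :: "nat set \<Rightarrow> (nat \<Rightarrow> nat \<Rightarrow> real) \<Rightarrow> bool" where
  "psd_on J A \<longleftrightarrow> (\<forall>j\<in>J. \<forall>k\<in>J. A j k = A k j) \<and>
     (\<forall>v. 0 \<le> (\<Sum>j\<in>J. \<Sum>k\<in>J. v j * A j k * v k))"

definition loewner_le :: "nat set \<Rightarrow> (nat \<Rightarrow> nat \<Rightarrow> real) \<Rightarrow> (nat \<Rightarrow> nat \<Rightarrow> real) \<Rightarrow> bool" where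
  "loewner_le J A B \<longleftrightarrow> psd_on J (\<lambda>j k. B j k - A j k)"

definition spectral_norm :: "nat set \<Rightarrow> (nat \<Rightarrow> nat \<Rightarrow> real) \<Rightarrow> real" where
  "spectral_norm J A =
     Sup ((\<lambda>v. L2_set (\<lambda>j. \<Sum>k\<in>J. A j k * v k) J) ` {v. L2_set v J \<le> 1})"


subsection \<open>Univariate exponential families\<close>

text \<open>
  A family is given by its base measure \<open>\<mu>\<close> on the real line; the integrability condition says
  that the natural parameter space is the whole line. (At \<open>\<theta> = 0\<close> it makes \<open>\<mu>\<close> finite.)
\<close>

definition exp_family :: "real measure \<Rightarrow> bool" where
  "exp_family \<mu> \<longleftrightarrow> sets \<mu> = sets borel \<and> emeasure \<mu> UNIV \<noteq> 0 \<and>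
     (\<forall>\<theta>. integrable \<mu> (\<lambda>y. exp (y * \<theta>)))"

definition cumulant :: "real measure \<Rightarrow> real \<Rightarrow> real" where
  "cumulant \<mu> \<theta> = ln (\<integral>y. exp (y * \<theta>) \<partial>\<mu>)"

definition exp_density :: "real measure \<Rightarrow> real \<Rightarrow> real \<Rightarrow> real" where
  "exp_density \<mu> \<theta> y = exp (y * \<theta> - cumulant \<mu> \<theta>)"


subsection \<open>Generalized linear models\<close>

definition lin_pred :: "nat \<Rightarrow> (nat \<Rightarrow> nat \<Rightarrow> real) \<Rightarrow> (nat \<Rightarrow> real) \<Rightarrow> nat \<Rightarrow> real" where
  "lin_pred p X \<beta> i = (\<Sum>j=1..p. X i j * \<beta> j)"

definition loglik ::
    "real measure \<Rightarrow> nat \<Rightarrow> nat \<Rightarrow> (nat \<Rightarrow> nat \<Rightarrow> real) \<Rightarrow> (nat \<Rightarrow> real) \<Rightarrow> (nat \<Rightarrow> real) \<Rightarrow> real" where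
  "loglik \<mu> n p X y \<beta> =
     (\<Sum>i=1..n. y i * lin_pred p X \<beta> i - cumulant \<mu> (lin_pred p X \<beta> i))"

definition neg_hessian ::
    "real measure \<Rightarrow> nat \<Rightarrow> nat \<Rightarrow> (nat \<Rightarrow> nat \<Rightarrow> real) \<Rightarrow> (nat \<Rightarrow> real) \<Rightarrow> nat \<Rightarrow> nat \<Rightarrow> real" where
  "neg_hessian \<mu> n p X \<beta> j k =
     (\<Sum>i=1..n. X i j * X i k * deriv (deriv (cumulant \<mu>)) (lin_pred p X \<beta> i))"

definition glm_problem ::
    "'w measure \<Rightarrow> (nat \<Rightarrow> 'w \<Rightarrow> real) \<Rightarrow> real measure \<Rightarrow> nat \<Rightarrow> nat \<Rightarrow> nat \<Rightarrow>
     (nat \<Rightarrow> nat \<Rightarrow> real) \<Rightarrow> (nat \<Rightarrow> real) \<Rightarrow> bool" where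
  "glm_problem \<Omega> Y \<mu> n p q X \<beta>0 \<longleftrightarrow>
     exp_family \<mu> \<and> \<beta>0 \<in> coord_space {1..p} \<and> card (supp \<beta>0) \<le> q \<and>
     prob_space \<Omega> \<and> prob_space.indep_vars \<Omega> (\<lambda>_. borel) Y {1..n} \<and>
     (\<forall>i\<in>{1..n}. distributed \<Omega> \<mu> (Y i) (\<lambda>y. ennreal (exp_density \<mu> (lin_pred p X \<beta>0 i) y)))"

definition hessian_bounds ::
    "(real \<Rightarrow> real) \<Rightarrow> (real \<Rightarrow> real) \<Rightarrow> real \<Rightarrow>
     real measure \<Rightarrow> nat \<Rightarrow> nat \<Rightarrow> (nat \<Rightarrow> nat \<Rightarrow> real) \<Rightarrow> nat set \<Rightarrow> bool" where
  "hessian_bounds c_lower c_upper c_change \<mu> n p X J \<longleftrightarrow>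
     (\<forall>\<beta>\<in>coord_space J. \<forall>\<beta>'\<in>coord_space J.
        loewner_le J (\<lambda>j k. c_lower (L2_set \<beta> {1..p}) * id_mat j k)
                     (\<lambda>j k. neg_hessian \<mu> n p X \<beta> j k / real n) \<and>
        loewner_le J (\<lambda>j k. neg_hessian \<mu> n p X \<beta> j k / real n)
                     (\<lambda>j k. c_upper (L2_set \<beta> {1..p}) * id_mat j k) \<and>
        spectral_norm J (\<lambda>j k. neg_hessian \<mu> n p X \<beta> j k - neg_hessian \<mu> n p X \<beta>' j k) / real n
          \<le> c_change * L2_set (\<lambda>j. \<beta> j - \<beta>' j) {1..p})"

definition mle_set ::
    "real measure \<Rightarrow> nat \<Rightarrow> nat \<Rightarrow> (nat \<Rightarrow> nat \<Rightarrow> real) \<Rightarrow> (nat \<Rightarrow> real) \<Rightarrow> nat set \<Rightarrow>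
     (nat \<Rightarrow> real) set" where
  "mle_set \<mu> n p X y J =
     {\<beta>. is_arg_max (\<lambda>\<beta>. exp (loglik \<mu> n p X y \<beta>)) (\<lambda>\<beta>. \<beta> \<in> coord_space J) \<beta>}"

text \<open>
  The defining property of the constants \<open>(\<nu>, c_sample, a_MLE)\<close>. The probability involved
  depends only on the law of \<open>(Y 1, \<dots>, Y n)\<close>, so letting the probability space range over all
  measures on the single type \<open>nat \<Rightarrow> real\<close>, which carries every such law, loses nothing.
\<close>

definition mle_bound ::
    "real \<Rightarrow> (real \<Rightarrow> real) \<Rightarrow> (real \<Rightarrow> real) \<Rightarrow> real \<Rightarrow> real \<Rightarrow> real \<Rightarrow> real \<Rightarrow> bool" where
  "mle_bound a0 c_lower c_upper c_change \<nu> c_sample a_MLE \<longleftrightarrow>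
     (\<forall>(\<Omega> :: (nat \<Rightarrow> real) measure) Y \<mu> n p q X \<beta>0.
        n \<ge> 1 \<longrightarrow> p \<ge> 1 \<longrightarrow>
        glm_problem \<Omega> Y \<mu> n p q X \<beta>0 \<longrightarrow>
        L2_set \<beta>0 {1..p} \<le> a0 \<longrightarrow>
        (\<forall>J. J \<subseteq> {1..p} \<and> card J \<le> 2 * q \<longrightarrow>
           hessian_bounds c_lower c_upper c_change \<mu> n p X J) \<longrightarrow>
        real n \<ge> c_sample * real q ^ 3 * max (ln (real p)) (ln (real n) ^ 3) \<longrightarrow>
        measure \<Omega> {\<omega> \<in> space \<Omega>. \<forall>J. J \<subseteq> {1..p} \<and> card J \<le> q \<longrightarrow>
            (\<exists>\<beta>. mle_set \<mu> n p X (\<lambda>i. Y i \<omega>) J = {\<beta>} \<and> L2_set \<beta> {1..p} \<le> a_MLE)}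
          \<ge> 1 - real p powr (- \<nu>))"


subsection \<open>Evidence and the Bayesian criterion\<close>

text \<open>
  Lebesgue measure on \<open>\<real>\<^sup>J\<close> is \<open>\<Pi>\<^sub>M j\<in>J. lborel\<close>, whose points are \<open>undefined\<close> outside \<open>J\<close>;
  \<open>zero_fill\<close> turns them into elements of \<open>coord_space J\<close>.
\<close>

definition zero_fill :: "nat set \<Rightarrow> (nat \<Rightarrow> real) \<Rightarrow> nat \<Rightarrow> real" where
  "zero_fill J \<beta> = (\<lambda>j. if j \<in> J then \<beta> j else 0)"

definition prior_density :: "nat set \<Rightarrow> ((nat \<Rightarrow> real) \<Rightarrow> real) \<Rightarrow> bool" where
  "prior_density J f \<longleftrightarrow>
     (\<forall>\<beta>\<in>coord_space J. 0 \<le> f \<beta>) \<and>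
     (\<lambda>\<beta>. f (zero_fill J \<beta>)) \<in> borel_measurable (\<Pi>\<^sub>M j\<in>J. lborel) \<and>
     (\<integral>\<^sup>+\<beta>. ennreal (f (zero_fill J \<beta>)) \<partial>(\<Pi>\<^sub>M j\<in>J. lborel)) = 1"

text \<open>The evidence is \<open>ennreal\<close>-valued because the integral may be infinite for some responses.\<close>

definition evidence ::
    "real measure \<Rightarrow> nat \<Rightarrow> nat \<Rightarrow> (nat \<Rightarrow> nat \<Rightarrow> real) \<Rightarrow> (nat \<Rightarrow> real) \<Rightarrow>
     (nat set \<Rightarrow> (nat \<Rightarrow> real) \<Rightarrow> real) \<Rightarrow> nat set \<Rightarrow> ennreal" where
  "evidence \<mu> n p X y f J =
     (\<integral>\<^sup>+\<beta>. ennreal (exp (loglik \<mu> n p X y (zero_fill J \<beta>)) * f J (zero_fill J \<beta>))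
        \<partial>(\<Pi>\<^sub>M j\<in>J. lborel))"

definition bayes ::
    "real \<Rightarrow> real measure \<Rightarrow> nat \<Rightarrow> nat \<Rightarrow> (nat \<Rightarrow> nat \<Rightarrow> real) \<Rightarrow> (nat \<Rightarrow> real) \<Rightarrow>
     (nat set \<Rightarrow> (nat \<Rightarrow> real) \<Rightarrow> real) \<Rightarrow> nat set \<Rightarrow> ennreal" where
  "bayes \<gamma> \<mu> n p X y f J =
     ennreal (real (p choose card J) powr (- \<gamma>)) * evidence \<mu> n p X y f J"

text \<open>The direction of rounding is left open.\<close>

definition rounded :: "real \<Rightarrow> nat \<Rightarrow> bool" where
  "rounded x m \<longleftrightarrow> int m = \<lfloor>x\<rfloor> \<or> int m = \<lceil>x\<rceil>"

end

theory Submission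
  imports Defs "HOL-Real_Asymp.Real_Asymp"
begin

text \<open>
  For \<open>J \<supseteq> J0\<close> write \<open>\<beta> = \<beta>0 + u + d\<close>, where \<open>u\<close> lives on \<open>J0\<close> and \<open>d\<close> is orthogonal to all such
  \<open>u\<close> for the Hessian at \<open>\<beta>0\<close>. Within distance of order \<open>sqrt (q log n / n)\<close> of \<open>\<beta>0\<close> the
  log-likelihood is quadratic up to \<open>o(1)\<close> because \<open>q^3 log^3 n / n\<close> vanishes, so \<open>Evidence J\<close> is at
  most a constant times \<open>Evidence J0\<close> times an integral of \<open>exp (score d - Q d / 2)\<close> over the
  \<open>r = card (J - J0)\<close> additional coordinates. Under the true law the integrand has mean
  \<open>1 + o(1)\<close>, by the same Taylor expansion, so the integral has mean \<open>(C log n / n) powr (r / 2)\<close>.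
  Markov's inequality and a union bound over all \<open>J\<close> show that it is at most
  \<open>n powr ((\<kappa> - 1 / 2 + \<epsilon>) r)\<close>, while the binomial prior contributes
  \<open>n powr (- \<gamma> (\<kappa> - \<psi>) r)\<close> up to constants; the condition on \<open>\<gamma>\<close> says that the product vanishes
  for small \<open>\<epsilon>\<close>. Outside the ball, and on every model that misses a true covariate, concavity makes
  the likelihood exponentially small. Maximum likelihood estimators never enter: all that is
  needed of \<open>a_MLE\<close> is \<open>a0 < a_MLE\<close>, so that the prior of the true model is bounded below near \<open>\<beta>0\<close>.
\<close>

text \<open>Two facts make a first moment enough for exponentially many models. By
  \<open>score_mgf\<close>, \<open>exp (score d - bregman d)\<close> is a likelihood ratio with mean
  exactly one, so integrating over the extra coordinates before applying Markov's inequality keeps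
  the gain of order \<open>1 / sqrt n\<close> per coordinate, up to logarithms. And the directions
  \<open>orth j\<close> are projected against J0 alone, not against the rest of J, so that pointwise
  control of the score needs at most \<open>2 * p\<close> directions for all models together.

  The obstacle is the radius. The Taylor ball has squared radius of order \<open>q log n / n\<close>
  for every J; a mean-one integrand over it in \<open>r\<close> coordinates would give a bound
  larger by about \<open>(q / r) powr (r / 2)\<close>, already \<open>n powr (\<psi> / 2)\<close>
  for one extra covariate, and the condition on \<gamma> leaves no room for that. Hence a second cut
  at squared radius of order \<open>r log n / n\<close>, beyond which the quadratic term beats the
  score.

  The inequality \<open>a0 < a_MLE\<close> is not assumed; it is extracted from the universal
  property of \<open>a_MLE\<close> by testing it on one Gaussian model.\<close>

subsection \<open>Exponential families\<close>

lemma abs_power_le_fact_exp: "\<bar>y::real\<bar> ^ k \<le> fact k * exp \<bar>y\<bar>"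
proof -
  have s: "summable (\<lambda>n. \<bar>y\<bar> ^ n / fact n)" using summable_exp[of "\<bar>y\<bar>"] by (simp add: field_simps)
  have "\<bar>y\<bar> ^ k / fact k = (\<Sum>n\<in>{k}. \<bar>y\<bar> ^ n / fact n)" by simp
  also have "\<dots> \<le> (\<Sum>n. \<bar>y\<bar> ^ n / fact n)"
    by (rule sum_le_suminf[OF s]) auto
  also have "\<dots> = exp \<bar>y\<bar>" by (simp add: exp_def field_simps scaleR_conv_of_real)
  finally show ?thesis by (simp add: field_simps)
qed

text \<open>Absorbs an exponential weight in \<open>\<bar>y\<bar>\<close> into two tilts, which are
  integrable because the natural parameter space is the whole line; the dominations below rest on
  it.\<close>

lemma exp_abs_mult_le:
  fixes y c \<theta> :: real assumes "c \<ge> 0"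
  shows "exp (c * \<bar>y\<bar>) * exp (y * \<theta>) \<le> exp (y * (\<theta> + c)) + exp (y * (\<theta> - c))"
proof (cases "y \<ge> 0")
  case True
  then have "exp (c * \<bar>y\<bar>) * exp (y * \<theta>) = exp (y * (\<theta> + c))" by (simp add: exp_add[symmetric] algebra_simps)
  then show ?thesis using exp_gt_zero[of "y * (\<theta> - c)"] by linarith
next
  case False
  then have "exp (c * \<bar>y\<bar>) * exp (y * \<theta>) = exp (y * (\<theta> - c))" by (simp add: exp_add[symmetric] algebra_simps)
  then show ?thesis using exp_gt_zero[of "y * (\<theta> + c)"] by linarith
qed

lemma abs_exp_minus_one_le: "\<bar>exp x - 1\<bar> \<le> \<bar>x\<bar> * exp \<bar>x::real\<bar>"
proof (cases "x \<ge> 0")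
  case True
  have "1 - x \<le> exp (- x)" using exp_ge_add_one_self[of "-x"] by simp
  then have "(1 - x) * exp x \<le> 1" by (metis exp_gt_zero exp_minus_inverse mult.commute mult_le_cancel_left_pos)
  then show ?thesis using True by (simp add: algebra_simps)
next
  case False
  then have "1 \<le> exp \<bar>x\<bar>" by simp
  then have "\<bar>x\<bar> * 1 \<le> \<bar>x\<bar> * exp \<bar>x\<bar>" by (intro mult_left_mono) auto
  moreover have "\<bar>exp x - 1\<bar> \<le> \<bar>x\<bar>" using False exp_ge_add_one_self[of x] by (smt (verit) exp_le_one_iff)
  ultimately show ?thesis by simp
qed

lemma exp_family_measurable: "exp_family \<mu> \<Longrightarrow> g \<in> borel_measurable borel \<Longrightarrow> g \<in> borel_measurable \<mu>"
  unfolding exp_family_def by (simp cong: measurable_cong_sets)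

lemma exp_family_integrable_power:
  assumes "exp_family \<mu>"
  shows "integrable \<mu> (\<lambda>y. y ^ k * exp (y * \<theta>))"
proof (rule Bochner_Integration.integrable_bound)
  show "integrable \<mu> (\<lambda>y. fact k * (exp (y * (\<theta> + 1)) + exp (y * (\<theta> - 1))))"
    using assms by (auto simp: exp_family_def)
  show "(\<lambda>y. y ^ k * exp (y * \<theta>)) \<in> borel_measurable \<mu>"
    by (rule exp_family_measurable[OF assms]) simp
  show "AE y in \<mu>. norm (y ^ k * exp (y * \<theta>)) \<le> norm (fact k * (exp (y * (\<theta> + 1)) + exp (y * (\<theta> - 1))))"
  proof (rule AE_I2)
    fix y :: real
    have "norm (y ^ k * exp (y * \<theta>)) = \<bar>y\<bar> ^ k * exp (y * \<theta>)" by (simp add: abs_mult power_abs)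
    also have "\<dots> \<le> (fact k * exp \<bar>y\<bar>) * exp (y * \<theta>)"
      by (intro mult_right_mono abs_power_le_fact_exp) simp
    also have "\<dots> \<le> fact k * (exp (y * (\<theta> + 1)) + exp (y * (\<theta> - 1)))"
      using exp_abs_mult_le[of 1 y \<theta>] by (simp add: mult.assoc)
    finally show "norm (y ^ k * exp (y * \<theta>)) \<le> norm (fact k * (exp (y * (\<theta> + 1)) + exp (y * (\<theta> - 1))))"
      by simp
  qed
qed

text \<open>Differentiation under the integral sign, by dominated convergence along an arbitrary
  null sequence of increments.\<close>

lemma exp_family_moment_deriv:
  assumes "exp_family \<mu>"
  shows "((\<lambda>\<theta>. \<integral>y. y ^ k * exp (y * \<theta>) \<partial>\<mu>) has_real_derivative
            (\<integral>y. y ^ Suc k * exp (y * \<theta>) \<partial>\<mu>)) (at \<theta>)"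
  unfolding DERIV_def tendsto_at_iff_sequentially
proof (intro allI impI)
  fix h :: "nat \<Rightarrow> real"
  assume h0: "\<forall>i. h i \<in> UNIV - {0}" and h: "h \<longlonglongrightarrow> 0"
  \<comment> \<open>Dropping the first \<open>N\<close> terms makes all increments at most 1, as the
    integrable majorant requires; the limit is unaffected.\<close>
  obtain N where N: "\<And>i. i \<ge> N \<Longrightarrow> \<bar>h i\<bar> \<le> 1"
    using h unfolding lim_sequentially by (metis dist_0_norm dist_commute less_imp_le real_norm_def zero_less_one)
  define g where "g = (\<lambda>i y. y ^ k * (exp (y * (\<theta> + h (i + N))) - exp (y * \<theta>)) / h (i + N))"
  have hN: "(\<lambda>i. h (i + N)) \<longlonglongrightarrow> 0" using h by (rule LIMSEQ_ignore_initial_segment)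
  have "(\<lambda>i. \<integral>y. g i y \<partial>\<mu>) \<longlonglongrightarrow> (\<integral>y. y ^ Suc k * exp (y * \<theta>) \<partial>\<mu>)"
  proof (rule integral_dominated_convergence)
    show "(\<lambda>y. y ^ Suc k * exp (y * \<theta>)) \<in> borel_measurable \<mu>"
      by (rule exp_family_measurable[OF assms]) simp
    show "g i \<in> borel_measurable \<mu>" for i
      unfolding g_def by (rule exp_family_measurable[OF assms]) simp
    \<comment> \<open>Tilts by 2: one unit of the exponent comes from the difference quotient, the
      other from the power of \<open>y\<close>.\<close>
    show "integrable \<mu> (\<lambda>y. fact (Suc k) * (exp (y * (\<theta> + 2)) + exp (y * (\<theta> - 2))))"
      using assms by (auto simp: exp_family_def)
    show "AE y in \<mu>. (\<lambda>i. g i y) \<longlonglongrightarrow> y ^ Suc k * exp (y * \<theta>)"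
    proof (rule AE_I2)
      fix y :: real
      have "((\<lambda>\<theta>. y ^ k * exp (y * \<theta>)) has_real_derivative y ^ k * (exp (y * \<theta>) * y)) (at \<theta>)"
        by (auto intro!: derivative_eq_intros)
      then have "(\<lambda>h. (y ^ k * exp (y * (\<theta> + h)) - y ^ k * exp (y * \<theta>)) / h) \<midarrow>0\<rightarrow> y ^ k * (exp (y * \<theta>) * y)"
        unfolding DERIV_def .
      from this[unfolded tendsto_at_iff_sequentially, rule_format, of "\<lambda>i. h (i + N)"] h0 hN
      show "(\<lambda>i. g i y) \<longlonglongrightarrow> y ^ Suc k * exp (y * \<theta>)"
        unfolding g_def by (simp add: o_def algebra_simps)
    qed
    show "AE y in \<mu>. norm (g i y) \<le> fact (Suc k) * (exp (y * (\<theta> + 2)) + exp (y * (\<theta> - 2)))" for i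
    proof (rule AE_I2)
      fix y :: real
      let ?h = "h (i + N)"
      have hn: "?h \<noteq> 0" and hl: "\<bar>?h\<bar> \<le> 1" using h0 N by auto
      have yh: "\<bar>y * ?h\<bar> \<le> \<bar>y\<bar>" using mult_left_mono[OF hl, of "\<bar>y\<bar>"] by (simp add: abs_mult)
      have "exp (y * (\<theta> + ?h)) - exp (y * \<theta>) = exp (y * \<theta>) * (exp (y * ?h) - 1)"
        by (simp add: algebra_simps exp_add)
      then have "norm (g i y) = \<bar>y\<bar> ^ k * exp (y * \<theta>) * \<bar>exp (y * ?h) - 1\<bar> / \<bar>?h\<bar>"
        unfolding g_def by (simp add: abs_mult power_abs)
      also have "\<dots> \<le> \<bar>y\<bar> ^ k * exp (y * \<theta>) * (\<bar>y * ?h\<bar> * exp \<bar>y * ?h\<bar>) / \<bar>?h\<bar>"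
        by (intro divide_right_mono mult_left_mono abs_exp_minus_one_le) auto
      also have "\<dots> = \<bar>y\<bar> ^ Suc k * exp (y * \<theta>) * exp \<bar>y * ?h\<bar>"
        using hn by (simp add: abs_mult field_simps)
      also have "\<dots> \<le> (fact (Suc k) * exp \<bar>y\<bar>) * exp (y * \<theta>) * exp \<bar>y\<bar>"
        using yh by (intro mult_mono mult_right_mono abs_power_le_fact_exp) auto
      also have "\<dots> = fact (Suc k) * (exp (2 * \<bar>y\<bar>) * exp (y * \<theta>))"
      proof -
        have "exp (2 * \<bar>y\<bar>) = exp \<bar>y\<bar> * exp \<bar>y\<bar>" by (simp add: exp_add[symmetric])
        then show ?thesis by (simp only: mult_ac)
      qed
      also have "\<dots> \<le> fact (Suc k) * (exp (y * (\<theta> + 2)) + exp (y * (\<theta> - 2)))"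
        by (intro mult_left_mono exp_abs_mult_le) auto
      finally show "norm (g i y) \<le> fact (Suc k) * (exp (y * (\<theta> + 2)) + exp (y * (\<theta> - 2)))" .
    qed
  qed
  moreover have "(\<integral>y. g i y \<partial>\<mu>) = ((\<integral>y. y ^ k * exp (y * (\<theta> + h (i + N))) \<partial>\<mu>) - (\<integral>y. y ^ k * exp (y * \<theta>) \<partial>\<mu>)) / h (i + N)" for i
    unfolding g_def
    using exp_family_integrable_power[OF assms]
    by (simp add: right_diff_distrib diff_divide_distrib)
  ultimately have "(\<lambda>i. ((\<integral>y. y ^ k * exp (y * (\<theta> + h (i + N))) \<partial>\<mu>) - (\<integral>y. y ^ k * exp (y * \<theta>) \<partial>\<mu>)) / h (i + N))
     \<longlonglongrightarrow> (\<integral>y. y ^ Suc k * exp (y * \<theta>) \<partial>\<mu>)" by simp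
  from LIMSEQ_offset[OF this[folded add.assoc]]
  show "((\<lambda>h. ((\<integral>y. y ^ k * exp (y * (\<theta> + h)) \<partial>\<mu>) - (\<integral>y. y ^ k * exp (y * \<theta>) \<partial>\<mu>)) / h) \<circ> h)
     \<longlonglongrightarrow> (\<integral>y. y ^ Suc k * exp (y * \<theta>) \<partial>\<mu>)"
    unfolding o_def .
qed

lemma exp_family_mgf_pos:
  assumes "exp_family \<mu>"
  shows "0 < (\<integral>y. exp (y * \<theta>) \<partial>\<mu>)"
proof -
  have i: "integrable \<mu> (\<lambda>y. exp (y * \<theta>))" using assms by (simp add: exp_family_def)
  have "(\<integral>y. exp (y * \<theta>) \<partial>\<mu>) \<noteq> 0"
  proof
    assume "(\<integral>y. exp (y * \<theta>) \<partial>\<mu>) = 0"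
    then have "AE y in \<mu>. exp (y * \<theta>) = 0"
      using integral_nonneg_eq_0_iff_AE[OF i] by simp
    then have "AE y in \<mu>. False" by simp
    then have "emeasure \<mu> (space \<mu>) = 0" by (auto elim!: AE_E intro: emeasure_eq_0)
    moreover have "space \<mu> = UNIV" using assms sets_eq_imp_space_eq[of \<mu> borel] by (simp add: exp_family_def)
    ultimately show False using assms by (simp add: exp_family_def)
  qed
  then show ?thesis by (simp add: less_le integral_nonneg)
qed

text \<open>\<open>deriv\<close> is a total operator, so differentiability has to be established
  before the Hessian built from it can act as a second derivative. The derivatives are quotients of
  moments of the tilted measure.\<close>

lemma cumulant_differentiable:
  assumes "exp_family \<mu>"
  shows "(cumulant \<mu> has_real_derivative deriv (cumulant \<mu>) \<theta>) (at \<theta>)"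
    and "(deriv (cumulant \<mu>) has_real_derivative deriv (deriv (cumulant \<mu>)) \<theta>) (at \<theta>)"
proof -
  define m where "m = (\<lambda>k \<theta>. \<integral>y. y ^ k * exp (y * \<theta>) \<partial>\<mu>)"
  have md: "(m k has_real_derivative m (Suc k) \<theta>) (at \<theta>)" for k \<theta>
    unfolding m_def by (rule exp_family_moment_deriv[OF assms])
  have m0: "m 0 \<theta> > 0" for \<theta> using exp_family_mgf_pos[OF assms] by (simp add: m_def)
  have c: "cumulant \<mu> = (\<lambda>\<theta>. ln (m 0 \<theta>))" by (simp add: fun_eq_iff cumulant_def m_def)
  have d1: "(cumulant \<mu> has_real_derivative m 1 \<theta> / m 0 \<theta>) (at \<theta>)" for \<theta>
    unfolding c using m0[of \<theta>] md[of 0 \<theta>] by (auto intro!: derivative_eq_intros simp: field_simps)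
  have e1: "deriv (cumulant \<mu>) = (\<lambda>\<theta>. m 1 \<theta> / m 0 \<theta>)"
    using DERIV_imp_deriv[OF d1] by (simp add: fun_eq_iff)
  have d2: "(deriv (cumulant \<mu>) has_real_derivative
      (m 2 \<theta> * m 0 \<theta> - m 1 \<theta> * m 1 \<theta>) / (m 0 \<theta> * m 0 \<theta>)) (at \<theta>)"
    unfolding e1 using m0[of \<theta>] md[of 0 \<theta>] md[of 1 \<theta>]
    by (auto intro!: derivative_eq_intros simp: numeral_2_eq_2)
  show "(cumulant \<mu> has_real_derivative deriv (cumulant \<mu>) \<theta>) (at \<theta>)" using d1 e1 by simp
  show "(deriv (cumulant \<mu>) has_real_derivative deriv (deriv (cumulant \<mu>)) \<theta>) (at \<theta>)"
    using d2 DERIV_imp_deriv[OF d2] by simp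
qed

lemma exp_cumulant:
  assumes "exp_family \<mu>"
  shows "(\<integral>\<^sup>+ y. ennreal (exp (y * t)) \<partial>\<mu>) = ennreal (exp (cumulant \<mu> t))"
  using assms exp_family_mgf_pos[OF assms, of t]
  by (subst nn_integral_eq_integral) (auto simp: exp_family_def cumulant_def)

text \<open>Multiplying by \<open>exp (c * y)\<close> moves the natural parameter from \<theta> to
  \<open>\<theta> + c\<close>; only the normalizing constants remain.\<close>

lemma exp_density_mgf:
  assumes "exp_family \<mu>" and D: "distributed M \<mu> Z (\<lambda>y. ennreal (exp_density \<mu> \<theta> y))"
  shows "(\<integral>\<^sup>+ \<omega>. ennreal (exp (c * Z \<omega>)) \<partial>M)
    = ennreal (exp (cumulant \<mu> (\<theta> + c) - cumulant \<mu> \<theta>))"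
proof -
  have me: "(\<lambda>y. ennreal (exp (c * y))) \<in> borel_measurable \<mu>"
    by (rule exp_family_measurable[OF assms(1)]) simp
  have "(\<integral>\<^sup>+ \<omega>. ennreal (exp (c * Z \<omega>)) \<partial>M)
     = (\<integral>\<^sup>+ y. ennreal (exp_density \<mu> \<theta> y) * ennreal (exp (c * y)) \<partial>\<mu>)"
    by (rule distributed_nn_integral[OF D me, symmetric])
  also have "\<dots> = (\<integral>\<^sup>+ y. ennreal (exp (- cumulant \<mu> \<theta>)) * ennreal (exp (y * (\<theta> + c))) \<partial>\<mu>)"
    by (intro nn_integral_cong)
      (simp add: exp_density_def ennreal_mult'[symmetric] exp_add[symmetric] algebra_simps)
  also have "\<dots> = ennreal (exp (- cumulant \<mu> \<theta>)) * (\<integral>\<^sup>+ y. ennreal (exp (y * (\<theta> + c))) \<partial>\<mu>)"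
    by (intro nn_integral_cmult exp_family_measurable[OF assms(1)]) simp
  also have "\<dots> = ennreal (exp (cumulant \<mu> (\<theta> + c) - cumulant \<mu> \<theta>))"
    by (simp add: exp_cumulant[OF assms(1)] ennreal_mult'[symmetric] exp_add[symmetric])
  finally show ?thesis .
qed

subsection \<open>Lebesgue integrals over coordinate subspaces\<close>

abbreviation vecM :: "(nat \<Rightarrow> real) measure" where
  "vecM \<equiv> Pi\<^sub>M UNIV (\<lambda>_. borel)"

interpretation lborel_prod: product_sigma_finite "\<lambda>_::nat. lborel :: real measure"
  by standard

lemma zero_fill_coord_space: "zero_fill S x \<in> coord_space S"
  by (simp add: zero_fill_def coord_space_def)

lemma coord_space_mono: "S \<subseteq> T \<Longrightarrow> x \<in> coord_space S \<Longrightarrow> x \<in> coord_space T"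
  by (auto simp: coord_space_def)

lemma coord_space_diff: "x \<in> coord_space S \<Longrightarrow> y \<in> coord_space S \<Longrightarrow> (\<lambda>j. x j - y j) \<in> coord_space S"
  by (auto simp: coord_space_def)

lemma coord_space_scale: "x \<in> coord_space S \<Longrightarrow> (\<lambda>j. c * x j) \<in> coord_space S"
  by (auto simp: coord_space_def)

lemma zero_fill_measurable [measurable]:
  "zero_fill S \<in> measurable (Pi\<^sub>M S (\<lambda>_. lborel)) vecM"
  unfolding zero_fill_def
proof (rule measurable_PiM_single')
  fix i :: nat
  show "(\<lambda>x. if i \<in> S then x i else (0::real)) \<in> borel_measurable (Pi\<^sub>M S (\<lambda>_. lborel))"
    by (cases "i \<in> S") auto
qed simp

lemma zero_fill_compose_measurable:
  "h \<in> borel_measurable vecM \<Longrightarrow> (\<lambda>x. h (zero_fill S x)) \<in> borel_measurable (Pi\<^sub>M S (\<lambda>_. lborel))"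
  by (rule measurable_compose[OF zero_fill_measurable])

text \<open>Keeping \<open>h\<close> a function of full vectors, zero-filled only inside the
  integral, lets one integrand be used for nested models and be translated by vectors.\<close>

definition lint :: "nat set \<Rightarrow> ((nat \<Rightarrow> real) \<Rightarrow> ennreal) \<Rightarrow> ennreal" where
  "lint S h = (\<integral>\<^sup>+\<beta>. h (zero_fill S \<beta>) \<partial>(\<Pi>\<^sub>M j\<in>S. lborel))"

lemma lint_mono: "(\<And>x. x \<in> coord_space S \<Longrightarrow> g x \<le> h x) \<Longrightarrow> lint S g \<le> lint S h"
  unfolding lint_def by (intro nn_integral_mono) (simp add: zero_fill_coord_space)

lemma lint_cong: "(\<And>x. x \<in> coord_space S \<Longrightarrow> g x = h x) \<Longrightarrow> lint S g = lint S h"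
  unfolding lint_def by (intro nn_integral_cong) (simp add: zero_fill_coord_space)

lemma lint_cmult: "h \<in> borel_measurable vecM \<Longrightarrow> lint S (\<lambda>x. c * h x) = c * lint S h"
  unfolding lint_def by (intro nn_integral_cmult zero_fill_compose_measurable)

lemma lint_multc: "h \<in> borel_measurable vecM \<Longrightarrow> lint S (\<lambda>x. h x * c) = lint S h * c"
  unfolding lint_def by (intro nn_integral_multc zero_fill_compose_measurable)

lemma lint_add:
  "g \<in> borel_measurable vecM \<Longrightarrow> h \<in> borel_measurable vecM \<Longrightarrow> lint S (\<lambda>x. g x + h x) = lint S g + lint S h"
  unfolding lint_def by (intro nn_integral_add zero_fill_compose_measurable)

lemma vec_add_measurable:
  assumes "g \<in> measurable M vecM" "h \<in> measurable M vecM"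
  shows "(\<lambda>x. (\<lambda>j. g x j + h x j)) \<in> measurable M vecM"
proof (rule measurable_PiM_single')
  fix i :: nat
  have "(\<lambda>x. g x i) \<in> borel_measurable M" "(\<lambda>x. h x i) \<in> borel_measurable M"
    using assms by (auto intro: measurable_compose[OF _ measurable_component_singleton[OF UNIV_I]])
  then show "(\<lambda>x. g x i + h x i) \<in> borel_measurable M" by simp
qed simp

lemma vec_shift_measurable: "(\<lambda>x. (\<lambda>j. x j + c j)) \<in> measurable vecM vecM"
proof (rule measurable_PiM_single')
  fix i :: nat
  show "(\<lambda>x. x i + c i) \<in> borel_measurable vecM" by simp
qed simp

text \<open>For disjoint index sets, merging two partial vectors is adding their zero-filled
  versions, so Fubini's theorem takes the form of a sum \<open>u + v\<close>.\<close>

lemma lint_Un: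
  assumes fin: "finite A" "finite B" and dis: "A \<inter> B = {}"
    and h[measurable]: "h \<in> borel_measurable vecM"
  shows "lint (A \<union> B) h = lint B (\<lambda>v. lint A (\<lambda>u. h (\<lambda>j. u j + v j)))"
proof -
  have "lint (A \<union> B) h = lint (B \<union> A) h" by (simp add: Un_commute)
  also have "\<dots> = (\<integral>\<^sup>+ v. (\<integral>\<^sup>+ u. h (zero_fill (B \<union> A) (merge B A (v, u)))
      \<partial>(Pi\<^sub>M A (\<lambda>_. lborel))) \<partial>(Pi\<^sub>M B (\<lambda>_. lborel)))"
    unfolding lint_def using dis fin
    by (intro lborel_prod.product_nn_integral_fold) auto
  also have "\<dots> = lint B (\<lambda>v. lint A (\<lambda>u. h (\<lambda>j. u j + v j)))"
    unfolding lint_def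
  proof (intro nn_integral_cong arg_cong[where f = h] ext)
    fix v u :: "nat \<Rightarrow> real" and j
    show "zero_fill (B \<union> A) (merge B A (v, u)) j = zero_fill A u j + zero_fill B v j"
      using dis by (auto simp: zero_fill_def merge_def)
  qed
  finally show ?thesis .
qed

lemma lint_singleton:
  assumes h[measurable]: "h \<in> borel_measurable vecM"
  shows "lint {i} h = (\<integral>\<^sup>+ x. h (\<lambda>j. if j = i then x else 0) \<partial>lborel)"
proof -
  have m: "(\<lambda>x j. if j = i then x else (0::real)) \<in> measurable lborel vecM"
  proof (rule measurable_PiM_single')
    fix k show "(\<lambda>x. if k = i then x else (0::real)) \<in> borel_measurable lborel"
      by (cases "k = i") auto
  qed simp
  have "(\<integral>\<^sup>+ x. h (\<lambda>j. if j = i then x else 0) \<partial>lborel)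
     = (\<integral>\<^sup>+ x. h (\<lambda>j. if j = i then x i else 0) \<partial>(Pi\<^sub>M {i} (\<lambda>_. lborel)))"
    by (intro lborel_prod.product_nn_integral_singleton[symmetric] measurable_compose[OF m h])
  then show ?thesis unfolding lint_def zero_fill_def by (simp cong: if_cong)
qed

text \<open>Translation invariance, one coordinate at a time: Fubini splits off coordinate
  \<open>i\<close>, the induction hypothesis translates the others under the integral, and a
  one-dimensional substitution does the rest.\<close>

lemma lint_shift:
  assumes "finite S" "c \<in> coord_space S" "h \<in> borel_measurable vecM"
  shows "lint S (\<lambda>x. h (\<lambda>j. x j + c j)) = lint S h"
  using assms
proof (induction S arbitrary: h c rule: finite_induct)
  case empty
  then have "c = (\<lambda>_. 0)" by (auto simp: coord_space_def)
  then show ?case by simp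
next
  case (insert i S)
  note h[measurable] = insert.prems(2)
  define c' where "c' = c(i := 0)"
  define ci where "ci = (\<lambda>j. if j = i then c i else 0)"
  have c': "c' \<in> coord_space S" using insert.prems(1) by (auto simp: coord_space_def c'_def)
  have cc: "c j = c' j + ci j" for j by (simp add: c'_def ci_def)
  have sh: "(\<lambda>x. g (\<lambda>j. x j + d j)) \<in> borel_measurable vecM"
    if "g \<in> borel_measurable vecM" for g :: "(nat \<Rightarrow> real) \<Rightarrow> ennreal" and d
    using measurable_compose[OF vec_shift_measurable that] .
  have inner: "lint S (\<lambda>u. h (\<lambda>j. (u j + v j) + c j)) = lint S (\<lambda>u. h (\<lambda>j. u j + (v j + ci j)))" for v
  proof -
    have "lint S (\<lambda>u. h (\<lambda>j. u j + (v j + ci j))) = lint S (\<lambda>u. h (\<lambda>j. (u j + c' j) + (v j + ci j)))"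
      by (rule insert.IH[OF c' sh, OF h, symmetric])
    then show ?thesis by (simp add: cc algebra_simps)
  qed
  define g where "g = (\<lambda>v. lint S (\<lambda>u. h (\<lambda>j. u j + v j)))"
  interpret sigma_finite_measure "Pi\<^sub>M S (\<lambda>_. lborel :: real measure)"
    by (rule lborel_prod.sigma_finite[OF insert.hyps(1)])
  have g[measurable]: "g \<in> borel_measurable vecM"
    unfolding g_def lint_def
  proof (rule borel_measurable_nn_integral)
    have "(\<lambda>(v, u). (\<lambda>j. zero_fill S u j + v j)) \<in> measurable (vecM \<Otimes>\<^sub>M Pi\<^sub>M S (\<lambda>_. lborel)) vecM"
      unfolding split_beta' by (rule vec_add_measurable) measurable
    from measurable_compose[OF this h]
    show "(\<lambda>(v, u). h (\<lambda>j. zero_fill S u j + v j)) \<in> borel_measurable (vecM \<Otimes>\<^sub>M Pi\<^sub>M S (\<lambda>_. lborel))"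
      by (simp add: split_beta')
  qed
  have gm: "(\<lambda>x. g (\<lambda>j. if j = i then x else 0)) \<in> borel_measurable borel"
  proof (rule measurable_compose[OF _ g], rule measurable_PiM_single')
    fix k show "(\<lambda>x. if k = i then x else (0::real)) \<in> borel_measurable borel"
      by (cases "k = i") auto
  qed simp
  have U: "insert i S = S \<union> {i}" by auto
  have "lint (insert i S) (\<lambda>x. h (\<lambda>j. x j + c j))
      = lint {i} (\<lambda>v. lint S (\<lambda>u. h (\<lambda>j. (u j + v j) + c j)))"
    unfolding U using insert.hyps by (intro lint_Un sh h) auto
  also have "\<dots> = lint {i} (\<lambda>v. g (\<lambda>j. v j + ci j))" unfolding inner g_def ..
  also have "\<dots> = (\<integral>\<^sup>+ x. g (\<lambda>j. (if j = i then x else 0) + ci j) \<partial>lborel)"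
    by (rule lint_singleton[OF sh, OF g])
  also have "\<dots> = (\<integral>\<^sup>+ x. g (\<lambda>j. if j = i then c i + 1 * x else 0) \<partial>lborel)"
    by (intro nn_integral_cong arg_cong[where f = g] ext) (simp add: ci_def)
  also have "\<dots> = (\<integral>\<^sup>+ x. g (\<lambda>j. if j = i then x else 0) \<partial>lborel)"
    using nn_integral_real_affine[OF gm, of 1 "c i"] by simp
  also have "\<dots> = lint {i} g" by (rule lint_singleton[OF g, symmetric])
  also have "\<dots> = lint (insert i S) h"
    unfolding U g_def using insert.hyps by (intro lint_Un[symmetric] h) auto
  finally show ?case .
qed

section \<open>Gaussian integrals and cube volumes\<close>

lemma nn_integral_exp_square:
  assumes "a > 0"
  shows "(\<integral>\<^sup>+ x. ennreal (exp (- a * x\<^sup>2)) \<partial>lborel) = ennreal (sqrt (pi / a))"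
proof -
  define s where "s = 1 / sqrt (2 * a)"
  have s: "s > 0" "2 * s\<^sup>2 = 1 / a" using assms by (auto simp: s_def power_divide)
  have e: "exp (- a * x\<^sup>2) = sqrt (pi / a) * normal_density 0 s x" for x
  proof -
    have "sqrt (2 * pi * s\<^sup>2) = sqrt (pi / a)" using s(2) by (simp add: mult.commute mult.left_commute field_simps)
    moreover have "sqrt (pi / a) > 0" using assms by simp
    moreover have "- (x\<^sup>2) / (2 * s\<^sup>2) = - a * x\<^sup>2" unfolding s(2) by (simp add: field_simps)
    ultimately show ?thesis using assms by (simp add: normal_density_def)
  qed
  have "(\<integral>\<^sup>+ x. ennreal (exp (- a * x\<^sup>2)) \<partial>lborel)
    = (\<integral>\<^sup>+ x. ennreal (sqrt (pi / a)) * ennreal (normal_density 0 s x) \<partial>lborel)"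
    unfolding e using assms by (intro nn_integral_cong) (simp add: ennreal_mult'[symmetric])
  also have "\<dots> = ennreal (sqrt (pi / a)) * (\<integral>\<^sup>+ x. ennreal (normal_density 0 s x) \<partial>lborel)"
    by (rule nn_integral_cmult) simp
  also have "(\<integral>\<^sup>+ x. ennreal (normal_density 0 s x) \<partial>lborel) = 1"
    using integral_normal_density[OF s(1)] integrable_normal_density[OF s(1)]
    by (subst nn_integral_eq_integral) auto
  finally show ?thesis by simp
qed

lemma lint_gaussian:
  assumes "finite S" "a > 0"
  shows "lint S (\<lambda>v. ennreal (exp (- a * (\<Sum>j\<in>S. (v j)\<^sup>2)))) = ennreal (sqrt (pi / a) ^ card S)"
proof -
  have "lint S (\<lambda>v. ennreal (exp (- a * (\<Sum>j\<in>S. (v j)\<^sup>2))))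
     = (\<integral>\<^sup>+ v. (\<Prod>j\<in>S. ennreal (exp (- a * (v j)\<^sup>2))) \<partial>(Pi\<^sub>M S (\<lambda>_. lborel)))"
    unfolding lint_def
    by (intro nn_integral_cong) (simp add: zero_fill_def prod_ennreal exp_sum[OF assms(1), symmetric] sum_distrib_left sum_negf)
  also have "\<dots> = (\<Prod>j\<in>S. \<integral>\<^sup>+ x. ennreal (exp (- a * x\<^sup>2)) \<partial>lborel)"
    by (rule lborel_prod.product_nn_integral_prod[OF assms(1)]) auto
  also have "\<dots> = ennreal (sqrt (pi / a) ^ card S)"
    unfolding nn_integral_exp_square[OF assms(2)] using assms by (simp add: ennreal_power)
  finally show ?thesis .
qed

lemma lint_cube:
  assumes "finite S" "c \<ge> 0"
  shows "lint S (\<lambda>v. indicator {v. \<forall>j\<in>S. \<bar>v j\<bar> \<le> c} v) = ennreal ((2 * c) ^ card S)"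
proof -
  have "lint S (\<lambda>v. indicator {v. \<forall>j\<in>S. \<bar>v j\<bar> \<le> c} v)
     = (\<integral>\<^sup>+ v. (\<Prod>j\<in>S. indicator {- c..c} (v j)) \<partial>(Pi\<^sub>M S (\<lambda>_. lborel)))"
    unfolding lint_def
  proof (intro nn_integral_cong)
    fix v :: "nat \<Rightarrow> real"
    show "indicator {v. \<forall>j\<in>S. \<bar>v j\<bar> \<le> c} (zero_fill S v) = (\<Prod>j\<in>S. indicator {- c..c} (v j) :: ennreal)"
    proof (cases "\<forall>j\<in>S. \<bar>v j\<bar> \<le> c")
      case True
      then have "(\<Prod>j\<in>S. indicator {- c..c} (v j) :: ennreal) = 1"
        by (intro prod.neutral) (auto simp: abs_le_iff indicator_def)
      then show ?thesis using True by (auto simp: zero_fill_def)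
    next
      case False
      then obtain j where "j \<in> S" "\<not> \<bar>v j\<bar> \<le> c" by auto
      then have "(\<Prod>j\<in>S. indicator {- c..c} (v j) :: ennreal) = 0"
        using assms by (intro prod_zero) (auto simp: abs_le_iff intro!: bexI[of _ j])
      then show ?thesis using False by (simp add: zero_fill_def)
    qed
  qed
  also have "\<dots> = (\<Prod>j\<in>S. \<integral>\<^sup>+ x. indicator {- c..c} x \<partial>lborel)"
    by (rule lborel_prod.product_nn_integral_prod[OF assms(1)]) auto
  also have "\<dots> = ennreal ((2 * c) ^ card S)"
    using assms by (simp add: ennreal_power)
  finally show ?thesis .
qed

subsection \<open>Local geometry of the likelihood\<close>

definition unit_vec :: "nat \<Rightarrow> nat \<Rightarrow> real" where
  "unit_vec j k = (if k = j then 1 else 0)"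

lemma lin_pred_add: "lin_pred p X (\<lambda>j. \<beta> j + \<delta> j) i = lin_pred p X \<beta> i + lin_pred p X \<delta> i"
  by (simp add: lin_pred_def distrib_left sum.distrib)

lemma lin_pred_diff: "lin_pred p X (\<lambda>j. \<beta> j - \<delta> j) i = lin_pred p X \<beta> i - lin_pred p X \<delta> i"
  by (simp add: lin_pred_def right_diff_distrib sum_subtractf)

lemma lin_pred_scale: "lin_pred p X (\<lambda>j. c * \<beta> j) i = c * lin_pred p X \<beta> i"
  by (simp add: lin_pred_def sum_distrib_left mult.left_commute)

lemma lin_pred_sum:
  "lin_pred p X (\<lambda>k. \<Sum>j\<in>V. v j * d j k) i = (\<Sum>j\<in>V. v j * lin_pred p X (d j) i)"
  unfolding lin_pred_def sum_distrib_left
  by (subst sum.swap) (simp add: mult_ac)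

lemma L2_set_scale: "L2_set (\<lambda>j. c * x j) A = \<bar>c\<bar> * L2_set x A"
  by (simp add: L2_set_def power_mult_distrib sum_distrib_left[symmetric] real_sqrt_mult)

lemma L2_set_coord_space:
  assumes "x \<in> coord_space V" "V \<subseteq> P" "finite P"
  shows "L2_set x P = L2_set x V"
  unfolding L2_set_def using assms
  by (intro arg_cong[where f = sqrt] sum.mono_neutral_right) (auto simp: coord_space_def)

lemma L2_set_mono_on: "V \<subseteq> P \<Longrightarrow> finite P \<Longrightarrow> L2_set x V \<le> L2_set x P"
  unfolding L2_set_def by (intro real_sqrt_le_mono sum_mono2) auto

lemma L2_set_uminus: "L2_set (\<lambda>j. - x j) A = L2_set x A"
  by (simp add: L2_set_def)

lemma L2_set_square: "(L2_set x A)\<^sup>2 = (\<Sum>j\<in>A. (x j)\<^sup>2)"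
  by (simp add: L2_set_def sum_nonneg)

lemma L2_set_pos:
  assumes "x \<in> coord_space P" "finite P" "x \<noteq> (\<lambda>_. 0)"
  shows "0 < L2_set x P"
proof -
  obtain j where "x j \<noteq> 0" using assms by auto
  moreover from this have "j \<in> P" using assms by (auto simp: coord_space_def)
  ultimately have "0 < \<bar>x j\<bar>" "\<bar>x j\<bar> \<le> L2_set x P"
    using member_le_L2_set[of P j "\<lambda>j. \<bar>x j\<bar>"] assms(2) by (auto simp: L2_set_def)
  then show ?thesis by linarith
qed

lemma unit_vec_coord_space: "unit_vec j \<in> coord_space {j}"
  by (simp add: unit_vec_def coord_space_def)

lemma L2_set_unit_vec: "finite P \<Longrightarrow> j \<in> P \<Longrightarrow> L2_set (unit_vec j) P = 1"
  by (subst L2_set_coord_space[OF unit_vec_coord_space]) (auto simp: unit_vec_def L2_set_def)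

text \<open>The functions of the norm in the Hessian condition are replaced by constants
  \<open>cl\<close>, \<open>cu\<close>, \<open>ch\<close>, which suffice near \<beta>0; the
  assumptions tying them to the design come in the extension \<open>local_glm_curv\<close>.\<close>

locale local_glm =
  fixes \<mu> :: "real measure" and n p q :: nat and X :: "nat \<Rightarrow> nat \<Rightarrow> real" and \<beta>0 :: "nat \<Rightarrow> real"
    and cl cu ch :: real
  assumes expfam: "exp_family \<mu>" and n_pos: "n \<ge> 1" and q_pos: "q \<ge> 1"
    and true_param: "\<beta>0 \<in> coord_space {1..p}" and sparse: "card (supp \<beta>0) \<le> q"
    and cl_pos: "cl > 0" and cu_pos: "cu > 0" and ch_nonneg: "ch \<ge> 0"
begin

abbreviation (input) "nrm \<delta> \<equiv> L2_set \<delta> {1..p}"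
abbreviation (input) "lp \<equiv> lin_pred p X"
abbreviation (input) "ll \<equiv> loglik \<mu> n p X"

text \<open>The bilinear form of the Hessian at \<beta>, written through linear predictors so that
  bilinearity is immediate and no index set enters.\<close>

definition quad :: "(nat \<Rightarrow> real) \<Rightarrow> (nat \<Rightarrow> real) \<Rightarrow> (nat \<Rightarrow> real) \<Rightarrow> real" where
  "quad \<beta> \<delta> \<epsilon> = (\<Sum>i=1..n. deriv (deriv (cumulant \<mu>)) (lp \<beta> i) * (lp \<delta> i * lp \<epsilon> i))"

text \<open>The Bregman divergence of the total cumulant function at \<beta>0. It occurs in two
  roles: as the deterministic loss in the log-likelihood (\<open>loglik_expand\<close>) and as the
  logarithm of the moment generating function of the score (\<open>score_mgf\<close>).\<close>

definition bregman :: "(nat \<Rightarrow> real) \<Rightarrow> real" where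
  "bregman \<delta> = (\<Sum>i=1..n. cumulant \<mu> (lp \<beta>0 i + lp \<delta> i) - cumulant \<mu> (lp \<beta>0 i)
      - deriv (cumulant \<mu>) (lp \<beta>0 i) * lp \<delta> i)"

definition score :: "(nat \<Rightarrow> real) \<Rightarrow> (nat \<Rightarrow> real) \<Rightarrow> real" where
  "score y \<delta> = (\<Sum>i=1..n. (y i - deriv (cumulant \<mu>) (lp \<beta>0 i)) * lp \<delta> i)"

text \<open>The size bound is \<open>2 * q\<close> because a model that misses a true covariate is
  examined inside its union with the support.\<close>

definition adm :: "nat set \<Rightarrow> bool" where
  "adm J \<longleftrightarrow> J \<subseteq> {1..p} \<and> supp \<beta>0 \<subseteq> J \<and> card J \<le> 2 * q"

text \<open>Exact, since the log-likelihood is linear in the responses: for given \<delta>, the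
  responses enter the increment only through the linear form \<open>score y\<close>.\<close>

lemma loglik_expand:
  "ll y (\<lambda>j. \<beta>0 j + \<delta> j) = ll y \<beta>0 + score y \<delta> - bregman \<delta>"
  by (simp add: loglik_def score_def bregman_def lin_pred_add sum.distrib[symmetric] sum_subtractf[symmetric] algebra_simps)

lemma bregman_derivs:
  "((\<lambda>t. bregman (\<lambda>j. t * \<delta> j)) has_real_derivative
      (\<Sum>i=1..n. (deriv (cumulant \<mu>) (lp \<beta>0 i + t * lp \<delta> i) - deriv (cumulant \<mu>) (lp \<beta>0 i)) * lp \<delta> i)) (at t)"
  "((\<lambda>t. \<Sum>i=1..n. (deriv (cumulant \<mu>) (lp \<beta>0 i + t * lp \<delta> i) - deriv (cumulant \<mu>) (lp \<beta>0 i)) * lp \<delta> i)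
      has_real_derivative quad (\<lambda>j. \<beta>0 j + t * \<delta> j) \<delta> \<delta>) (at t)"
proof -
  have c1: "((\<lambda>t. cumulant \<mu> (a + t * x)) has_real_derivative deriv (cumulant \<mu>) (a + t * x) * x) (at t)" for a x t
    by (rule DERIV_chain'[of _ _ _ _ "cumulant \<mu>", rotated, OF cumulant_differentiable(1)[OF expfam]])
      (auto intro!: derivative_eq_intros)
  have c2: "((\<lambda>t. deriv (cumulant \<mu>) (a + t * x)) has_real_derivative deriv (deriv (cumulant \<mu>)) (a + t * x) * x) (at t)" for a x t
    by (rule DERIV_chain'[of _ _ _ _ "deriv (cumulant \<mu>)", rotated, OF cumulant_differentiable(2)[OF expfam]])
      (auto intro!: derivative_eq_intros)
  show "((\<lambda>t. bregman (\<lambda>j. t * \<delta> j)) has_real_derivative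
      (\<Sum>i=1..n. (deriv (cumulant \<mu>) (lp \<beta>0 i + t * lp \<delta> i) - deriv (cumulant \<mu>) (lp \<beta>0 i)) * lp \<delta> i)) (at t)"
    unfolding bregman_def lin_pred_scale
    by (intro DERIV_sum) (auto intro!: derivative_eq_intros c1 simp: algebra_simps)
  show "((\<lambda>t. \<Sum>i=1..n. (deriv (cumulant \<mu>) (lp \<beta>0 i + t * lp \<delta> i) - deriv (cumulant \<mu>) (lp \<beta>0 i)) * lp \<delta> i)
      has_real_derivative quad (\<lambda>j. \<beta>0 j + t * \<delta> j) \<delta> \<delta>) (at t)"
    unfolding quad_def lin_pred_add lin_pred_scale
    by (intro DERIV_sum) (auto intro!: derivative_eq_intros c2 simp: algebra_simps)
qed

lemma bregman_zero: "bregman (\<lambda>j. 0) = 0"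
  by (simp add: bregman_def lin_pred_def)

text \<open>Along the ray through \<delta> the value and the slope at 0 vanish, so the Lagrange
  remainder is a quadratic form at an intermediate point.\<close>

lemma bregman_taylor:
  obtains t where "0 < t" "t < 1" "bregman \<delta> = quad (\<lambda>j. \<beta>0 j + t * \<delta> j) \<delta> \<delta> / 2"
proof -
  define D where "D = (\<lambda>m t. if m = (0::nat) then bregman (\<lambda>j. t * \<delta> j) else if m = 1 then
      (\<Sum>i=1..n. (deriv (cumulant \<mu>) (lp \<beta>0 i + t * lp \<delta> i) - deriv (cumulant \<mu>) (lp \<beta>0 i)) * lp \<delta> i)
      else quad (\<lambda>j. \<beta>0 j + t * \<delta> j) \<delta> \<delta>)"
  have "\<exists>t>0. t < 1 \<and> D 0 1 = (\<Sum>m<2. D m 0 / fact m * 1 ^ m) + D 2 t / fact 2 * 1 ^ 2"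
  proof (rule Maclaurin)
    show "\<forall>m t. m < 2 \<and> 0 \<le> t \<and> t \<le> 1 \<longrightarrow> DERIV (D m) t :> D (Suc m) t"
    proof (intro allI impI)
      fix m :: nat and t :: real assume "m < 2 \<and> 0 \<le> t \<and> t \<le> 1"
      then have "m = 0 \<or> m = 1" by auto
      then show "DERIV (D m) t :> D (Suc m) t"
        using bregman_derivs[of \<delta> t] by (auto simp: D_def)
    qed
  qed auto
  then obtain t where "t > 0" "t < 1" "D 0 1 = (\<Sum>m<2. D m 0 / fact m * 1 ^ m) + D 2 t / fact 2 * 1 ^ 2"
    by auto
  then show ?thesis using that[of t] by (simp add: D_def numeral_2_eq_2 bregman_zero)
qed

lemma score_add: "score y (\<lambda>j. \<delta> j + \<epsilon> j) = score y \<delta> + score y \<epsilon>"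
  by (simp add: score_def lin_pred_add distrib_left sum.distrib)

lemma score_scale: "score y (\<lambda>j. c * \<delta> j) = c * score y \<delta>"
  by (simp add: score_def lin_pred_scale sum_distrib_left mult_ac)

lemma score_sum: "score y (\<lambda>k. \<Sum>j\<in>V. v j * d j k) = (\<Sum>j\<in>V. v j * score y (d j))"
  unfolding score_def lin_pred_sum sum_distrib_left
  by (subst sum.swap) (simp add: mult_ac)

lemma score_bound:
  assumes "finite V" "\<And>j. j \<in> V \<Longrightarrow> \<bar>score y (d j)\<bar> \<le> B" "B \<ge> 0"
  shows "\<bar>score y (\<lambda>k. \<Sum>j\<in>V. v j * d j k)\<bar> \<le> B * sqrt (card V) * L2_set v V"
proof -
  have "\<bar>score y (\<lambda>k. \<Sum>j\<in>V. v j * d j k)\<bar> \<le> (\<Sum>j\<in>V. \<bar>v j\<bar> * \<bar>score y (d j)\<bar>)"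
    unfolding score_sum by (intro order_trans[OF sum_abs]) (simp add: abs_mult)
  also have "\<dots> \<le> (\<Sum>j\<in>V. \<bar>v j\<bar> * \<bar>B\<bar>)"
    using assms by (intro sum_mono mult_left_mono) auto
  also have "\<dots> \<le> L2_set v V * L2_set (\<lambda>_. B) V" by (rule L2_set_mult_ineq)
  also have "L2_set (\<lambda>_. B) V = B * sqrt (card V)"
    using assms(3) by (simp add: L2_set_def real_sqrt_mult)
  finally show ?thesis by (simp add: mult_ac)
qed

lemma quad_commute: "quad \<beta> \<delta> \<epsilon> = quad \<beta> \<epsilon> \<delta>"
  by (simp add: quad_def mult_ac)

lemma quad_add: "quad \<beta> (\<lambda>j. \<delta> j + \<delta>' j) \<epsilon> = quad \<beta> \<delta> \<epsilon> + quad \<beta> \<delta>' \<epsilon>"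
  by (simp add: quad_def lin_pred_add algebra_simps sum.distrib)

lemma quad_add2: "quad \<beta> \<epsilon> (\<lambda>j. \<delta> j + \<delta>' j) = quad \<beta> \<epsilon> \<delta> + quad \<beta> \<epsilon> \<delta>'"
  by (simp add: quad_def lin_pred_add algebra_simps sum.distrib)

lemma quad_diff: "quad \<beta> (\<lambda>j. \<delta> j - \<delta>' j) \<epsilon> = quad \<beta> \<delta> \<epsilon> - quad \<beta> \<delta>' \<epsilon>"
  by (simp add: quad_def lin_pred_diff algebra_simps sum_subtractf)

lemma quad_scale: "quad \<beta> (\<lambda>j. c * \<delta> j) \<epsilon> = c * quad \<beta> \<delta> \<epsilon>"
  by (simp add: quad_def lin_pred_scale sum_distrib_left mult_ac)

lemma quad_scale2: "quad \<beta> \<epsilon> (\<lambda>j. c * \<delta> j) = c * quad \<beta> \<epsilon> \<delta>"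
  by (simp add: quad_def lin_pred_scale sum_distrib_left mult_ac)

lemma quad_sum: "quad \<beta> (\<lambda>k. \<Sum>j\<in>V. v j * d j k) \<epsilon> = (\<Sum>j\<in>V. v j * quad \<beta> (d j) \<epsilon>)"
  unfolding quad_def lin_pred_sum sum_distrib_left sum_distrib_right
  by (subst sum.swap) (simp add: mult_ac)

lemma supp_finite: "finite (supp \<beta>0)" and supp_subset: "supp \<beta>0 \<subseteq> {1..p}"
proof -
  show "supp \<beta>0 \<subseteq> {1..p}" using true_param by (auto simp: supp_def coord_space_def)
  then show "finite (supp \<beta>0)" by (rule finite_subset) simp
qed

lemma beta0_supp: "\<beta>0 \<in> coord_space (supp \<beta>0)"
  by (simp add: supp_def coord_space_def)

lemma adm_supp: "adm (supp \<beta>0)"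
  using supp_subset sparse by (auto simp: adm_def)

lemma admD: "adm J \<Longrightarrow> J \<subseteq> {1..p}" "adm J \<Longrightarrow> supp \<beta>0 \<subseteq> J" "adm J \<Longrightarrow> finite J"
  by (auto simp: adm_def intro: finite_subset)

lemma beta0_adm: "adm J \<Longrightarrow> \<beta>0 \<in> coord_space J"
  using beta0_supp coord_space_mono admD(2) by blast

end

text \<open>Two-sided bounds are asked only within distance 1 of \<beta>0, where constants can
  replace functions of the norm. Nonnegativity on the whole model makes \<open>bregman\<close>
  convex along rays, which controls the likelihood far out.\<close>

locale local_glm_curv = local_glm +
  assumes curv_lower: "\<And>J \<beta> \<delta>. adm J \<Longrightarrow> \<beta> \<in> coord_space J \<Longrightarrow> L2_set (\<lambda>j. \<beta> j - \<beta>0 j) {1..p} \<le> 1 \<Longrightarrow>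
      \<delta> \<in> coord_space J \<Longrightarrow> cl * real n * (L2_set \<delta> {1..p})\<^sup>2 \<le> quad \<beta> \<delta> \<delta>"
    and curv_upper: "\<And>J \<beta> \<delta>. adm J \<Longrightarrow> \<beta> \<in> coord_space J \<Longrightarrow> L2_set (\<lambda>j. \<beta> j - \<beta>0 j) {1..p} \<le> 1 \<Longrightarrow>
      \<delta> \<in> coord_space J \<Longrightarrow> quad \<beta> \<delta> \<delta> \<le> cu * real n * (L2_set \<delta> {1..p})\<^sup>2"
    and curv_nonneg: "\<And>J \<beta> \<delta>. adm J \<Longrightarrow> \<beta> \<in> coord_space J \<Longrightarrow> \<delta> \<in> coord_space J \<Longrightarrow> 0 \<le> quad \<beta> \<delta> \<delta>"
    and curv_change: "\<And>J \<beta> \<delta>. adm J \<Longrightarrow> \<beta> \<in> coord_space J \<Longrightarrow> \<delta> \<in> coord_space J \<Longrightarrow>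
      \<bar>quad \<beta> \<delta> \<delta> - quad \<beta>0 \<delta> \<delta>\<bar> \<le> ch * real n * L2_set (\<lambda>j. \<beta> j - \<beta>0 j) {1..p} * (L2_set \<delta> {1..p})\<^sup>2"
begin

lemma segment:
  assumes "adm J" "\<delta> \<in> coord_space J"
  shows "(\<lambda>j. \<beta>0 j + t * \<delta> j) \<in> coord_space J"
    and "0 \<le> t \<Longrightarrow> t \<le> 1 \<Longrightarrow> L2_set (\<lambda>j. (\<beta>0 j + t * \<delta> j) - \<beta>0 j) {1..p} \<le> nrm \<delta>"
proof -
  show "(\<lambda>j. \<beta>0 j + t * \<delta> j) \<in> coord_space J"
    using beta0_adm[OF assms(1)] assms(2) by (auto simp: coord_space_def)
  assume "0 \<le> t" "t \<le> 1"
  then show "L2_set (\<lambda>j. (\<beta>0 j + t * \<delta> j) - \<beta>0 j) {1..p} \<le> nrm \<delta>"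
    by (simp add: L2_set_scale mult_left_le_one_le L2_set_nonneg)
qed

lemma bregman_bounds:
  assumes "adm J" "\<delta> \<in> coord_space J" "nrm \<delta> \<le> 1"
  shows "cl * real n * (nrm \<delta>)\<^sup>2 / 2 \<le> bregman \<delta>" "bregman \<delta> \<le> cu * real n * (nrm \<delta>)\<^sup>2 / 2"
proof -
  obtain t where t: "0 < t" "t < 1" "bregman \<delta> = quad (\<lambda>j. \<beta>0 j + t * \<delta> j) \<delta> \<delta> / 2"
    by (rule bregman_taylor)
  have l: "L2_set (\<lambda>j. (\<beta>0 j + t * \<delta> j) - \<beta>0 j) {1..p} \<le> 1"
    using segment(2)[OF assms(1,2), of t] t assms(3) by linarith
  show "cl * real n * (nrm \<delta>)\<^sup>2 / 2 \<le> bregman \<delta>"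
    using curv_lower[OF assms(1) segment(1)[OF assms(1,2)] l assms(2)] t(3) by simp
  show "bregman \<delta> \<le> cu * real n * (nrm \<delta>)\<^sup>2 / 2"
    using curv_upper[OF assms(1) segment(1)[OF assms(1,2)] l assms(2)] t(3) by simp
qed

lemma bregman_quad:
  assumes "adm J" "\<delta> \<in> coord_space J"
  shows "\<bar>bregman \<delta> - quad \<beta>0 \<delta> \<delta> / 2\<bar> \<le> ch * real n * (nrm \<delta>) ^ 3 / 2"
proof -
  obtain t where t: "0 < t" "t < 1" "bregman \<delta> = quad (\<lambda>j. \<beta>0 j + t * \<delta> j) \<delta> \<delta> / 2"
    by (rule bregman_taylor)
  have "\<bar>quad (\<lambda>j. \<beta>0 j + t * \<delta> j) \<delta> \<delta> - quad \<beta>0 \<delta> \<delta>\<bar>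
      \<le> ch * real n * L2_set (\<lambda>j. (\<beta>0 j + t * \<delta> j) - \<beta>0 j) {1..p} * (nrm \<delta>)\<^sup>2"
    by (rule curv_change[OF assms(1) segment(1)[OF assms] assms(2)])
  also have "\<dots> \<le> ch * real n * nrm \<delta> * (nrm \<delta>)\<^sup>2"
    using segment(2)[OF assms, of t] t ch_nonneg by (intro mult_right_mono mult_left_mono) auto
  also have "\<dots> = ch * real n * (nrm \<delta>) ^ 3" by (simp add: power3_eq_cube power2_eq_square)
  finally show ?thesis unfolding t(3) by (simp add: diff_divide_distrib[symmetric])
qed

text \<open>By convexity along the ray, the quadratic lower bound on the sphere of radius \<rho>
  extends to linear growth beyond it. Linear growth is enough, because the competing score is linear
  as well.\<close>

lemma bregman_tail:
  assumes "adm J" "\<delta> \<in> coord_space J" "0 < \<rho>" "\<rho> \<le> 1" "\<rho> \<le> nrm \<delta>"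
  shows "cl * real n * \<rho> * nrm \<delta> / 2 \<le> bregman \<delta>"
proof -
  define t where "t = \<rho> / nrm \<delta>"
  have pos: "nrm \<delta> > 0" using assms by linarith
  have t: "0 < t" "t \<le> 1" "t * nrm \<delta> = \<rho>" using assms pos by (auto simp: t_def)
  define g where "g = (\<lambda>t. bregman (\<lambda>j. t * \<delta> j))"
  have "convex_on UNIV g"
    unfolding g_def
    by (rule f''_ge0_imp_convex[OF convex_UNIV bregman_derivs(1) bregman_derivs(2)])
      (use curv_nonneg[OF assms(1) segment(1)[OF assms(1,2)] assms(2)] in auto)
  from convex_onD[OF this, of t 0 1] t have "g t \<le> t * bregman \<delta>"
    by (simp add: g_def bregman_zero)
  moreover have "cl * real n * \<rho>\<^sup>2 / 2 \<le> g t"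
    using bregman_bounds(1)[OF assms(1) coord_space_scale[OF assms(2)], of t] t assms(4)
    by (simp add: g_def L2_set_scale)
  ultimately have "cl * real n * \<rho>\<^sup>2 / 2 \<le> t * bregman \<delta>" by linarith
  moreover have "cl * real n * \<rho>\<^sup>2 / 2 = t * (cl * real n * \<rho> * nrm \<delta> / 2)"
    using t(3) by (simp add: power2_eq_square mult_ac)
  ultimately show ?thesis using t(1) by simp
qed

section \<open>Orthogonal projection in the inner product of the Hessian at \<beta>0\<close>

lemma quad_pos:
  assumes "adm J" "\<delta> \<in> coord_space J" "\<delta> \<noteq> (\<lambda>_. 0)"
  shows "0 < quad \<beta>0 \<delta> \<delta>"
proof -
  have "0 < nrm \<delta>" using L2_set_pos[of \<delta> "{1..p}"] assms coord_space_mono admD(1) by blast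
  then have "0 < cl * real n * (nrm \<delta>)\<^sup>2" using cl_pos n_pos by simp
  also have "\<dots> \<le> quad \<beta>0 \<delta> \<delta>"
    using curv_lower[OF assms(1) beta0_adm[OF assms(1)] _ assms(2)] by (simp add: L2_set_def)
  finally show ?thesis .
qed

text \<open>Gram-Schmidt by induction on \<open>S\<close>: the new basis vector \<open>e\<close> is
  \<open>unit_vec k\<close> minus its projection onto \<open>coord_space S\<close>, and positive
  definiteness on the support allows division by \<open>quad \<beta>0 e e\<close>.\<close>

lemma projection:
  assumes "S \<subseteq> supp \<beta>0"
  shows "\<exists>u\<in>coord_space S. \<forall>s\<in>coord_space S. quad \<beta>0 (\<lambda>j. x j - u j) s = 0"
proof -
  have "finite S" using assms supp_finite finite_subset by blast
  then show ?thesis using assms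
  proof (induction S arbitrary: x rule: finite_induct)
    case empty
    show ?case by (rule bexI[of _ "\<lambda>_. 0"]) (auto simp: coord_space_def quad_def lin_pred_def)
  next
    case (insert k S)
    from insert.IH[of "unit_vec k"] insert.prems obtain w where
      w: "w \<in> coord_space S" "\<And>s. s \<in> coord_space S \<Longrightarrow> quad \<beta>0 (\<lambda>j. unit_vec k j - w j) s = 0"
      by auto
    from insert.IH[of x] insert.prems obtain u where
      u: "u \<in> coord_space S" "\<And>s. s \<in> coord_space S \<Longrightarrow> quad \<beta>0 (\<lambda>j. x j - u j) s = 0"
      by auto
    define e where "e = (\<lambda>j. unit_vec k j - w j)"
    have e: "e \<in> coord_space (insert k S)" using w(1) by (auto simp: e_def coord_space_def unit_vec_def)
    have "e k = 1" using w(1) insert.hyps(2) by (auto simp: e_def coord_space_def unit_vec_def)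
    then have "e \<noteq> (\<lambda>_. 0)" by auto
    then have pos: "quad \<beta>0 e e > 0"
      using quad_pos[OF adm_supp coord_space_mono[OF insert.prems e]] by simp
    define r where "r = quad \<beta>0 (\<lambda>j. x j - u j) e / quad \<beta>0 e e"
    define u' where "u' = (\<lambda>j. u j + r * e j)"
    have eq: "(\<lambda>j. x j - u' j) = (\<lambda>j. (x j - u j) - r * e j)" by (auto simp: u'_def)
    have "quad \<beta>0 (\<lambda>j. x j - u' j) s = 0" if s: "s \<in> coord_space (insert k S)" for s
    proof -
      \<comment> \<open>Since \<open>e k = 1\<close>, subtracting \<open>s k * e\<close> removes
        coordinate \<open>k\<close> and leaves a vector of \<open>coord_space S\<close>.\<close>
      define s' where "s' = (\<lambda>j. s j - s k * e j)"
      have s': "s' \<in> coord_space S"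
        unfolding coord_space_def
      proof (intro CollectI allI impI)
        fix j assume "j \<notin> S"
        then show "s' j = 0" using s e \<open>e k = 1\<close> by (cases "j = k") (auto simp: s'_def coord_space_def)
      qed
      have "quad \<beta>0 (\<lambda>j. (x j - u j) - r * e j) s'
          = quad \<beta>0 (\<lambda>j. x j - u j) s' - r * quad \<beta>0 e s'"
        by (simp add: quad_diff[of _ "\<lambda>j. x j - u j" "\<lambda>j. r * e j"] quad_scale)
      also have "\<dots> = 0" using u(2)[OF s'] w(2)[OF s'] by (simp add: e_def)
      finally have 1: "quad \<beta>0 (\<lambda>j. (x j - u j) - r * e j) s' = 0" .
      have 2: "quad \<beta>0 (\<lambda>j. (x j - u j) - r * e j) e = 0"
      proof -
        have "quad \<beta>0 (\<lambda>j. (x j - u j) - r * e j) e = quad \<beta>0 (\<lambda>j. x j - u j) e - r * quad \<beta>0 e e"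
          by (simp add: quad_diff[of _ "\<lambda>j. x j - u j" "\<lambda>j. r * e j"] quad_scale)
        also have "\<dots> = 0" using pos by (simp add: r_def)
        finally show ?thesis .
      qed
      have "s = (\<lambda>j. s' j + s k * e j)" by (auto simp: s'_def)
      then have "quad \<beta>0 (\<lambda>j. (x j - u j) - r * e j) s = quad \<beta>0 (\<lambda>j. (x j - u j) - r * e j) (\<lambda>j. s' j + s k * e j)"
        by simp
      also have "\<dots> = 0" unfolding quad_add2 quad_scale2 1 2 by simp
      finally show ?thesis unfolding eq .
    qed
    moreover have "u' \<in> coord_space (insert k S)" using u(1) e by (auto simp: u'_def coord_space_def)
    ultimately show ?case by blast
  qed
qed

text \<open>The covariate \<open>j\<close> after projecting out the true covariates, in the inner product given by the Hessian at \<open>\<beta>0\<close>.\<close>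

definition orth :: "nat \<Rightarrow> nat \<Rightarrow> real" where
  "orth j = (SOME d. (\<lambda>k. d k - unit_vec j k) \<in> coord_space (supp \<beta>0) \<and>
      (\<forall>s\<in>coord_space (supp \<beta>0). quad \<beta>0 d s = 0))"

lemma orth:
  "(\<lambda>k. orth j k - unit_vec j k) \<in> coord_space (supp \<beta>0)"
  "s \<in> coord_space (supp \<beta>0) \<Longrightarrow> quad \<beta>0 (orth j) s = 0"
proof -
  obtain u where u: "u \<in> coord_space (supp \<beta>0)"
      "\<forall>s\<in>coord_space (supp \<beta>0). quad \<beta>0 (\<lambda>k. unit_vec j k - u k) s = 0"
    using projection[OF order_refl, of "unit_vec j"] by blast
  have "(\<lambda>k. orth j k - unit_vec j k) \<in> coord_space (supp \<beta>0) \<and>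
      (\<forall>s\<in>coord_space (supp \<beta>0). quad \<beta>0 (orth j) s = 0)"
    unfolding orth_def
    by (rule someI[of _ "\<lambda>k. unit_vec j k - u k"]) (use u in \<open>auto simp: coord_space_def\<close>)
  then show "(\<lambda>k. orth j k - unit_vec j k) \<in> coord_space (supp \<beta>0)"
    "s \<in> coord_space (supp \<beta>0) \<Longrightarrow> quad \<beta>0 (orth j) s = 0" by auto
qed

text \<open>The vector \<open>d\<close> of the decomposition as a linear function of the extra
  coordinates. It agrees with \<open>v\<close> outside the support, so passing from \<open>v\<close>
  to \<open>lift V v\<close> is a shear along the support and preserves volume.\<close>

definition lift :: "nat set \<Rightarrow> (nat \<Rightarrow> real) \<Rightarrow> nat \<Rightarrow> real" where
  "lift V v = (\<lambda>k. \<Sum>j\<in>V. v j * orth j k)"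

lemma lift_orth: "s \<in> coord_space (supp \<beta>0) \<Longrightarrow> quad \<beta>0 (lift V v) s = 0"
  unfolding lift_def quad_sum by (simp add: orth(2))

lemma lift_diff:
  assumes "finite V" "v \<in> coord_space V"
  shows "(\<lambda>k. lift V v k - v k) \<in> coord_space (supp \<beta>0)"
proof -
  have "lift V v k = v k" if "k \<notin> supp \<beta>0" for k
  proof -
    have "orth j k = unit_vec j k" for j using orth(1)[of j] that by (auto simp: coord_space_def)
    then have "lift V v k = (\<Sum>j\<in>V. if j = k then v j else 0)"
      by (auto simp: lift_def unit_vec_def intro!: sum.cong)
    also have "\<dots> = v k" using assms by (auto simp: coord_space_def)
    finally show ?thesis .
  qed
  then show ?thesis by (simp add: coord_space_def)
qed

lemma lift_coord_space:
  assumes "finite V" "v \<in> coord_space V"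
  shows "lift V v \<in> coord_space (supp \<beta>0 \<union> V)"
  using lift_diff[OF assms] assms(2) by (auto simp: coord_space_def)

text \<open>On \<open>V\<close> the lift coincides with \<open>v\<close>, which gives the first two
  bounds. The third is Pythagoras for the Hessian form: projecting can only lower
  \<open>quad\<close>, and comparing \<open>cl\<close> with \<open>cu\<close> converts this into
  Euclidean norms.\<close>

lemma lift_bounds:
  assumes a: "adm (supp \<beta>0 \<union> V)" and dis: "V \<inter> supp \<beta>0 = {}" and v: "v \<in> coord_space V"
  shows "nrm v \<le> nrm (lift V v)" "cl * real n * (nrm v)\<^sup>2 \<le> quad \<beta>0 (lift V v) (lift V v)"
    "nrm (lift V v) \<le> sqrt (cu / cl) * nrm v"
proof -
  have fV: "finite V" using admD(3)[OF a] by simp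
  have VP: "V \<subseteq> {1..p}" using admD(1)[OF a] by simp
  note d = lift_coord_space[OF fV v] and df = lift_diff[OF fV v]
  have b0: "\<beta>0 \<in> coord_space (supp \<beta>0 \<union> V)" by (rule beta0_adm[OF a])
  have z: "L2_set (\<lambda>j. \<beta>0 j - \<beta>0 j) {1..p} \<le> 1" by (simp add: L2_set_def)
  have "L2_set v V = L2_set (lift V v) V"
    using df dis by (intro L2_set_cong) (auto simp: coord_space_def)
  also have "\<dots> \<le> nrm (lift V v)" by (rule L2_set_mono_on[OF VP]) simp
  finally show nv: "nrm v \<le> nrm (lift V v)" using L2_set_coord_space[OF v VP] by simp
  have lo: "cl * real n * (nrm (lift V v))\<^sup>2 \<le> quad \<beta>0 (lift V v) (lift V v)"
    by (rule curv_lower[OF a b0 z d])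
  have "cl * real n * (nrm v)\<^sup>2 \<le> cl * real n * (nrm (lift V v))\<^sup>2"
    using nv cl_pos by (intro mult_left_mono power_mono) (auto simp: L2_set_nonneg)
  with lo show "cl * real n * (nrm v)\<^sup>2 \<le> quad \<beta>0 (lift V v) (lift V v)" by linarith
  define w where "w = (\<lambda>k. v k - lift V v k)"
  have w: "w \<in> coord_space (supp \<beta>0)" using df by (auto simp: w_def coord_space_def)
  have "quad \<beta>0 v v = quad \<beta>0 (\<lambda>k. lift V v k + w k) (\<lambda>k. lift V v k + w k)" by (simp add: w_def)
  also have "\<dots> = quad \<beta>0 (lift V v) (lift V v) + quad \<beta>0 w w"
    unfolding quad_add quad_add2 using lift_orth[OF w] quad_commute[of \<beta>0 w "lift V v"] by simp
  also have "\<dots> \<ge> quad \<beta>0 (lift V v) (lift V v)"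
    using curv_nonneg[OF adm_supp beta0_supp w] by simp
  finally have "quad \<beta>0 (lift V v) (lift V v) \<le> quad \<beta>0 v v" .
  moreover have "quad \<beta>0 v v \<le> cu * real n * (nrm v)\<^sup>2"
    using v by (intro curv_upper[OF a b0 z]) (auto simp: coord_space_def)
  ultimately have "cl * real n * (nrm (lift V v))\<^sup>2 \<le> cu * real n * (nrm v)\<^sup>2" using lo by linarith
  then have "(nrm (lift V v))\<^sup>2 \<le> (sqrt (cu / cl) * nrm v)\<^sup>2"
    using cl_pos cu_pos n_pos by (simp add: power_mult_distrib field_simps)
  then show "nrm (lift V v) \<le> sqrt (cu / cl) * nrm v"
    by (rule power2_le_imp_le) (use cl_pos cu_pos in \<open>auto simp: L2_set_nonneg\<close>)
qed

text \<open>Orthogonality removes the cross term, so the quadratic parts of \<open>u\<close> and of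
  the lift separate. Of the two cubic errors, one is for passing from \<open>bregman\<close> to
  \<open>quad\<close> at \<open>u + d\<close>, the other for passing back at
  \<open>u\<close>.\<close>

lemma loglik_shift_le:
  assumes a: "adm (supp \<beta>0 \<union> V)" and v: "v \<in> coord_space V" and u: "u \<in> coord_space (supp \<beta>0)"
  shows "ll y (\<lambda>j. \<beta>0 j + (u j + lift V v j)) \<le> ll y (\<lambda>j. \<beta>0 j + u j)
      + score y (lift V v) - quad \<beta>0 (lift V v) (lift V v) / 2
      + ch * real n * ((nrm (\<lambda>j. u j + lift V v j)) ^ 3 + (nrm u) ^ 3) / 2"
proof -
  have fV: "finite V" using admD(3)[OF a] by simp
  let ?d = "lift V v"
  have ud: "(\<lambda>j. u j + ?d j) \<in> coord_space (supp \<beta>0 \<union> V)"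
    using lift_coord_space[OF fV v] u by (auto simp: coord_space_def)
  have "quad \<beta>0 (\<lambda>j. u j + ?d j) (\<lambda>j. u j + ?d j) = quad \<beta>0 u u + quad \<beta>0 ?d ?d"
    unfolding quad_add quad_add2 using lift_orth[OF u] quad_commute[of \<beta>0 u ?d] by simp
  then show ?thesis
    using bregman_quad[OF a ud] bregman_quad[OF adm_supp u]
    unfolding loglik_expand score_add abs_le_iff by (simp add: field_simps)
qed

lemma score_bound_unit:
  assumes "J \<subseteq> {1..p}" "\<delta> \<in> coord_space J" "B \<ge> 0" "\<And>j. j \<in> {1..p} \<Longrightarrow> \<bar>score y (unit_vec j)\<bar> \<le> B"
  shows "\<bar>score y \<delta>\<bar> \<le> B * sqrt (card J) * nrm \<delta>"
proof -
  have fJ: "finite J" using assms(1) by (rule finite_subset) simp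
  have "\<delta> = (\<lambda>k. \<Sum>j\<in>J. \<delta> j * unit_vec j k)"
    using assms(2) fJ by (auto simp: unit_vec_def coord_space_def if_distrib[of "\<lambda>x. _ * x"] cong: if_cong)
  then have "\<bar>score y \<delta>\<bar> = \<bar>score y (\<lambda>k. \<Sum>j\<in>J. \<delta> j * unit_vec j k)\<bar>" by simp
  also have "\<dots> \<le> B * sqrt (card J) * L2_set \<delta> J"
    using assms by (intro score_bound fJ) auto
  finally show ?thesis using L2_set_coord_space[OF assms(2,1)] by simp
qed

end

subsection \<open>Bounds on the evidence\<close>

lemma lint_Fubini:
  assumes M: "sigma_finite_measure M" and V: "finite V"
    and G: "case_prod G \<in> borel_measurable (M \<Otimes>\<^sub>M vecM)"
  shows "(\<integral>\<^sup>+\<omega>. lint V (G \<omega>) \<partial>M) = lint V (\<lambda>v. \<integral>\<^sup>+\<omega>. G \<omega> v \<partial>M)" (is ?Fub)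
    and "(\<lambda>\<omega>. lint V (G \<omega>)) \<in> borel_measurable M" (is ?meas)
proof -
  interpret A: sigma_finite_measure M by fact
  interpret B: sigma_finite_measure "Pi\<^sub>M V (\<lambda>_. lborel :: real measure)"
    by (rule lborel_prod.sigma_finite[OF V])
  interpret pair_sigma_finite "Pi\<^sub>M V (\<lambda>_. lborel :: real measure)" M ..
  have "(\<lambda>(\<omega>, b). (\<omega>, zero_fill V b)) \<in> measurable (M \<Otimes>\<^sub>M Pi\<^sub>M V (\<lambda>_. lborel)) (M \<Otimes>\<^sub>M vecM)"
    unfolding split_beta' by (intro measurable_Pair measurable_compose[OF measurable_snd zero_fill_measurable]) simp
  from measurable_compose[OF this G]
  have G': "(\<lambda>(\<omega>, b). G \<omega> (zero_fill V b)) \<in> borel_measurable (M \<Otimes>\<^sub>M Pi\<^sub>M V (\<lambda>_. lborel))"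
    by (simp add: split_beta')
  then show ?meas unfolding lint_def by (rule B.borel_measurable_nn_integral)
  have "(\<lambda>(b, \<omega>). G \<omega> (zero_fill V b)) \<in> borel_measurable (Pi\<^sub>M V (\<lambda>_. lborel) \<Otimes>\<^sub>M M)"
    using measurable_pair_swap[OF G'] by (simp add: split_beta')
  from Fubini'[OF this] show ?Fub unfolding lint_def .
qed

lemma L2_set_measurable [measurable]: "(\<lambda>v. L2_set v P) \<in> borel_measurable vecM"
  unfolding L2_set_def by measurable

lemma lin_pred_measurable [measurable]: "(\<lambda>v. lin_pred p X v i) \<in> borel_measurable vecM"
  unfolding lin_pred_def by measurable

lemma L2_set_shift_measurable: "(\<lambda>v. L2_set (\<lambda>j. v j - c j) P) \<in> borel_measurable vecM"
  unfolding L2_set_def by measurable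

lemma L2_ball_sets [measurable]:
  "{v. L2_set v P \<le> r} \<in> sets vecM"
  "{v. L2_set (\<lambda>j. v j - c j) P \<le> r} \<in> sets vecM"
proof -
  note [measurable] = L2_set_shift_measurable
  have "{v \<in> space vecM. L2_set v P \<le> r} \<in> sets vecM"
    "{v \<in> space vecM. L2_set (\<lambda>j. v j - c j) P \<le> r} \<in> sets vecM"
    by measurable
  then show "{v. L2_set v P \<le> r} \<in> sets vecM"
    "{v. L2_set (\<lambda>j. v j - c j) P \<le> r} \<in> sets vecM" by (simp_all add: space_PiM)
qed

context local_glm begin

lemma cumulant_measurable [measurable]: "cumulant \<mu> \<in> borel_measurable borel"
  by (intro borel_measurable_continuous_onI continuous_at_imp_continuous_on ballI)
    (rule DERIV_isCont[OF cumulant_differentiable(1)[OF expfam]])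

lemma loglik_measurable [measurable]: "ll y \<in> borel_measurable vecM"
  unfolding loglik_def by measurable

lemma evidence_lint:
  assumes "J \<subseteq> {1..p}" "card J \<le> q" "prior_density J (f J)"
  shows "(\<lambda>\<beta>. ennreal (f J (zero_fill J \<beta>))) \<in> borel_measurable (Pi\<^sub>M J (\<lambda>_. lborel))"
    "evidence \<mu> n p X y f J =
      (\<integral>\<^sup>+\<beta>. ennreal (exp (ll y (zero_fill J \<beta>))) * ennreal (f J (zero_fill J \<beta>)) \<partial>(\<Pi>\<^sub>M j\<in>J. lborel))"
  using assms(3) unfolding prior_density_def evidence_def
  by (auto simp: ennreal_mult' zero_fill_coord_space intro!: nn_integral_cong)

lemma evidence_le:
  assumes J: "J \<subseteq> {1..p}" "card J \<le> q" "prior_density J (f J)"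
    and le: "\<And>\<beta>. \<beta> \<in> coord_space J \<Longrightarrow> ll y \<beta> \<le> C"
  shows "evidence \<mu> n p X y f J \<le> ennreal (exp C)"
proof -
  have "evidence \<mu> n p X y f J \<le> (\<integral>\<^sup>+\<beta>. ennreal (exp C) * ennreal (f J (zero_fill J \<beta>)) \<partial>(\<Pi>\<^sub>M j\<in>J. lborel))"
    unfolding evidence_lint(2)[where f = f and J = J, OF J]
    by (intro nn_integral_mono mult_right_mono ennreal_leI) (auto intro!: le zero_fill_coord_space)
  also have "\<dots> = ennreal (exp C)"
    using J(3) by (subst nn_integral_cmult[OF evidence_lint(1)[where f = f and J = J, OF J]]) (simp add: prior_density_def)
  finally show ?thesis .
qed

text \<open>Near \<beta>0 the prior is bounded by \<open>F3\<close>, which leaves a Lebesgue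
  integral of the likelihood; far away the likelihood is bounded instead, and the prior contributes
  at most its total mass 1.\<close>

lemma evidence_split:
  assumes J: "J \<subseteq> {1..p}" "card J \<le> q" "prior_density J (f J)"
    and F3: "\<And>\<beta>. \<beta> \<in> coord_space J \<Longrightarrow> f J \<beta> \<le> F3"
    and le: "\<And>\<beta>. \<beta> \<in> coord_space J \<Longrightarrow> R < nrm (\<lambda>j. \<beta> j - \<beta>0 j) \<Longrightarrow> ll y \<beta> \<le> C"
  shows "evidence \<mu> n p X y f J \<le> ennreal F3 *
      lint J (\<lambda>\<beta>. indicator {\<beta>. nrm (\<lambda>j. \<beta> j - \<beta>0 j) \<le> R} \<beta> * ennreal (exp (ll y \<beta>)))
      + ennreal (exp C)"
proof -
  define h where "h = (\<lambda>\<beta>. indicator {\<beta>. nrm (\<lambda>j. \<beta> j - \<beta>0 j) \<le> R} \<beta> * ennreal (exp (ll y \<beta>)))"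
  have hm: "h \<in> borel_measurable vecM"
    unfolding h_def by measurable
  have "evidence \<mu> n p X y f J \<le>
    (\<integral>\<^sup>+\<beta>. ennreal F3 * h (zero_fill J \<beta>) + ennreal (exp C) * ennreal (f J (zero_fill J \<beta>)) \<partial>(\<Pi>\<^sub>M j\<in>J. lborel))"
    unfolding evidence_lint(2)[where f = f and J = J, OF J]
  proof (intro nn_integral_mono)
    fix b :: "nat \<Rightarrow> real"
    let ?b = "zero_fill J b"
    show "ennreal (exp (ll y ?b)) * ennreal (f J ?b)
        \<le> ennreal F3 * h ?b + ennreal (exp C) * ennreal (f J ?b)"
    proof (cases "nrm (\<lambda>j. ?b j - \<beta>0 j) \<le> R")
      case True
      then have "ennreal (exp (ll y ?b)) * ennreal (f J ?b) \<le> h ?b * ennreal F3"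
        using F3[OF zero_fill_coord_space] by (auto simp: h_def intro!: mult_left_mono ennreal_leI)
      then show ?thesis by (simp add: mult.commute add_increasing2)
    next
      case False
      then have "ll y ?b \<le> C" by (intro le zero_fill_coord_space) auto
      then have "ennreal (exp (ll y ?b)) * ennreal (f J ?b) \<le> ennreal (exp C) * ennreal (f J ?b)"
        by (intro mult_right_mono ennreal_leI) auto
      then show ?thesis by (simp add: add_increasing)
    qed
  qed
  also have "\<dots> = ennreal F3 * lint J h + ennreal (exp C) * 1"
    using J(3) evidence_lint(1)[where f = f and J = J, OF J] zero_fill_compose_measurable[OF hm]
    by (subst nn_integral_add) (auto simp: nn_integral_cmult lint_def prior_density_def)
  finally show ?thesis by (simp add: h_def)
qed

text \<open>The yardstick common to the true model and its supersets: it bounds the evidence of the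
  former from below and, multiplied by \<open>excess\<close>, the local evidence of the latter from
  above. No Laplace approximation of it is computed.\<close>

definition local_lik :: "(nat \<Rightarrow> real) \<Rightarrow> real \<Rightarrow> ennreal" where
  "local_lik y r = lint (supp \<beta>0) (\<lambda>u. indicator {u. nrm u \<le> r} u *
      ennreal (exp (ll y (\<lambda>j. \<beta>0 j + u j))))"

lemma loglik_shift_measurable [measurable]:
  "(\<lambda>u. ll y (\<lambda>j. \<beta>0 j + u j)) \<in> borel_measurable vecM"
  using measurable_compose[OF vec_shift_measurable[of \<beta>0] loglik_measurable[of y]]
  by (simp add: add.commute)

text \<open>Here the room between the norm of \<beta>0 and \<open>am\<close> is spent: the ball of
  radius \<open>r\<close> about \<beta>0 has to lie where the prior density is at least
  \<open>F4\<close>.\<close>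

lemma evidence_ge:
  assumes pr: "prior_density (supp \<beta>0) (f (supp \<beta>0))"
    and F4: "\<And>\<beta>. \<beta> \<in> coord_space (supp \<beta>0) \<Longrightarrow> nrm \<beta> \<le> am \<Longrightarrow> F4 \<le> f (supp \<beta>0) \<beta>"
    and r: "nrm \<beta>0 + r \<le> am" and F4_nn: "F4 \<ge> 0"
  shows "ennreal F4 * local_lik y r \<le> evidence \<mu> n p X y f (supp \<beta>0)"
proof -
  let ?J = "supp \<beta>0"
  define h where "h = (\<lambda>\<beta>. indicator {\<beta>. nrm (\<lambda>j. \<beta> j - \<beta>0 j) \<le> r} \<beta> * ennreal (exp (ll y \<beta>)))"
  have hm: "h \<in> borel_measurable vecM"
    unfolding h_def by measurable
  have "local_lik y r = lint ?J (\<lambda>u. h (\<lambda>j. u j + \<beta>0 j))"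
    unfolding local_lik_def by (intro lint_cong) (simp add: h_def add.commute indicator_def)
  also have "\<dots> = lint ?J h" by (rule lint_shift[OF supp_finite beta0_supp hm])
  finally have "ennreal F4 * local_lik y r = lint ?J (\<lambda>\<beta>. ennreal F4 * h \<beta>)"
    by (simp add: lint_cmult[OF hm])
  also have "\<dots> \<le> evidence \<mu> n p X y f ?J"
    unfolding lint_def evidence_lint(2)[where f = f and J = "supp \<beta>0", OF supp_subset sparse pr]
  proof (intro nn_integral_mono)
    fix b :: "nat \<Rightarrow> real"
    let ?b = "zero_fill ?J b"
    show "ennreal F4 * h ?b \<le> ennreal (exp (ll y ?b)) * ennreal (f ?J ?b)"
    proof (cases "nrm (\<lambda>j. ?b j - \<beta>0 j) \<le> r")
      case True
      have "nrm (\<lambda>j. (?b j - \<beta>0 j) + \<beta>0 j) \<le> nrm (\<lambda>j. ?b j - \<beta>0 j) + nrm \<beta>0"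
        by (rule L2_set_triangle_ineq)
      then have "nrm ?b \<le> am" using True r by simp
      then have "F4 \<le> f ?J ?b" by (intro F4 zero_fill_coord_space)
      then show ?thesis using True
        by (subst mult.commute) (auto simp: h_def intro!: mult_left_mono ennreal_leI)
    next
      case False
      then show ?thesis by (simp add: h_def)
    qed
  qed
  finally show ?thesis .
qed

text \<open>A cube has an explicit volume, and a crude bound is enough, since it only has to beat
  exponentially small terms.\<close>

lemma local_lik_ge:
  assumes \<eta>: "\<eta> \<ge> 0"
    and cube: "\<And>u. u \<in> coord_space (supp \<beta>0) \<Longrightarrow> (\<And>j. \<bar>u j\<bar> \<le> \<eta>) \<Longrightarrow>
      nrm u \<le> r \<and> C \<le> ll y (\<lambda>j. \<beta>0 j + u j)"
  shows "ennreal (exp C * (2 * \<eta>) ^ card (supp \<beta>0)) \<le> local_lik y r"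
proof -
  let ?J = "supp \<beta>0"
  have [measurable]: "{u. \<forall>j\<in>?J. \<bar>u j\<bar> \<le> \<eta>} \<in> sets vecM"
  proof -
    have "{u \<in> space vecM. \<forall>j\<in>?J. \<bar>u j\<bar> \<le> \<eta>} \<in> sets vecM"
      using supp_finite by measurable
    then show ?thesis by (simp add: space_PiM)
  qed
  have "ennreal (exp C * (2 * \<eta>) ^ card ?J) = ennreal (exp C) * lint ?J (\<lambda>u. indicator {u. \<forall>j\<in>?J. \<bar>u j\<bar> \<le> \<eta>} u)"
    using \<eta> by (simp add: lint_cube[OF supp_finite] ennreal_mult)
  also have "\<dots> = lint ?J (\<lambda>u. ennreal (exp C) * indicator {u. \<forall>j\<in>?J. \<bar>u j\<bar> \<le> \<eta>} u)"
    by (intro lint_cmult[symmetric]) measurable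
  also have "\<dots> \<le> local_lik y r"
    unfolding local_lik_def
  proof (rule lint_mono)
    fix u assume u: "u \<in> coord_space ?J"
    show "ennreal (exp C) * indicator {u. \<forall>j\<in>?J. \<bar>u j\<bar> \<le> \<eta>} u
        \<le> indicator {u. nrm u \<le> r} u * ennreal (exp (ll y (\<lambda>j. \<beta>0 j + u j)))"
    proof (cases "\<forall>j\<in>?J. \<bar>u j\<bar> \<le> \<eta>")
      case True
      then have "\<bar>u j\<bar> \<le> \<eta>" for j using u \<eta> by (cases "j \<in> ?J") (auto simp: coord_space_def)
      from cube[OF u this] show ?thesis using True by (auto intro: ennreal_leI)
    qed auto
  qed
  finally show ?thesis .
qed

end

context local_glm_curv begin

text \<open>The factor by which adding the covariates \<open>V\<close> can raise the evidence.\<close>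

definition excess :: "nat set \<Rightarrow> real \<Rightarrow> (nat \<Rightarrow> real) \<Rightarrow> ennreal" where
  "excess V R y = lint V (\<lambda>v. indicator {v. nrm v \<le> R} v *
      ennreal (exp (score y (lift V v) - quad \<beta>0 (lift V v) (lift V v) / 2)))"

lemma lift_measurable [measurable]:
  "(\<lambda>v. score y (lift V v)) \<in> borel_measurable vecM"
  "(\<lambda>v. quad \<beta>0 (lift V v) (lift V v)) \<in> borel_measurable vecM"
  unfolding score_def quad_def lift_def lin_pred_sum by measurable

text \<open>Fubini, then the shear from \<open>u + v\<close> to
  \<open>\<beta>0 + u + lift V v\<close>, then \<open>loglik_shift_le\<close> makes the likelihood
  factorize. The inner ball grows to radius \<open>(1 + \<Lambda>) * R\<close> because
  \<open>u\<close> is the difference of a vector of norm at most \<open>R\<close> and a lift of norm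
  at most \<open>\<Lambda> * R\<close>.\<close>

lemma local_evidence_le:
  assumes a: "adm (supp \<beta>0 \<union> V)" and dis: "V \<inter> supp \<beta>0 = {}" and R: "R \<ge> 0"
    and \<Lambda>: "sqrt (cu / cl) \<le> \<Lambda>" and err: "ch * real n * (R ^ 3 + ((1 + \<Lambda>) * R) ^ 3) / 2 \<le> E"
  shows "lint (supp \<beta>0 \<union> V) (\<lambda>\<beta>. indicator {\<beta>. nrm (\<lambda>j. \<beta> j - \<beta>0 j) \<le> R} \<beta> * ennreal (exp (ll y \<beta>)))
      \<le> ennreal (exp E) * local_lik y ((1 + \<Lambda>) * R) * excess V R y"
proof -
  let ?J = "supp \<beta>0"
  define h where "h = (\<lambda>\<beta>. indicator {\<beta>. nrm (\<lambda>j. \<beta> j - \<beta>0 j) \<le> R} \<beta> * ennreal (exp (ll y \<beta>)))"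
  have hm: "h \<in> borel_measurable vecM"
    unfolding h_def by measurable
  have fV: "finite V" using admD(3)[OF a] by simp
  have VP: "V \<subseteq> {1..p}" using admD(1)[OF a] by simp
  define g where "g = (\<lambda>u. indicator {u. nrm u \<le> (1 + \<Lambda>) * R} u *
      ennreal (exp (ll y (\<lambda>j. \<beta>0 j + u j))))"
  have gm: "g \<in> borel_measurable vecM" unfolding g_def by measurable
  define k where "k = (\<lambda>v. indicator {v. nrm v \<le> R} v *
      ennreal (exp (score y (lift V v) - quad \<beta>0 (lift V v) (lift V v) / 2)))"
  have km: "k \<in> borel_measurable vecM" unfolding k_def by measurable
  have "lint (?J \<union> V) h = lint V (\<lambda>v. lint ?J (\<lambda>u. h (\<lambda>j. u j + v j)))"
    using dis by (intro lint_Un supp_finite fV hm) auto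
  also have "\<dots> \<le> lint V (\<lambda>v. (ennreal (exp E) * local_lik y ((1 + \<Lambda>) * R)) * k v)"
  proof (rule lint_mono)
    fix v assume v: "v \<in> coord_space V"
    let ?d = "lift V v"
    \<comment> \<open>For fixed \<open>v\<close> the shear is a translation by a vector supported on
      \<open>?J\<close>, under which the inner integral is invariant.\<close>
    have c: "(\<lambda>j. \<beta>0 j + (?d j - v j)) \<in> coord_space ?J"
      using lift_diff[OF fV v] beta0_supp by (auto simp: coord_space_def)
    have "lint ?J (\<lambda>u. h (\<lambda>j. u j + v j))
        = lint ?J (\<lambda>u. h (\<lambda>j. (u j + (\<beta>0 j + (?d j - v j))) + v j))"
      by (rule lint_shift[OF supp_finite c, symmetric])
        (rule measurable_compose[OF vec_shift_measurable hm])
    also have "\<dots> = lint ?J (\<lambda>u. h (\<lambda>j. \<beta>0 j + (u j + ?d j)))"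
      by (intro lint_cong arg_cong[where f = h]) auto
    also have "\<dots> \<le> lint ?J (\<lambda>u. g u * (ennreal (exp E) * k v))"
    proof (rule lint_mono)
      fix u assume u: "u \<in> coord_space ?J"
      show "h (\<lambda>j. \<beta>0 j + (u j + ?d j)) \<le> g u * (ennreal (exp E) * k v)"
      proof (cases "nrm (\<lambda>j. u j + ?d j) \<le> R")
        case True
        \<comment> \<open>The norm of \<open>v\<close> is read off on \<open>V\<close>, where
          \<open>u\<close> vanishes and the lift agrees with \<open>v\<close>.\<close>
        have "nrm v = L2_set v V" by (rule L2_set_coord_space[OF v VP]) simp
        also have "\<dots> = L2_set (\<lambda>j. u j + ?d j) V"
        proof (intro L2_set_cong refl)
          fix j assume "j \<in> V"
          then have "j \<notin> supp \<beta>0" using dis by blast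
          then show "v j = u j + ?d j" using lift_diff[OF fV v] u by (auto simp: coord_space_def)
        qed
        also have "\<dots> \<le> nrm (\<lambda>j. u j + ?d j)" by (rule L2_set_mono_on[OF VP]) simp
        finally have nv: "nrm v \<le> R" using True by linarith
        have "nrm ?d \<le> sqrt (cu / cl) * nrm v" by (rule lift_bounds(3)[OF a dis v])
        also have "\<dots> \<le> \<Lambda> * R" using nv \<Lambda> R cl_pos cu_pos
          by (intro mult_mono order_trans[OF real_sqrt_ge_zero \<Lambda>]) (auto simp: L2_set_nonneg)
        finally have nd: "nrm ?d \<le> \<Lambda> * R" .
        have "nrm (\<lambda>j. (u j + ?d j) + - ?d j) \<le> nrm (\<lambda>j. u j + ?d j) + nrm (\<lambda>j. - ?d j)"
          by (rule L2_set_triangle_ineq)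
        then have nu: "nrm u \<le> (1 + \<Lambda>) * R" using True nd by (simp add: L2_set_uminus algebra_simps)
        have "ch * real n * ((nrm (\<lambda>j. u j + ?d j)) ^ 3 + (nrm u) ^ 3) / 2
            \<le> ch * real n * (R ^ 3 + ((1 + \<Lambda>) * R) ^ 3) / 2"
          using True nu ch_nonneg
          by (intro divide_right_mono mult_left_mono add_mono power_mono) (auto simp: L2_set_nonneg)
        then have "ll y (\<lambda>j. \<beta>0 j + (u j + ?d j)) \<le> ll y (\<lambda>j. \<beta>0 j + u j)
            + (E + (score y ?d - quad \<beta>0 ?d ?d / 2))"
          using loglik_shift_le[OF a v u, of y] err by linarith
        then have "exp (ll y (\<lambda>j. \<beta>0 j + (u j + ?d j)))
            \<le> exp (ll y (\<lambda>j. \<beta>0 j + u j)) * (exp E * exp (score y ?d - quad \<beta>0 ?d ?d / 2))"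
          by (simp add: exp_add[symmetric])
        then show ?thesis using True nv nu
          by (simp add: h_def g_def k_def ennreal_mult'[symmetric] ennreal_leI)
      qed (simp add: h_def)
    qed
    also have "\<dots> = lint ?J g * (ennreal (exp E) * k v)" by (rule lint_multc[OF gm])
    also have "\<dots> = (ennreal (exp E) * local_lik y ((1 + \<Lambda>) * R)) * k v"
      by (simp add: local_lik_def g_def mult_ac)
    finally show "lint ?J (\<lambda>u. h (\<lambda>j. u j + v j)) \<le> (ennreal (exp E) * local_lik y ((1 + \<Lambda>) * R)) * k v" .
  qed
  also have "\<dots> = ennreal (exp E) * local_lik y ((1 + \<Lambda>) * R) * excess V R y"
    unfolding excess_def k_def[symmetric] by (rule lint_cmult[OF km])
  finally show ?thesis unfolding h_def .
qed

text \<open>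
  With \<open>a = 1 / (2 \<rho>\<^sup>2)\<close> the extra weight is at least \<open>1\<close> on the ball of radius \<open>\<rho> sqrt (card V)\<close>
  and turns the mean of the integral into a Gaussian integral; this replaces a computation
  of the volume of the ball.
\<close>

definition tempered_excess :: "nat set \<Rightarrow> real \<Rightarrow> real \<Rightarrow> (nat \<Rightarrow> real) \<Rightarrow> ennreal" where
  "tempered_excess V R a y = lint V (\<lambda>v. indicator {v. nrm v \<le> R} v *
      ennreal (exp (real (card V) / 2 - a * (\<Sum>j\<in>V. (v j)\<^sup>2)) *
        exp (score y (lift V v) - quad \<beta>0 (lift V v) (lift V v) / 2)))"

text \<open>With this \<rho>, the Cauchy-Schwarz bound on the score is at most half of the lower
  bound on \<open>quad / 2\<close> beyond norm \<open>\<rho> * sqrt (card V)\<close>; what is left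
  there is a Gaussian with variance of order \<open>1 / n\<close>. Within that radius the tempering
  weight is at least 1.\<close>

lemma excess_le:
  assumes a: "adm (supp \<beta>0 \<union> V)" and dis: "V \<inter> supp \<beta>0 = {}"
    and B: "\<And>j. j \<in> V \<Longrightarrow> \<bar>score y (orth j)\<bar> \<le> B" "B > 0" and \<rho>: "\<rho> = 4 * B / (cl * real n)"
  shows "excess V R y \<le> tempered_excess V R (1 / (2 * \<rho>\<^sup>2)) y + ennreal (sqrt (4 * pi / (cl * real n)) ^ card V)"
proof -
  have fV: "finite V" using admD(3)[OF a] by simp
  have VP: "V \<subseteq> {1..p}" using admD(1)[OF a] by simp
  have cn: "cl * real n > 0" using cl_pos n_pos by simp
  have \<rho>_pos: "\<rho> > 0" unfolding \<rho> using B(2) cn by simp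
  define k where "k = (\<lambda>v. indicator {v. nrm v \<le> R} v *
      ennreal (exp (real (card V) / 2 - 1 / (2 * \<rho>\<^sup>2) * (\<Sum>j\<in>V. (v j)\<^sup>2)) *
        exp (score y (lift V v) - quad \<beta>0 (lift V v) (lift V v) / 2)))"
  have km: "k \<in> borel_measurable vecM" unfolding k_def by measurable
  have "excess V R y \<le> lint V (\<lambda>v. k v + ennreal (exp (- (cl * real n / 4) * (\<Sum>j\<in>V. (v j)\<^sup>2))))"
    unfolding excess_def
  proof (rule lint_mono)
    fix v assume v: "v \<in> coord_space V"
    let ?s = "score y (lift V v)" and ?Q = "quad \<beta>0 (lift V v) (lift V v)"
    let ?N = "L2_set v V" and ?r = "sqrt (real (card V))"
    have Nn: "?N = nrm v" by (rule L2_set_coord_space[OF v VP, symmetric]) simp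
    have N2: "(\<Sum>j\<in>V. (v j)\<^sup>2) = ?N\<^sup>2" by (rule L2_set_square[symmetric])
    have N0: "?N \<ge> 0" by (rule L2_set_nonneg)
    show "indicator {v. nrm v \<le> R} v * ennreal (exp (?s - ?Q / 2))
        \<le> k v + ennreal (exp (- (cl * real n / 4) * (\<Sum>j\<in>V. (v j)\<^sup>2)))"
    proof (cases "nrm v \<le> R")
      case True
      show ?thesis
      proof (cases "?N \<le> \<rho> * ?r")
        case le: True
        then have "?N\<^sup>2 \<le> \<rho>\<^sup>2 * real (card V)"
          using power_mono[OF le N0, of 2] by (simp add: power_mult_distrib)
        then have "1 / (2 * \<rho>\<^sup>2) * ?N\<^sup>2 \<le> real (card V) / 2" using \<rho>_pos by (simp add: field_simps)
        then have "exp (?s - ?Q / 2) \<le> exp (real (card V) / 2 - 1 / (2 * \<rho>\<^sup>2) * ?N\<^sup>2) * exp (?s - ?Q / 2)"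
          by simp
        then have "indicator {v. nrm v \<le> R} v * ennreal (exp (?s - ?Q / 2)) \<le> k v"
          unfolding k_def N2 using True by (simp add: ennreal_leI)
        then show ?thesis by (simp add: add_increasing2)
      next
        case False
        have "?s \<le> B * ?r * ?N"
          using score_bound[where V = V and v = v and d = orth and y = y and B = B] fV B unfolding lift_def by (simp add: abs_le_iff)
        also have "B = cl * real n / 4 * \<rho>" unfolding \<rho> using cl_pos n_pos by simp
        also have "cl * real n / 4 * \<rho> * ?r * ?N = cl * real n / 4 * (\<rho> * ?r) * ?N" by (simp only: mult_ac)
        also have "\<dots> \<le> cl * real n / 4 * ?N * ?N"
          using False cn N0 by (intro mult_right_mono mult_left_mono) auto
        finally have "?s \<le> cl * real n / 4 * ?N\<^sup>2" by (simp add: power2_eq_square mult.assoc)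
        moreover have "cl * real n * ?N\<^sup>2 \<le> ?Q" unfolding Nn by (rule lift_bounds(2)[OF a dis v])
        ultimately have "?s - ?Q / 2 \<le> - (cl * real n / 4) * ?N\<^sup>2" by (simp add: field_simps)
        then have "indicator {v. nrm v \<le> R} v * ennreal (exp (?s - ?Q / 2)) \<le> ennreal (exp (- (cl * real n / 4) * (\<Sum>j\<in>V. (v j)\<^sup>2)))"
          unfolding N2 using True by (simp add: ennreal_leI)
        then show ?thesis by (simp add: add_increasing)
      qed
    qed simp
  qed
  also have "\<dots> = lint V k + ennreal (sqrt (pi / (cl * real n / 4)) ^ card V)"
    using lint_gaussian[OF fV, of "cl * real n / 4"] cn by (subst lint_add[OF km]) simp_all
  finally show ?thesis by (simp add: tempered_excess_def k_def mult.commute)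
qed

end

subsection \<open>Random fluctuations\<close>

locale random_glm = local_glm_curv \<mu> n p q X \<beta>0 cl cu ch + prob_space M
  for \<mu> n p q X \<beta>0 cl cu ch and M :: "'w measure" +
  fixes Y :: "nat \<Rightarrow> 'w \<Rightarrow> real"
  assumes indep: "indep_vars (\<lambda>_. borel) Y {1..n}"
    and dist: "\<And>i. i \<in> {1..n} \<Longrightarrow>
      distributed M \<mu> (Y i) (\<lambda>y. ennreal (exp_density \<mu> (lin_pred p X \<beta>0 i) y))"
begin

abbreviation (input) "obs \<omega> \<equiv> (\<lambda>i. Y i \<omega>)"

lemma Y_measurable: "i \<in> {1..n} \<Longrightarrow> Y i \<in> borel_measurable M"
  using indep by (auto simp: indep_vars_def)

lemma score_measurable [measurable]: "(\<lambda>\<omega>. score (obs \<omega>) \<delta>) \<in> borel_measurable M"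
  unfolding score_def using Y_measurable by measurable

text \<open>By independence the transform factorizes, and each factor is a ratio of normalizing
  constants; their product is the exponential of the Bregman divergence.\<close>

lemma score_mgf: "(\<integral>\<^sup>+\<omega>. ennreal (exp (score (obs \<omega>) \<delta>)) \<partial>M) = ennreal (exp (bregman \<delta>))"
proof -
  let ?b' = "\<lambda>i. deriv (cumulant \<mu>) (lp \<beta>0 i)"
  define Z where "Z = (\<lambda>i y. ennreal (exp (- ?b' i * lp \<delta> i) * exp (lp \<delta> i * y)))"
  have Z: "Z i \<in> borel_measurable borel" for i unfolding Z_def by measurable
  have "(\<integral>\<^sup>+\<omega>. ennreal (exp (score (obs \<omega>) \<delta>)) \<partial>M) = (\<integral>\<^sup>+\<omega>. (\<Prod>i\<in>{1..n}. Z i (Y i \<omega>)) \<partial>M)"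
    by (intro nn_integral_cong)
      (simp add: Z_def score_def prod_ennreal exp_sum exp_add[symmetric] algebra_simps)
  also have "\<dots> = (\<Prod>i\<in>{1..n}. \<integral>\<^sup>+\<omega>. Z i (Y i \<omega>) \<partial>M)"
    by (rule indep_vars_nn_integral[OF _ indep_vars_compose2[OF indep Z]]) auto
  also have "\<dots> = (\<Prod>i\<in>{1..n}. ennreal (exp (- ?b' i * lp \<delta> i)) *
      ennreal (exp (cumulant \<mu> (lp \<beta>0 i + lp \<delta> i) - cumulant \<mu> (lp \<beta>0 i))))"
  proof (intro prod.cong refl)
    fix i assume i: "i \<in> {1..n}"
    have "(\<integral>\<^sup>+\<omega>. Z i (Y i \<omega>) \<partial>M)
        = (\<integral>\<^sup>+\<omega>. ennreal (exp (- ?b' i * lp \<delta> i)) * ennreal (exp (lp \<delta> i * Y i \<omega>)) \<partial>M)"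
      by (simp add: Z_def ennreal_mult')
    also have "\<dots> = ennreal (exp (- ?b' i * lp \<delta> i)) * (\<integral>\<^sup>+\<omega>. ennreal (exp (lp \<delta> i * Y i \<omega>)) \<partial>M)"
      using Y_measurable[OF i] by (intro nn_integral_cmult) measurable
    also have "(\<integral>\<^sup>+\<omega>. ennreal (exp (lp \<delta> i * Y i \<omega>)) \<partial>M)
        = ennreal (exp (cumulant \<mu> (lp \<beta>0 i + lp \<delta> i) - cumulant \<mu> (lp \<beta>0 i)))"
      by (rule exp_density_mgf[OF expfam dist[OF i]])
    finally show "(\<integral>\<^sup>+\<omega>. Z i (Y i \<omega>) \<partial>M) = ennreal (exp (- ?b' i * lp \<delta> i)) *
      ennreal (exp (cumulant \<mu> (lp \<beta>0 i + lp \<delta> i) - cumulant \<mu> (lp \<beta>0 i)))" .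
  qed
  also have "\<dots> = ennreal (exp (bregman \<delta>))"
    by (simp add: bregman_def ennreal_mult'[symmetric] prod_ennreal exp_sum exp_add[symmetric] algebra_simps)
  finally show ?thesis .
qed

text \<open>Chernoff's bound with parameter \<tau>. The condition \<open>\<tau> * D \<le> 1\<close>
  keeps the scaled direction in the unit ball, where \<open>bregman\<close> has its quadratic upper
  bound.\<close>

lemma score_upper_tail:
  assumes "adm J" "\<delta> \<in> coord_space J" "nrm \<delta> \<le> D" "\<tau> * D \<le> 1" "\<tau> > 0"
  shows "prob {\<omega> \<in> space M. B \<le> score (obs \<omega>) \<delta>} \<le> exp (cu * real n * (\<tau> * D)\<^sup>2 / 2 - \<tau> * B)"
proof -
  have nt: "nrm (\<lambda>j. \<tau> * \<delta> j) \<le> \<tau> * D" using assms by (simp add: L2_set_scale)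
  have br: "bregman (\<lambda>j. \<tau> * \<delta> j) \<le> cu * real n * (\<tau> * D)\<^sup>2 / 2"
  proof -
    have "bregman (\<lambda>j. \<tau> * \<delta> j) \<le> cu * real n * (nrm (\<lambda>j. \<tau> * \<delta> j))\<^sup>2 / 2"
      by (rule bregman_bounds(2)[OF assms(1) coord_space_scale[OF assms(2)]]) (use nt assms(4) in linarith)
    also have "\<dots> \<le> cu * real n * (\<tau> * D)\<^sup>2 / 2"
      using nt cu_pos by (intro divide_right_mono mult_left_mono power_mono) (auto simp: L2_set_nonneg)
    finally show ?thesis .
  qed
  have "emeasure M {\<omega> \<in> space M. B \<le> score (obs \<omega>) \<delta>}
      = emeasure M {\<omega> \<in> space M. 1 \<le> ennreal (exp (- \<tau> * B)) * ennreal (exp (score (obs \<omega>) (\<lambda>j. \<tau> * \<delta> j)))}"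
    using assms(5) by (intro arg_cong[where f = "emeasure M"] Collect_cong conj_cong refl)
      (simp add: score_scale ennreal_mult'[symmetric] exp_add[symmetric] ennreal_1[symmetric] del: ennreal_1)
  also have "\<dots> \<le> ennreal (exp (- \<tau> * B)) *
      (\<integral>\<^sup>+\<omega>. ennreal (exp (score (obs \<omega>) (\<lambda>j. \<tau> * \<delta> j))) * indicator (space M) \<omega> \<partial>M)"
    by (intro nn_integral_Markov_inequality) auto
  also have "(\<integral>\<^sup>+\<omega>. ennreal (exp (score (obs \<omega>) (\<lambda>j. \<tau> * \<delta> j))) * indicator (space M) \<omega> \<partial>M)
      = (\<integral>\<^sup>+\<omega>. ennreal (exp (score (obs \<omega>) (\<lambda>j. \<tau> * \<delta> j))) \<partial>M)"
    by (intro nn_integral_cong) auto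
  also have "ennreal (exp (- \<tau> * B)) * \<dots> = ennreal (exp (bregman (\<lambda>j. \<tau> * \<delta> j) - \<tau> * B))"
    unfolding score_mgf by (simp add: ennreal_mult'[symmetric] exp_add[symmetric])
  also have "\<dots> \<le> ennreal (exp (cu * real n * (\<tau> * D)\<^sup>2 / 2 - \<tau> * B))"
    using br by (intro ennreal_leI) simp
  finally show ?thesis by (simp add: emeasure_eq_measure)
qed

lemma score_tail:
  assumes "adm J" "\<delta> \<in> coord_space J" "nrm \<delta> \<le> D" "\<tau> * D \<le> 1" "\<tau> > 0"
  shows "prob {\<omega> \<in> space M. B \<le> \<bar>score (obs \<omega>) \<delta>\<bar>} \<le> 2 * exp (cu * real n * (\<tau> * D)\<^sup>2 / 2 - \<tau> * B)"
proof -
  have neg: "(\<lambda>j. - \<delta> j) = (\<lambda>j. (-1) * \<delta> j)" by auto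
  have "{\<omega> \<in> space M. B \<le> \<bar>score (obs \<omega>) \<delta>\<bar>} =
     {\<omega> \<in> space M. B \<le> score (obs \<omega>) \<delta>} \<union> {\<omega> \<in> space M. B \<le> score (obs \<omega>) (\<lambda>j. - \<delta> j)}"
    unfolding neg score_scale by auto
  then have "prob {\<omega> \<in> space M. B \<le> \<bar>score (obs \<omega>) \<delta>\<bar>} \<le>
    prob {\<omega> \<in> space M. B \<le> score (obs \<omega>) \<delta>} + prob {\<omega> \<in> space M. B \<le> score (obs \<omega>) (\<lambda>j. - \<delta> j)}"
    by (simp add: measure_Un_le)
  also have "\<dots> \<le> exp (cu * real n * (\<tau> * D)\<^sup>2 / 2 - \<tau> * B) + exp (cu * real n * (\<tau> * D)\<^sup>2 / 2 - \<tau> * B)"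
    using assms by (intro add_mono score_upper_tail[of J]) (auto simp: L2_set_uminus coord_space_def)
  finally show ?thesis by simp
qed

section \<open>The two exceptional events\<close>

lemma orth_props:
  assumes "j \<in> {1..p}" "j \<notin> supp \<beta>0"
  shows "adm (insert j (supp \<beta>0))" "orth j \<in> coord_space (insert j (supp \<beta>0))"
    "nrm (orth j) \<le> sqrt (cu / cl)"
proof -
  have ins: "insert j (supp \<beta>0) = supp \<beta>0 \<union> {j}" by auto
  \<comment> \<open>One extra covariate gives at most \<open>q + 1\<close> indices, and
    \<open>q + 1 \<le> 2 * q\<close> because \<open>q \<ge> 1\<close>.\<close>
  show a: "adm (insert j (supp \<beta>0))"
    using assms supp_subset sparse q_pos supp_finite by (auto simp: adm_def)
  have l: "lift {j} (unit_vec j) = orth j" by (simp add: lift_def unit_vec_def)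
  show "orth j \<in> coord_space (insert j (supp \<beta>0))"
    using lift_coord_space[OF _ unit_vec_coord_space, of j] unfolding l ins by simp
  have "nrm (lift {j} (unit_vec j)) \<le> sqrt (cu / cl) * nrm (unit_vec j)"
    using a assms unfolding ins by (intro lift_bounds(3) unit_vec_coord_space) auto
  then show "nrm (orth j) \<le> sqrt (cu / cl)"
    using L2_set_unit_vec[of "{1..p}" j] assms(1) by (simp add: l)
qed

text \<open>The unit vectors control the score of arbitrary displacements from \<beta>0, the
  projected covariates that of every \<open>lift V v\<close>; both extensions are by
  Cauchy-Schwarz.\<close>

definition bad_score :: "real \<Rightarrow> 'w set" where
  "bad_score B = (\<Union>j\<in>{1..p}. {\<omega> \<in> space M. B \<le> \<bar>score (obs \<omega>) (unit_vec j)\<bar>}) \<union>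
     (\<Union>j\<in>{1..p} - supp \<beta>0. {\<omega> \<in> space M. B \<le> \<bar>score (obs \<omega>) (orth j)\<bar>})"

lemma unit_vec_adm:
  assumes "j \<in> {1..p}"
  shows "adm (insert j (supp \<beta>0))" "unit_vec j \<in> coord_space (insert j (supp \<beta>0))"
  using assms supp_subset sparse q_pos supp_finite card_insert_le_m1[of "2 * q" "supp \<beta>0" j]
  by (auto simp: adm_def unit_vec_def coord_space_def card_insert_if)

lemma bad_score:
  assumes "sqrt (cu / cl) \<le> D" "1 \<le> D" "\<tau> * D \<le> 1" "\<tau> > 0"
  shows "bad_score B \<in> events" "prob (bad_score B) \<le> 4 * real p * exp (cu * real n * (\<tau> * D)\<^sup>2 / 2 - \<tau> * B)"
proof -
  let ?e = "exp (cu * real n * (\<tau> * D)\<^sup>2 / 2 - \<tau> * B)"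
  show "bad_score B \<in> events" unfolding bad_score_def by measurable
  have fin: "finite ({1..p} - supp \<beta>0)" by simp
  have "prob (bad_score B) \<le> prob (\<Union>j\<in>{1..p}. {\<omega> \<in> space M. B \<le> \<bar>score (obs \<omega>) (unit_vec j)\<bar>}) +
    prob (\<Union>j\<in>{1..p} - supp \<beta>0. {\<omega> \<in> space M. B \<le> \<bar>score (obs \<omega>) (orth j)\<bar>})"
    unfolding bad_score_def by (intro measure_Un_le) measurable
  also have "\<dots> \<le> (\<Sum>j\<in>{1..p}. prob {\<omega> \<in> space M. B \<le> \<bar>score (obs \<omega>) (unit_vec j)\<bar>}) +
    (\<Sum>j\<in>{1..p} - supp \<beta>0. prob {\<omega> \<in> space M. B \<le> \<bar>score (obs \<omega>) (orth j)\<bar>})"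
    by (intro add_mono measure_UNION_le) measurable
  also have "\<dots> \<le> (\<Sum>j\<in>{1..p}. 2 * ?e) + (\<Sum>j\<in>{1..p} - supp \<beta>0. 2 * ?e)"
  proof (intro add_mono sum_mono)
    fix j assume j: "j \<in> {1..p}"
    show "prob {\<omega> \<in> space M. B \<le> \<bar>score (obs \<omega>) (unit_vec j)\<bar>} \<le> 2 * ?e"
      using L2_set_unit_vec[OF _ j] assms by (intro score_tail[OF unit_vec_adm[OF j]]) auto
  next
    fix j assume "j \<in> {1..p} - supp \<beta>0"
    then have j: "j \<in> {1..p}" "j \<notin> supp \<beta>0" by auto
    show "prob {\<omega> \<in> space M. B \<le> \<bar>score (obs \<omega>) (orth j)\<bar>} \<le> 2 * ?e"
      using orth_props(3)[OF j] assms by (intro score_tail[OF orth_props(1,2)[OF j]]) auto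
  qed
  also have "\<dots> \<le> real p * (2 * ?e) + real p * (2 * ?e)"
    using card_mono[of "{1..p}" "{1..p} - supp \<beta>0"] by (intro add_mono) (auto intro!: mult_right_mono)
  finally show "prob (bad_score B) \<le> 4 * real p * ?e" by simp
qed

lemma tempered_joint_measurable:
  "(\<lambda>(\<omega>, v). indicator {v. nrm v \<le> R} v *
      ennreal (exp (real (card V) / 2 - a * (\<Sum>j\<in>V. (v j)\<^sup>2)) *
        exp (score (obs \<omega>) (lift V v) - quad \<beta>0 (lift V v) (lift V v) / 2)))
    \<in> borel_measurable (M \<Otimes>\<^sub>M vecM)"
proof -
  have [measurable]: "(\<lambda>x. score (obs (fst x)) (lift V (snd x))) \<in> borel_measurable (M \<Otimes>\<^sub>M vecM)"
    unfolding lift_def score_sum by measurable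
  have [measurable]: "(\<lambda>x. quad \<beta>0 (lift V (snd x)) (lift V (snd x))) \<in> borel_measurable (M \<Otimes>\<^sub>M vecM)"
    by (rule measurable_compose[OF measurable_snd lift_measurable(2)])
  show ?thesis unfolding split_beta' by measurable
qed

lemma tempered_measurable [measurable]: "(\<lambda>\<omega>. tempered_excess V R a (obs \<omega>)) \<in> borel_measurable M"
  if "finite V"
  unfolding tempered_excess_def
  by (rule lint_Fubini(2)[OF sigma_finite_measure_axioms that]) (use tempered_joint_measurable[of R V a] in simp)

text \<open>After the integrals are exchanged, the mean of \<open>exp (score)\<close> is
  \<open>exp (bregman)\<close>, which cancels \<open>quad / 2\<close> up to the cubic error
  \<open>E\<close>; only the Gaussian weight remains to be integrated. The restriction to norm at
  most \<open>R\<close> keeps that error bounded.\<close>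

lemma tempered_mean:
  assumes a: "adm (supp \<beta>0 \<union> V)" and dis: "V \<inter> supp \<beta>0 = {}" and R: "R \<ge> 0" and "\<alpha> > 0"
    and \<Lambda>: "sqrt (cu / cl) \<le> \<Lambda>" and err: "ch * real n * (\<Lambda> * R) ^ 3 / 2 \<le> E"
  shows "(\<integral>\<^sup>+\<omega>. tempered_excess V R \<alpha> (obs \<omega>) \<partial>M) \<le> ennreal (exp E * (exp (1 / 2) * sqrt (pi / \<alpha>)) ^ card V)"
proof -
  have fV: "finite V" using admD(3)[OF a] by simp
  let ?w = "\<lambda>v. exp (real (card V) / 2 - \<alpha> * (\<Sum>j\<in>V. (v j)\<^sup>2))"
  let ?Q = "\<lambda>v. quad \<beta>0 (lift V v) (lift V v)"
  have "(\<integral>\<^sup>+\<omega>. tempered_excess V R \<alpha> (obs \<omega>) \<partial>M)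
     = lint V (\<lambda>v. \<integral>\<^sup>+\<omega>. indicator {v. nrm v \<le> R} v *
        ennreal (?w v * exp (score (obs \<omega>) (lift V v) - ?Q v / 2)) \<partial>M)"
    unfolding tempered_excess_def
    by (rule lint_Fubini(1)[OF sigma_finite_measure_axioms fV]) (use tempered_joint_measurable[of R V \<alpha>] in simp)
  also have "\<dots> \<le> lint V (\<lambda>v. ennreal (exp E * exp (real (card V) / 2)) * ennreal (exp (- \<alpha> * (\<Sum>j\<in>V. (v j)\<^sup>2))))"
  proof (rule lint_mono)
    fix v assume v: "v \<in> coord_space V"
    let ?d = "lift V v"
    have "(\<integral>\<^sup>+\<omega>. indicator {v. nrm v \<le> R} v * ennreal (?w v * exp (score (obs \<omega>) ?d - ?Q v / 2)) \<partial>M)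
      = (\<integral>\<^sup>+\<omega>. (indicator {v. nrm v \<le> R} v * ennreal (?w v * exp (- ?Q v / 2))) * ennreal (exp (score (obs \<omega>) ?d)) \<partial>M)"
      by (intro nn_integral_cong) (simp add: ennreal_mult'[symmetric] mult.assoc exp_add[symmetric] algebra_simps)
    also have "\<dots> = indicator {v. nrm v \<le> R} v * ennreal (?w v * exp (- ?Q v / 2)) * ennreal (exp (bregman ?d))"
      by (subst nn_integral_cmult) (auto simp: score_mgf)
    also have "\<dots> \<le> ennreal (exp E * exp (real (card V) / 2)) * ennreal (exp (- \<alpha> * (\<Sum>j\<in>V. (v j)\<^sup>2)))"
    proof (cases "nrm v \<le> R")
      case True
      have "nrm ?d \<le> sqrt (cu / cl) * nrm v" by (rule lift_bounds(3)[OF a dis v])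
      also have "\<dots> \<le> \<Lambda> * R" using True \<Lambda> R cl_pos cu_pos
        by (intro mult_mono order_trans[OF real_sqrt_ge_zero \<Lambda>]) (auto simp: L2_set_nonneg)
      finally have "ch * real n * (nrm ?d) ^ 3 / 2 \<le> ch * real n * (\<Lambda> * R) ^ 3 / 2"
        using ch_nonneg by (intro divide_right_mono mult_left_mono power_mono) (auto simp: L2_set_nonneg)
      then have "bregman ?d - ?Q v / 2 \<le> E"
        using bregman_quad[OF a lift_coord_space[OF fV v]] err by linarith
      then have "?w v * exp (- ?Q v / 2) * exp (bregman ?d)
          \<le> exp E * exp (real (card V) / 2) * exp (- \<alpha> * (\<Sum>j\<in>V. (v j)\<^sup>2))"
        by (simp add: exp_add[symmetric])
      then show ?thesis using True by (simp add: ennreal_mult'[symmetric] ennreal_leI)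
    qed simp
    finally show "(\<integral>\<^sup>+\<omega>. indicator {v. nrm v \<le> R} v * ennreal (?w v * exp (score (obs \<omega>) ?d - ?Q v / 2)) \<partial>M)
      \<le> ennreal (exp E * exp (real (card V) / 2)) * ennreal (exp (- \<alpha> * (\<Sum>j\<in>V. (v j)\<^sup>2)))" .
  qed
  also have "\<dots> = ennreal (exp E * exp (real (card V) / 2)) * ennreal (sqrt (pi / \<alpha>) ^ card V)"
    by (subst lint_cmult) (use lint_gaussian[OF fV \<open>\<alpha> > 0\<close>] in auto)
  also have "\<dots> = ennreal (exp E * (exp (1 / 2) * sqrt (pi / \<alpha>)) ^ card V)"
  proof -
    have "exp (real (card V) / 2) = exp (1 / 2) ^ card V" by (simp add: exp_of_nat_mult[symmetric])
    then show ?thesis using \<open>\<alpha> > 0\<close> by (simp add: ennreal_mult'[symmetric] power_mult_distrib mult.assoc)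
  qed
  finally show ?thesis .
qed

definition extensions :: "nat set set" where
  "extensions = {V. V \<noteq> {} \<and> V \<subseteq> {1..p} - supp \<beta>0 \<and> card (supp \<beta>0 \<union> V) \<le> q}"

definition bad_excess :: "real \<Rightarrow> real \<Rightarrow> real \<Rightarrow> 'w set" where
  "bad_excess R \<alpha> s = (\<Union>V\<in>extensions. {\<omega> \<in> space M. ennreal (s ^ card V) \<le> tempered_excess V R \<alpha> (obs \<omega>)})"

lemma extensionsD:
  assumes "V \<in> extensions"
  shows "finite V" "V \<noteq> {}" "adm (supp \<beta>0 \<union> V)" "V \<inter> supp \<beta>0 = {}" "V \<subseteq> {1..p}" "card (supp \<beta>0 \<union> V) \<le> q"
  using assms supp_subset finite_subset[of V "{1..p}"] by (auto simp: extensions_def adm_def)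

lemma finite_extensions: "finite extensions"
  by (rule finite_subset[of _ "Pow {1..p}"]) (auto simp: extensions_def)

text \<open>Markov's inequality with a threshold \<open>s\<close> per extra coordinate bounds each
  probability by a power \<open>y ^ card V\<close>. Summed over all nonempty subsets of
  \<open>{1..p}\<close> these powers give \<open>(1 + y) ^ p - 1\<close>, which is small as soon as
  \<open>p * y\<close> is.\<close>

lemma bad_excess:
  assumes R: "R \<ge> 0" and \<alpha>: "\<alpha> > 0" and s: "s > 0"
    and \<Lambda>: "sqrt (cu / cl) \<le> \<Lambda>" and err: "ch * real n * (\<Lambda> * R) ^ 3 / 2 \<le> E"
  shows "bad_excess R \<alpha> s \<in> events"
    "prob (bad_excess R \<alpha> s) \<le> exp E * (exp (real p * (exp (1 / 2) * sqrt (pi / \<alpha>) / s)) - 1)"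
proof -
  let ?y = "exp (1 / 2) * sqrt (pi / \<alpha>) / s"
  let ?A = "\<lambda>V. {\<omega> \<in> space M. ennreal (s ^ card V) \<le> tempered_excess V R \<alpha> (obs \<omega>)}"
  have y: "?y \<ge> 0" using s \<alpha> by simp
  have A: "?A V \<in> events" if "V \<in> extensions" for V
    using tempered_measurable[OF extensionsD(1)[OF that], of R \<alpha>] by measurable
  then show "bad_excess R \<alpha> s \<in> events"
    unfolding bad_excess_def by (intro sets.finite_UN finite_extensions)
  have PA: "prob (?A V) \<le> exp E * ?y ^ card V" if V: "V \<in> extensions" for V
  proof -
    note [measurable] = tempered_measurable[OF extensionsD(1)[OF V], of R \<alpha>]
    have sp: "s ^ card V > 0" using s by simp
    have "?A V = {\<omega> \<in> space M. 1 \<le> ennreal (1 / s ^ card V) * tempered_excess V R \<alpha> (obs \<omega>)}"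
    proof (intro Collect_cong conj_cong refl)
      fix \<omega>
      let ?T = "tempered_excess V R \<alpha> (obs \<omega>)"
      show "ennreal (s ^ card V) \<le> ?T \<longleftrightarrow> 1 \<le> ennreal (1 / s ^ card V) * ?T"
      proof (cases ?T)
        case (real t)
        then show ?thesis using sp
          by (simp add: ennreal_mult'[symmetric] ennreal_1[symmetric] field_simps del: ennreal_1)
      qed (use s in \<open>auto simp: ennreal_mult_top\<close>)
    qed
    then have "emeasure M (?A V) \<le> ennreal (1 / s ^ card V) *
        (\<integral>\<^sup>+\<omega>. tempered_excess V R \<alpha> (obs \<omega>) * indicator (space M) \<omega> \<partial>M)"
      using nn_integral_Markov_inequality[of "\<lambda>\<omega>. tempered_excess V R \<alpha> (obs \<omega>)" "space M" M "ennreal (1 / s ^ card V)"]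
      by simp
    also have "(\<integral>\<^sup>+\<omega>. tempered_excess V R \<alpha> (obs \<omega>) * indicator (space M) \<omega> \<partial>M)
        = (\<integral>\<^sup>+\<omega>. tempered_excess V R \<alpha> (obs \<omega>) \<partial>M)"
      by (intro nn_integral_cong) auto
    also have "ennreal (1 / s ^ card V) * \<dots> \<le>
        ennreal (1 / s ^ card V) * ennreal (exp E * (exp (1 / 2) * sqrt (pi / \<alpha>)) ^ card V)"
      by (intro mult_left_mono tempered_mean[OF extensionsD(3,4)[OF V] R \<alpha> \<Lambda> err]) simp
    also have "\<dots> = ennreal (exp E * ?y ^ card V)"
      using sp \<alpha> by (simp add: ennreal_mult'[symmetric] power_divide)
    finally show ?thesis using y by (simp add: emeasure_eq_measure)
  qed
  have "prob (bad_excess R \<alpha> s) \<le> (\<Sum>V\<in>extensions. prob (?A V))"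
    unfolding bad_excess_def using A by (intro measure_UNION_le finite_extensions)
  also have "\<dots> \<le> (\<Sum>V\<in>extensions. exp E * ?y ^ card V)" by (intro sum_mono PA)
  also have "\<dots> \<le> (\<Sum>V\<in>Pow {1..p} - {{}}. exp E * ?y ^ card V)"
    using y by (intro sum_mono2) (auto simp: extensions_def)
  also have "\<dots> = exp E * ((\<Sum>V\<in>Pow {1..p}. ?y ^ card V) - 1)"
    by (simp add: sum_diff1 sum_distrib_left[symmetric])
  also have "(\<Sum>V\<in>Pow {1..p}. ?y ^ card V) = (1 + ?y) ^ p"
  proof -
    have "(\<Prod>j\<in>{1..p}. ?y + 1) = (\<Sum>V\<in>Pow {1..p}. (\<Prod>j\<in>V. ?y) * (\<Prod>j\<in>{1..p} - V. 1))"
      by (rule prod_add) simp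
    then show ?thesis by (simp add: add.commute)
  qed
  also have "(1 + ?y) ^ p \<le> exp ?y ^ p"
    using y by (intro power_mono exp_ge_add_one_self) auto
  also have "exp ?y ^ p = exp (real p * ?y)" by (simp only: exp_of_nat_mult)
  finally show "prob (bad_excess R \<alpha> s) \<le> exp E * (exp (real p * ?y) - 1)" by simp
qed

end

subsection \<open>Correct selection for one problem\<close>

text \<open>Raising the lower index from \<open>k\<close> to \<open>k + 1\<close> multiplies the
  coefficient by \<open>(p - k) / (k + 1)\<close>, which is at least \<open>(p - q) / q\<close>
  while \<open>k < q\<close>. Cleared of denominators for the induction.\<close>

lemma binomial_growth:
  assumes "a + r \<le> q" "q \<le> p"
  shows "real (p choose a) * (real p - real q) ^ r \<le> real (p choose (a + r)) * real q ^ r"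
  using assms(1)
proof (induction r)
  case (Suc r)
  let ?c = "\<lambda>k. real (p choose k)"
  have "Suc (a + r) * (p choose Suc (a + r)) = (p - (a + r)) * (p choose (a + r))"
    by (metis binomial_absorb_comp binomial_absorption mult.commute)
  then have step: "real (Suc (a + r)) * ?c (Suc (a + r)) = (real p - real (a + r)) * ?c (a + r)"
  proof -
    have "real (Suc (a + r) * (p choose Suc (a + r))) = real ((p - (a + r)) * (p choose (a + r)))"
      by (simp only: \<open>Suc (a + r) * (p choose Suc (a + r)) = (p - (a + r)) * (p choose (a + r))\<close>)
    moreover have "real (p - (a + r)) = real p - real (a + r)"
      using Suc.prems assms(2) by (intro of_nat_diff) simp
    ultimately show ?thesis by (simp only: of_nat_mult)
  qed
  have pq: "0 \<le> real p - real q" using assms(2) by simp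
  have "?c a * (real p - real q) ^ Suc r = (?c a * (real p - real q) ^ r) * (real p - real q)" by simp
  also have "\<dots> \<le> (?c (a + r) * real q ^ r) * (real p - real (a + r))"
    using Suc.prems pq by (intro mult_mono[OF Suc.IH]) auto
  also have "\<dots> = real (Suc (a + r)) * ?c (Suc (a + r)) * real q ^ r"
    unfolding step by (simp only: mult_ac)
  also have "\<dots> \<le> real q * ?c (Suc (a + r)) * real q ^ r"
    using Suc.prems by (intro mult_right_mono) auto
  finally show ?case by (simp add: mult_ac)
qed simp

text \<open>The price of the extra covariates in the prior: one factor for each of them, the same
  whatever the size of the true model.\<close>

lemma binomial_powr_ratio:
  assumes "a + r \<le> q" "2 * q \<le> p" "\<gamma> \<ge> 0" "q \<ge> 1"
  shows "real (p choose (a + r)) powr (- \<gamma>)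
    \<le> real (p choose a) powr (- \<gamma>) * ((real q / (real p - real q)) powr \<gamma>) ^ r"
proof -
  have pq: "real p - real q > 0" "real q > 0" using assms by auto
  let ?x = "(real q / (real p - real q)) ^ r"
  have c: "real (p choose a) > 0" "real (p choose (a + r)) > 0" using assms by auto
  have x: "?x > 0" using pq by simp
  have "real (p choose a) \<le> real (p choose (a + r)) * ?x"
    using binomial_growth[of a r q p] assms pq by (simp add: power_divide field_simps)
  then have "real (p choose (a + r)) powr (- \<gamma>) \<le> (real (p choose a) / ?x) powr (- \<gamma>)"
    using c x assms(3) by (intro powr_mono2' divide_pos_pos) (auto simp only: pos_divide_le_eq)
  also have "\<dots> = real (p choose a) powr (- \<gamma>) * ?x powr \<gamma>"
  proof -
    have "(c / x) powr (- \<gamma>) = c powr (- \<gamma>) * x powr \<gamma>" if "c > 0" "x > 0" for c x :: real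
      using that by (simp add: powr_divide powr_minus field_simps)
    from this[OF c(1) x] show ?thesis .
  qed
  also have "?x powr \<gamma> = ((real q / (real p - real q)) powr \<gamma>) ^ r"
    using pq by (simp add: powr_powr powr_realpow[symmetric] mult.commute powr_power)
  finally show ?thesis .
qed

locale selection_problem = random_glm \<mu> n p q X \<beta>0 cl cu ch M Y
  for \<mu> n p q X \<beta>0 cl cu ch and M :: "'w measure" and Y +
  fixes f :: "nat set \<Rightarrow> (nat \<Rightarrow> real) \<Rightarrow> real" and F3 F4 am \<gamma> :: real
  assumes prior: "\<And>J. J \<subseteq> {1..p} \<Longrightarrow> card J \<le> q \<Longrightarrow> prior_density J (f J)"
    and F_pos: "F3 > 0" "F4 > 0" and gamma_nonneg: "\<gamma> \<ge> 0"
    and prior_le: "\<And>J \<beta>. J \<subseteq> {1..p} \<Longrightarrow> card J \<le> q \<Longrightarrow> \<beta> \<in> coord_space J \<Longrightarrow> f J \<beta> \<le> F3"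
    and prior_ge: "\<And>J \<beta>. J \<subseteq> {1..p} \<Longrightarrow> card J \<le> q \<Longrightarrow> \<beta> \<in> coord_space J \<Longrightarrow>
        L2_set \<beta> {1..p} \<le> am \<Longrightarrow> F4 \<le> f J \<beta>"
begin

abbreviation (input) "bay J \<omega> \<equiv> bayes \<gamma> \<mu> n p X (obs \<omega>) f J"

lemma evidence_measurable:
  assumes "J \<subseteq> {1..p}" "card J \<le> q"
  shows "(\<lambda>\<omega>. evidence \<mu> n p X (obs \<omega>) f J) \<in> borel_measurable M"
proof -
  have fin: "finite J" using assms(1) by (rule finite_subset) simp
  interpret B: sigma_finite_measure "Pi\<^sub>M J (\<lambda>_. lborel :: real measure)"
    by (rule lborel_prod.sigma_finite[OF fin])
  have [measurable]: "(\<lambda>\<beta>. f J (zero_fill J \<beta>)) \<in> borel_measurable (Pi\<^sub>M J (\<lambda>_. lborel))"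
    using prior[OF assms] by (simp add: prior_density_def)
  note [measurable] = Y_measurable zero_fill_measurable
  have [measurable]: "(\<lambda>x. lp (zero_fill J (snd x)) i) \<in> borel_measurable (M \<Otimes>\<^sub>M Pi\<^sub>M J (\<lambda>_. lborel))" for i
    by (rule measurable_compose[OF measurable_compose[OF measurable_snd zero_fill_measurable] lin_pred_measurable])
  have "(\<lambda>(\<omega>, \<beta>). ennreal (exp (ll (obs \<omega>) (zero_fill J \<beta>)) * f J (zero_fill J \<beta>)))
      \<in> borel_measurable (M \<Otimes>\<^sub>M Pi\<^sub>M J (\<lambda>_. lborel))"
    unfolding split_beta' loglik_def by measurable
  then show ?thesis unfolding evidence_def by (rule B.borel_measurable_nn_integral)
qed

definition selected :: "'w set" where
  "selected = {\<omega> \<in> space M. {J. is_arg_max (bayes \<gamma> \<mu> n p X (obs \<omega>) f)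
      (\<lambda>J. J \<subseteq> {1..p} \<and> card J \<le> q) J} = {supp \<beta>0}}"

text \<open>A unique maximizer amounts to strict inequalities against finitely many competitors; in
  this form both measurability and the comparison of models are proved.\<close>

lemma selected_iff:
  "\<omega> \<in> selected \<longleftrightarrow> \<omega> \<in> space M \<and>
     (\<forall>J\<in>{J. J \<subseteq> {1..p} \<and> card J \<le> q} - {supp \<beta>0}. bay J \<omega> < bay (supp \<beta>0) \<omega>)"
proof -
  define g where "g = bayes \<gamma> \<mu> n p X (obs \<omega>) f"
  define P where "P = (\<lambda>J. J \<subseteq> {1..p} \<and> card J \<le> q)"
  have P0: "P (supp \<beta>0)" using supp_subset sparse by (simp add: P_def)
  have "{J. is_arg_max g P J} = {supp \<beta>0} \<longleftrightarrow> (\<forall>J. P J \<and> J \<noteq> supp \<beta>0 \<longrightarrow> g J < g (supp \<beta>0))"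
  proof
    assume eq: "{J. is_arg_max g P J} = {supp \<beta>0}"
    then have max: "\<not> g (supp \<beta>0) < g J" if "P J" for J
      using that unfolding is_arg_max_def by blast
    show "\<forall>J. P J \<and> J \<noteq> supp \<beta>0 \<longrightarrow> g J < g (supp \<beta>0)"
    proof (intro allI impI, rule ccontr)
      fix J assume J: "P J \<and> J \<noteq> supp \<beta>0" and "\<not> g J < g (supp \<beta>0)"
      then have "g J = g (supp \<beta>0)" using max[of J] by auto
      then have "is_arg_max g P J" using J max unfolding is_arg_max_def by auto
      then show False using eq J by auto
    qed
  next
    assume *: "\<forall>J. P J \<and> J \<noteq> supp \<beta>0 \<longrightarrow> g J < g (supp \<beta>0)"
    then have "\<not> g (supp \<beta>0) < g J" if "P J" for J using that by (cases "J = supp \<beta>0") auto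
    then have "is_arg_max g P (supp \<beta>0)" using P0 unfolding is_arg_max_def by blast
    moreover have "J = supp \<beta>0" if "is_arg_max g P J" for J
      using that * P0 unfolding is_arg_max_def by blast
    ultimately show "{J. is_arg_max g P J} = {supp \<beta>0}" by blast
  qed
  then show ?thesis unfolding selected_def g_def P_def by auto
qed

lemma selected_events: "selected \<in> events"
proof -
  define \<J> where "\<J> = {J. J \<subseteq> {1..p} \<and> card J \<le> q} - {supp \<beta>0}"
  have fin: "finite \<J>" by (rule finite_subset[of _ "Pow {1..p}"]) (auto simp: \<J>_def)
  have m: "(\<lambda>\<omega>. bay J \<omega>) \<in> borel_measurable M" if "J \<subseteq> {1..p}" "card J \<le> q" for J
    using evidence_measurable[OF that] unfolding bayes_def by measurable
  have "{\<omega> \<in> space M. \<forall>J\<in>\<J>. bay J \<omega> < bay (supp \<beta>0) \<omega>} \<in> events"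
  proof (rule sets.sets_Collect_finite_All[OF _ fin])
    fix J assume "J \<in> \<J>"
    then have J: "J \<subseteq> {1..p}" "card J \<le> q" by (auto simp: \<J>_def)
    note [measurable] = m[OF J] m[OF supp_subset sparse]
    show "{\<omega> \<in> space M. bay J \<omega> < bay (supp \<beta>0) \<omega>} \<in> events" by measurable
  qed
  also have "{\<omega> \<in> space M. \<forall>J\<in>\<J>. bay J \<omega> < bay (supp \<beta>0) \<omega>} = selected"
    using selected_iff unfolding \<J>_def by blast
  finally show ?thesis .
qed

text \<open>Beyond radius \<rho> the divergence is at least \<open>cl * real n * \<rho> / 2\<close>
  times the norm, while \<open>dom\<close> limits the score to half of that slope. The difference,
  evaluated at norm \<rho>, is the drop.\<close>

lemma loglik_tail:
  assumes a: "adm J" and b: "\<beta> \<in> coord_space J" and \<rho>: "0 < \<rho>" "\<rho> \<le> 1" "\<rho> \<le> nrm (\<lambda>j. \<beta> j - \<beta>0 j)"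
    and B: "B \<ge> 0" "\<And>j. j \<in> {1..p} \<Longrightarrow> \<bar>score y (unit_vec j)\<bar> \<le> B"
    and dom: "B * sqrt (2 * real q) \<le> cl * real n * \<rho> / 4"
  shows "ll y \<beta> \<le> ll y \<beta>0 - cl * real n * \<rho>\<^sup>2 / 4"
proof -
  define \<delta> where "\<delta> = (\<lambda>j. \<beta> j - \<beta>0 j)"
  have d: "\<delta> \<in> coord_space J" unfolding \<delta>_def by (rule coord_space_diff[OF b beta0_adm[OF a]])
  have cn: "0 \<le> cl * real n" using cl_pos by simp
  have "\<bar>score y \<delta>\<bar> \<le> B * sqrt (real (card J)) * nrm \<delta>"
    by (rule score_bound_unit[OF admD(1)[OF a] d B])
  also have "\<dots> \<le> B * sqrt (2 * real q) * nrm \<delta>"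
    using a B(1) by (intro mult_right_mono mult_left_mono) (auto simp: adm_def L2_set_nonneg)
  also have "\<dots> \<le> cl * real n * \<rho> / 4 * nrm \<delta>"
    by (intro mult_right_mono dom L2_set_nonneg)
  finally have s: "score y \<delta> \<le> cl * real n * \<rho> / 4 * nrm \<delta>" by linarith
  have "cl * real n * \<rho> * nrm \<delta> / 2 \<le> bregman \<delta>"
    using \<rho> by (intro bregman_tail[OF a d]) (auto simp: \<delta>_def)
  moreover have "cl * real n * \<rho> * \<rho> \<le> cl * real n * \<rho> * nrm \<delta>"
    using \<rho> cn by (intro mult_left_mono) (auto simp: \<delta>_def)
  moreover have "ll y \<beta> = ll y \<beta>0 + score y \<delta> - bregman \<delta>"
    using loglik_expand[of y \<delta>] by (simp add: \<delta>_def)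
  ultimately show ?thesis using s by (simp add: power2_eq_square mult.assoc)
qed

text \<open>Purely deterministic: outside the two exceptional events every competitor loses. The
  numerical hypotheses isolate what is required of radii and thresholds; the choices made in
  \<open>tuning\<close> satisfy them.\<close>

lemma correct_selection:
  assumes \<Lambda>: "sqrt (cu / cl) \<le> \<Lambda>" "1 \<le> \<Lambda>"
    and R: "R > 0" "R \<le> 1" "nrm \<beta>0 + (1 + \<Lambda>) * R \<le> am"
    and err: "ch * real n * (R ^ 3 + ((1 + \<Lambda>) * R) ^ 3) / 2 \<le> 1"
    and B: "B > 0" "B * sqrt (2 * real q) \<le> cl * real n * R / 4"
    and bmin: "R \<le> bmin" "bmin \<le> 1" "\<And>j. j \<in> supp \<beta>0 \<Longrightarrow> bmin \<le> \<bar>\<beta>0 j\<bar>"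
    and \<eta>: "\<eta> > 0" "2 * \<eta> \<le> 1" "real q * \<eta> \<le> R"
      "B * sqrt (2 * real q) * (real q * \<eta>) + cu * real n * (real q * \<eta>)\<^sup>2 / 2 \<le> 1"
    and p2q: "2 * q \<le> p"
    and under: "exp (- (cl * real n * bmin\<^sup>2 / 4)) < F4 * exp (- 1) * (2 * \<eta>) ^ q * (real p ^ q) powr (- \<gamma>)"
    and far: "exp (- (cl * real n * R\<^sup>2 / 4)) < F4 * exp (- 1) * (2 * \<eta>) ^ q * (real p ^ q) powr (- \<gamma>) / 2"
    and g: "g = (real q / (real p - real q)) powr \<gamma>" and \<sigma>: "\<sigma> = sqrt (4 * pi / (cl * real n))"
    and s: "s > 0" "g * s \<le> 1" "g * \<sigma> \<le> 1" "F3 * exp 1 * (g * s + g * \<sigma>) \<le> F4 / 2"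
    and \<rho>: "\<rho> = 4 * B / (cl * real n)" and \<alpha>: "\<alpha> = 1 / (2 * \<rho>\<^sup>2)"
    and \<omega>: "\<omega> \<in> space M" "\<omega> \<notin> bad_score B" "\<omega> \<notin> bad_excess R \<alpha> s"
  shows "\<omega> \<in> selected"
proof -
  let ?J0 = "supp \<beta>0" and ?y = "obs \<omega>"
  let ?l0 = "ll ?y \<beta>0"
  define loc where "loc = local_lik ?y ((1 + \<Lambda>) * R)"
  define w where "w = (\<lambda>k. real (p choose k) powr (- \<gamma>))"
  let ?q0 = "card ?J0"
  have cn: "cl * real n > 0" using cl_pos n_pos by simp
  have p_pos: "p \<ge> 1" using p2q q_pos by simp
  have w1: "w k \<le> 1" if "k \<le> q" for k
  proof -
    have "1 \<le> real (p choose k)" using that p2q by (simp add: Suc_leI)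
    then have "real (p choose k) powr (- \<gamma>) \<le> 1 powr (- \<gamma>)"
      using gamma_nonneg by (intro powr_mono2') auto
    then show ?thesis by (simp add: w_def)
  qed
  have w_pos: "w k > 0" if "k \<le> q" for k using that p2q by (simp add: w_def)
  \<comment> \<open>A crude bound on the binomial coefficient suffices, because it is only compared
    with exponentially small likelihoods.\<close>
  have w0: "(real p ^ q) powr (- \<gamma>) \<le> w ?q0"
    unfolding w_def
  proof (rule powr_mono2')
    show "0 < real (p choose ?q0)" using sparse p2q by simp
    have "p choose ?q0 \<le> p ^ ?q0" by (rule binomial_le_pow) (use sparse p2q in linarith)
    also have "\<dots> \<le> p ^ q" using sparse p_pos by (intro power_increasing) auto
    finally show "real (p choose ?q0) \<le> real p ^ q" by (simp flip: of_nat_power)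
  qed (use gamma_nonneg in auto)
  have su: "\<bar>score ?y (unit_vec j)\<bar> \<le> B" if "j \<in> {1..p}" for j
    using \<omega>(1,2) that by (auto simp: bad_score_def not_le intro: less_imp_le)
  have so: "\<bar>score ?y (orth j)\<bar> \<le> B" if "j \<in> {1..p} - ?J0" for j
    using \<omega>(1,2) that by (auto simp: bad_score_def not_le intro: less_imp_le)
  have ev0: "ennreal F4 * loc \<le> evidence \<mu> n p X ?y f ?J0"
    unfolding loc_def using F_pos R(3)
    by (intro evidence_ge[where am = am] prior supp_subset sparse prior_ge) auto
  have tail: "ll ?y \<beta> \<le> ?l0 - cl * real n * r\<^sup>2 / 4"
    if "adm J" "\<beta> \<in> coord_space J" "R \<le> r" "r \<le> 1" "r \<le> nrm (\<lambda>j. \<beta> j - \<beta>0 j)" for J \<beta> r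
  proof (rule loglik_tail[OF that(1,2) _ that(4,5) _ su])
    have "cl * real n * R / 4 \<le> cl * real n * r / 4"
      using that(3) cn by (intro divide_right_mono mult_left_mono) auto
    then show "B * sqrt (2 * real q) \<le> cl * real n * r / 4" using B(2) by linarith
  qed (use that(3) R(1) B(1) in auto)
  have score_J0: "\<bar>score ?y u\<bar> \<le> B * sqrt (2 * real q) * nrm u" if "u \<in> coord_space ?J0" for u
  proof -
    have "\<bar>score ?y u\<bar> \<le> B * sqrt (real ?q0) * nrm u"
      using B(1) by (intro score_bound_unit[OF supp_subset that] su) auto
    also have "\<dots> \<le> B * sqrt (2 * real q) * nrm u"
      using sparse B(1) by (intro mult_right_mono mult_left_mono) (auto simp: L2_set_nonneg)
    finally show ?thesis .
  qed
  \<comment> \<open>Strictness needs finiteness: in \<open>ennreal\<close>, half of an infinite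
    value is not smaller than the whole.\<close>
  have ev0_fin: "evidence \<mu> n p X ?y f ?J0 < \<top>"
  proof -
    have "ll ?y \<beta> \<le> ?l0 + B * sqrt (2 * real q) * R" if b: "\<beta> \<in> coord_space ?J0" for \<beta>
    proof (cases "R \<le> nrm (\<lambda>j. \<beta> j - \<beta>0 j)")
      case True
      have "ll ?y \<beta> \<le> ?l0 - cl * real n * R\<^sup>2 / 4"
        by (rule tail[OF adm_supp b order_refl R(2) True])
      moreover have "0 \<le> cl * real n * R\<^sup>2 / 4" "0 \<le> B * sqrt (2 * real q) * R" using cn B(1) R(1) by auto
      ultimately show ?thesis by linarith
    next
      case False
      define \<delta> where "\<delta> = (\<lambda>j. \<beta> j - \<beta>0 j)"
      have d: "\<delta> \<in> coord_space ?J0" unfolding \<delta>_def by (rule coord_space_diff[OF b beta0_supp])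
      have "nrm \<delta> \<le> 1" using False R(2) by (simp add: \<delta>_def)
      then have "cl * real n * (nrm \<delta>)\<^sup>2 / 2 \<le> bregman \<delta>" by (rule bregman_bounds(1)[OF adm_supp d])
      moreover have "0 \<le> cl * real n * (nrm \<delta>)\<^sup>2 / 2" using cn by simp
      moreover have "B * sqrt (2 * real q) * nrm \<delta> \<le> B * sqrt (2 * real q) * R"
        using False B(1) by (intro mult_left_mono) (auto simp: \<delta>_def)
      ultimately show ?thesis using score_J0[OF d] loglik_expand[of ?y \<delta>] by (simp add: \<delta>_def)
    qed
    then have "evidence \<mu> n p X ?y f ?J0 \<le> ennreal (exp (?l0 + B * sqrt (2 * real q) * R))"
      by (rule evidence_le[where f = f and J = "supp \<beta>0", OF supp_subset sparse prior[OF supp_subset sparse]])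
    then show ?thesis by (rule order.strict_trans1) simp
  qed
  have loc_fin: "loc < \<top>"
  proof (rule ccontr)
    assume "\<not> loc < \<top>"
    then have "loc = \<top>" using less_top by blast
    then have "ennreal F4 * loc = \<top>" using F_pos by (simp add: ennreal_mult_top)
    then show False using ev0 ev0_fin by (simp add: top_unique)
  qed
  \<comment> \<open>On the cube of half-width \<eta> the log-likelihood drops by at most 1. Passing
    from the exponent \<open>card ?J0\<close> to \<open>q\<close> uses
    \<open>2 * \<eta> \<le> 1\<close>.\<close>
  have loc_ge: "ennreal (exp ?l0 * (exp (- 1) * (2 * \<eta>) ^ q)) \<le> loc"
  proof -
    have "ennreal (exp (?l0 - 1) * (2 * \<eta>) ^ ?q0) \<le> loc"
      unfolding loc_def
    proof (rule local_lik_ge)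
      fix u assume u: "u \<in> coord_space ?J0" and ub: "\<And>j. \<bar>u j\<bar> \<le> \<eta>"
      have "nrm u = L2_set u ?J0" by (rule L2_set_coord_space[OF u supp_subset]) simp
      also have "\<dots> \<le> (\<Sum>j\<in>?J0. \<bar>u j\<bar>)" by (rule L2_set_le_sum_abs)
      also have "\<dots> \<le> (\<Sum>j\<in>?J0. \<eta>)" by (intro sum_mono ub)
      also have "\<dots> \<le> real q * \<eta>" using sparse \<eta>(1) by simp
      finally have nu: "nrm u \<le> real q * \<eta>" .
      have R\<Lambda>: "R \<le> (1 + \<Lambda>) * R" using \<Lambda>(2) R(1) by (simp add: algebra_simps)
      have "bregman u \<le> cu * real n * (nrm u)\<^sup>2 / 2"
        by (rule bregman_bounds(2)[OF adm_supp u]) (use nu \<eta>(3) R(2) in linarith)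
      also have "\<dots> \<le> cu * real n * (real q * \<eta>)\<^sup>2 / 2"
        using nu cu_pos by (intro divide_right_mono mult_left_mono power_mono) (auto simp: L2_set_nonneg)
      finally have "bregman u \<le> cu * real n * (real q * \<eta>)\<^sup>2 / 2" .
      moreover have "B * sqrt (2 * real q) * nrm u \<le> B * sqrt (2 * real q) * (real q * \<eta>)"
        using nu B(1) by (intro mult_left_mono) auto
      ultimately have "?l0 - 1 \<le> ll ?y (\<lambda>j. \<beta>0 j + u j)"
        using score_J0[OF u] \<eta>(4) unfolding loglik_expand by linarith
      then show "nrm u \<le> (1 + \<Lambda>) * R \<and> ?l0 - 1 \<le> ll ?y (\<lambda>j. \<beta>0 j + u j)"
        using nu \<eta>(3) R\<Lambda> by linarith
    qed (use \<eta>(1) in simp)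
    moreover have "exp ?l0 * (exp (- 1) * (2 * \<eta>) ^ q) \<le> exp (?l0 - 1) * (2 * \<eta>) ^ ?q0"
    proof -
      have "exp ?l0 * (exp (- 1) * (2 * \<eta>) ^ q) = exp (?l0 - 1) * (2 * \<eta>) ^ q"
        by (simp add: exp_diff exp_minus divide_inverse mult.assoc)
      also have "\<dots> \<le> exp (?l0 - 1) * (2 * \<eta>) ^ ?q0"
        using sparse \<eta>(1,2) by (intro mult_left_mono power_decreasing) auto
      finally show ?thesis .
    qed
    ultimately show ?thesis by (meson ennreal_leI order_trans)
  qed
  have main_ge: "ennreal (w ?q0) * (ennreal F4 * loc) \<le> bay ?J0 \<omega>"
    unfolding bayes_def w_def by (intro mult_left_mono ev0) simp
  have base: "ennreal (exp ?l0 * (F4 * exp (- 1) * (2 * \<eta>) ^ q * (real p ^ q) powr (- \<gamma>)))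
      \<le> ennreal (w ?q0) * (ennreal F4 * loc)"
  proof -
    have "exp ?l0 * (F4 * exp (- 1) * (2 * \<eta>) ^ q * (real p ^ q) powr (- \<gamma>))
        \<le> exp ?l0 * (F4 * exp (- 1) * (2 * \<eta>) ^ q * w ?q0)"
      using w0 F_pos \<eta>(1) by (intro mult_left_mono) auto
    then have "ennreal (exp ?l0 * (F4 * exp (- 1) * (2 * \<eta>) ^ q * (real p ^ q) powr (- \<gamma>)))
        \<le> ennreal (w ?q0) * (ennreal F4 * ennreal (exp ?l0 * (exp (- 1) * (2 * \<eta>) ^ q)))"
      using F_pos \<eta>(1) by (simp add: ennreal_mult'[symmetric] ennreal_leI mult_ac w_def)
    also have "\<dots> \<le> ennreal (w ?q0) * (ennreal F4 * loc)"
      by (intro mult_left_mono loc_ge) auto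
    finally show ?thesis .
  qed
  have "bay J \<omega> < bay ?J0 \<omega>" if J: "J \<subseteq> {1..p}" "card J \<le> q" "J \<noteq> ?J0" for J
  proof (cases "?J0 \<subseteq> J")
    case False
    then obtain k where k: "k \<in> ?J0" "k \<notin> J" by auto
    \<comment> \<open>Here the allowance \<open>2 * q\<close> is used: two models of size at most
      \<open>q\<close> are united.\<close>
    have a: "adm (?J0 \<union> J)"
      using J supp_subset sparse card_Un_le[of ?J0 J] by (auto simp: adm_def)
    have "ll ?y \<beta> \<le> ?l0 - cl * real n * bmin\<^sup>2 / 4" if b: "\<beta> \<in> coord_space J" for \<beta>
    proof (rule tail[OF a _ bmin(1,2)])
      show "\<beta> \<in> coord_space (?J0 \<union> J)" using b by (auto simp: coord_space_def)
      \<comment> \<open>Every \<beta> in the model vanishes at the missed covariate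
        \<open>k\<close>, so it stays at least the signal strength away from \<beta>0.\<close>
      have "bmin \<le> \<bar>\<beta> k - \<beta>0 k\<bar>" using b k bmin(3)[OF k(1)] by (auto simp: coord_space_def)
      also have "\<dots> \<le> nrm (\<lambda>j. \<bar>\<beta> j - \<beta>0 j\<bar>)"
        using k(1) supp_subset by (intro member_le_L2_set) auto
      finally show "bmin \<le> nrm (\<lambda>j. \<beta> j - \<beta>0 j)" by (simp add: L2_set_def)
    qed
    then have "evidence \<mu> n p X ?y f J \<le> ennreal (exp (?l0 - cl * real n * bmin\<^sup>2 / 4))"
      by (rule evidence_le[where f = f and J = J, OF J(1,2) prior[OF J(1,2)]])
    then have "bay J \<omega> \<le> ennreal 1 * ennreal (exp (?l0 - cl * real n * bmin\<^sup>2 / 4))"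
      unfolding bayes_def using w1[OF J(2)] by (intro mult_mono ennreal_leI) (auto simp: w_def)
    also have "\<dots> = ennreal (exp ?l0 * exp (- (cl * real n * bmin\<^sup>2 / 4)))"
      by (simp add: exp_add[symmetric])
    also have "\<dots> < ennreal (exp ?l0 * (F4 * exp (- 1) * (2 * \<eta>) ^ q * (real p ^ q) powr (- \<gamma>)))"
      by (intro ennreal_lessI mult_strict_left_mono under mult_pos_pos) (use F_pos \<eta>(1) p_pos in auto)
    also note base also note main_ge
    finally show ?thesis .
  next
    case True
    define V where "V = J - ?J0"
    let ?r = "card V"
    have JV: "J = ?J0 \<union> V" and Vd: "V \<inter> ?J0 = {}" using True by (auto simp: V_def)
    have finV: "finite V" using J(1) finite_subset[of V "{1..p}"] by (auto simp: V_def)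
    have cJ: "card J = ?q0 + ?r" unfolding JV by (rule card_Un_disjoint[OF supp_finite finV]) (use Vd in auto)
    have Vext: "V \<in> extensions"
    proof -
      have "V \<noteq> {}" using True J(3) unfolding V_def by blast
      moreover have "V \<subseteq> {1..p} - ?J0" using J(1) unfolding V_def by blast
      moreover have "card (?J0 \<union> V) \<le> q" using J(2) JV by simp
      ultimately show ?thesis unfolding extensions_def by blast
    qed
    have aJ: "adm (?J0 \<union> V)" by (rule extensionsD(3)[OF Vext])
    have r1: "?r \<ge> 1" using extensionsD(1,2)[OF Vext] by (simp add: Suc_leI card_gt_0_iff)
    have "excess V R ?y \<le> tempered_excess V R (1 / (2 * \<rho>\<^sup>2)) ?y + ennreal (sqrt (4 * pi / (cl * real n)) ^ ?r)"
    proof (rule excess_le[OF aJ Vd _ B(1) \<rho>])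
      fix j assume "j \<in> V"
      then have "j \<in> {1..p} - ?J0" using extensionsD(5)[OF Vext] Vd by blast
      then show "\<bar>score ?y (orth j)\<bar> \<le> B" by (rule so)
    qed
    also have "\<dots> \<le> ennreal (s ^ ?r) + ennreal (\<sigma> ^ ?r)"
      using \<omega>(1,3) Vext unfolding bad_excess_def \<alpha> \<sigma> by (intro add_mono) (auto simp: not_le intro: less_imp_le)
    also have "\<dots> = ennreal (s ^ ?r + \<sigma> ^ ?r)" using s(1) cn \<sigma> by simp
    finally have ex: "excess V R ?y \<le> ennreal (s ^ ?r + \<sigma> ^ ?r)" .
    have g0: "g \<ge> 0" and \<sigma>0: "\<sigma> \<ge> 0" using g \<sigma> cn by auto
    have wJ: "w (card J) \<le> w ?q0 * g ^ ?r"
      unfolding w_def g cJ using J(2) cJ p2q gamma_nonneg q_pos by (intro binomial_powr_ratio) auto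
    have "evidence \<mu> n p X ?y f J \<le> ennreal F3 *
        lint J (\<lambda>\<beta>. indicator {\<beta>. nrm (\<lambda>j. \<beta> j - \<beta>0 j) \<le> R} \<beta> * ennreal (exp (ll ?y \<beta>)))
        + ennreal (exp (?l0 - cl * real n * R\<^sup>2 / 4))"
      using aJ J(1,2) unfolding JV[symmetric]
      by (intro evidence_split prior prior_le tail[OF _ _ order_refl R(2)]) auto
    also have "\<dots> \<le> ennreal F3 * (ennreal (exp 1) * loc * ennreal (s ^ ?r + \<sigma> ^ ?r))
        + ennreal (exp (?l0 - cl * real n * R\<^sup>2 / 4))"
    proof (intro add_mono mult_left_mono order_refl)
      have "lint J (\<lambda>\<beta>. indicator {\<beta>. nrm (\<lambda>j. \<beta> j - \<beta>0 j) \<le> R} \<beta> * ennreal (exp (ll ?y \<beta>)))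
          \<le> ennreal (exp 1) * loc * excess V R ?y"
        unfolding JV loc_def using R(1) by (intro local_evidence_le[OF aJ Vd _ \<Lambda>(1) err]) simp
      also have "\<dots> \<le> ennreal (exp 1) * loc * ennreal (s ^ ?r + \<sigma> ^ ?r)" by (intro mult_left_mono ex) simp
      finally show "lint J (\<lambda>\<beta>. indicator {\<beta>. nrm (\<lambda>j. \<beta> j - \<beta>0 j) \<le> R} \<beta> * ennreal (exp (ll ?y \<beta>)))
          \<le> ennreal (exp 1) * loc * ennreal (s ^ ?r + \<sigma> ^ ?r)" .
    qed simp
    finally have evJ: "evidence \<mu> n p X ?y f J \<le> ennreal F3 * (ennreal (exp 1) * loc * ennreal (s ^ ?r + \<sigma> ^ ?r))
        + ennreal (exp (?l0 - cl * real n * R\<^sup>2 / 4))" .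
    have "bay J \<omega> \<le> ennreal (w (card J)) * (ennreal F3 * (ennreal (exp 1) * loc * ennreal (s ^ ?r + \<sigma> ^ ?r))
        + ennreal (exp (?l0 - cl * real n * R\<^sup>2 / 4)))"
      unfolding bayes_def w_def by (intro mult_left_mono evJ) simp
    also have "\<dots> = ennreal (w (card J) * (F3 * exp 1 * (s ^ ?r + \<sigma> ^ ?r))) * loc
        + ennreal (w (card J) * exp (?l0 - cl * real n * R\<^sup>2 / 4))"
      using F_pos s(1) \<sigma>0 by (simp add: ennreal_mult distrib_left mult_ac w_def)
    \<comment> \<open>The lower bound for the true model is shared out: the local part of
      \<open>J\<close> gets at most one half, and \<open>far\<close> keeps the remote part strictly
      below the other half.\<close>
    also have "\<dots> \<le> ennreal (w ?q0 * (F4 / 2)) * loc + ennreal (exp ?l0 * exp (- (cl * real n * R\<^sup>2 / 4)))"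
    proof (intro add_mono mult_right_mono ennreal_leI)
      have "w (card J) * (F3 * exp 1 * (s ^ ?r + \<sigma> ^ ?r)) \<le> w ?q0 * g ^ ?r * (F3 * exp 1 * (s ^ ?r + \<sigma> ^ ?r))"
        using F_pos s(1) \<sigma>0 by (intro mult_right_mono wJ) auto
      also have "\<dots> = w ?q0 * (F3 * exp 1 * ((g * s) ^ ?r + (g * \<sigma>) ^ ?r))"
        by (simp add: power_mult_distrib algebra_simps)
      also have "\<dots> \<le> w ?q0 * (F3 * exp 1 * (g * s + g * \<sigma>))"
      proof -
        have "(g * s) ^ ?r \<le> (g * s) ^ 1" "(g * \<sigma>) ^ ?r \<le> (g * \<sigma>) ^ 1"
          using s g0 \<sigma>0 r1 by (intro power_decreasing; simp)+
        then show ?thesis using F_pos w_pos[OF sparse] by (intro mult_left_mono) auto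
      qed
      also have "\<dots> \<le> w ?q0 * (F4 / 2)" using s(4) w_pos[OF sparse] by (intro mult_left_mono) auto
      finally show "w (card J) * (F3 * exp 1 * (s ^ ?r + \<sigma> ^ ?r)) \<le> w ?q0 * (F4 / 2)" .
      have "w (card J) * exp (?l0 - cl * real n * R\<^sup>2 / 4) \<le> 1 * exp (?l0 - cl * real n * R\<^sup>2 / 4)"
        using w1[OF J(2)] by (intro mult_right_mono) auto
      then show "w (card J) * exp (?l0 - cl * real n * R\<^sup>2 / 4) \<le> exp ?l0 * exp (- (cl * real n * R\<^sup>2 / 4))"
        by (simp add: exp_add[symmetric])
    qed simp
    also have "\<dots> < ennreal (w ?q0) * (ennreal F4 * loc)"
    proof -
      obtain t where t: "loc = ennreal t" "t \<ge> 0" using loc_fin by (cases loc) auto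
      let ?K = "F4 * exp (- 1) * (2 * \<eta>) ^ q * (real p ^ q) powr (- \<gamma>)"
      have K: "exp ?l0 * ?K \<le> w ?q0 * F4 * t"
        using base F_pos t(2) w_pos[OF sparse] unfolding t(1)
        by (simp add: ennreal_mult'[symmetric] mult.assoc)
      have "exp ?l0 * exp (- (cl * real n * R\<^sup>2 / 4)) < exp ?l0 * (?K / 2)"
        using far by (intro mult_strict_left_mono) auto
      then have "w ?q0 * (F4 / 2) * t + exp ?l0 * exp (- (cl * real n * R\<^sup>2 / 4)) < w ?q0 * F4 * t"
      proof -
        have "exp ?l0 * (?K / 2) = exp ?l0 * ?K / 2" "w ?q0 * (F4 / 2) * t = w ?q0 * F4 * t / 2" by simp_all
        then show ?thesis using K \<open>exp ?l0 * exp (- (cl * real n * R\<^sup>2 / 4)) < exp ?l0 * (?K / 2)\<close> by linarith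
      qed
      then have "ennreal (w ?q0 * (F4 / 2) * t + exp ?l0 * exp (- (cl * real n * R\<^sup>2 / 4))) < ennreal (w ?q0 * F4 * t)"
        using F_pos t(2) w_pos[OF sparse] by (intro ennreal_lessI) (auto intro: le_less_trans[rotated])
      then show ?thesis using F_pos t(2) w_pos[OF sparse] unfolding t(1)
        by (simp add: ennreal_mult'[symmetric] mult.assoc ennreal_plus[symmetric] del: ennreal_plus)
    qed
    also note main_ge
    finally show ?thesis .
  qed
  then show ?thesis using \<omega>(1) unfolding selected_iff by blast
qed

lemma selection_prob:
  assumes "\<And>\<omega>. \<omega> \<in> space M \<Longrightarrow> \<omega> \<notin> bad_score B \<Longrightarrow> \<omega> \<notin> bad_excess R \<alpha> s \<Longrightarrow> \<omega> \<in> selected"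
    and "bad_score B \<in> events" "bad_excess R \<alpha> s \<in> events"
  shows "1 - prob (bad_score B) - prob (bad_excess R \<alpha> s) \<le> prob selected"
proof -
  have "space M \<subseteq> selected \<union> (bad_score B \<union> bad_excess R \<alpha> s)" using assms(1) by blast
  then have "prob (space M) \<le> prob (selected \<union> (bad_score B \<union> bad_excess R \<alpha> s))"
    using assms selected_events by (intro finite_measure_mono) auto
  also have "\<dots> \<le> prob selected + prob (bad_score B \<union> bad_excess R \<alpha> s)"
    using assms selected_events by (intro measure_Un_le) auto
  also have "prob (bad_score B \<union> bad_excess R \<alpha> s) \<le> prob (bad_score B) + prob (bad_excess R \<alpha> s)"
    using assms by (intro measure_Un_le) auto
  finally show ?thesis by (simp add: prob_space)
qed

end

section \<open>From the Loewner order and the spectral norm to quadratic forms\<close>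

lemma quad_form_neg_hessian:
  assumes "J \<subseteq> {1..p}" "\<delta> \<in> coord_space J"
  shows "(\<Sum>j\<in>J. \<Sum>k\<in>J. \<delta> j * neg_hessian \<mu> n p X \<beta> j k * \<delta> k)
    = (\<Sum>i=1..n. deriv (deriv (cumulant \<mu>)) (lin_pred p X \<beta> i) * (lin_pred p X \<delta> i * lin_pred p X \<delta> i))"
proof -
  let ?h = "\<lambda>i. deriv (deriv (cumulant \<mu>)) (lin_pred p X \<beta> i)"
  have l: "lin_pred p X \<delta> i = (\<Sum>j\<in>J. \<delta> j * X i j)" for i
    unfolding lin_pred_def using assms
    by (intro sum.mono_neutral_cong_right) (auto simp: coord_space_def)
  have "(\<Sum>j\<in>J. \<Sum>k\<in>J. \<delta> j * neg_hessian \<mu> n p X \<beta> j k * \<delta> k)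
      = (\<Sum>j\<in>J. \<Sum>k\<in>J. \<Sum>i=1..n. ?h i * ((\<delta> j * X i j) * (\<delta> k * X i k)))"
    unfolding neg_hessian_def sum_distrib_left sum_distrib_right by (simp add: mult_ac)
  also have "\<dots> = (\<Sum>j\<in>J. \<Sum>i=1..n. \<Sum>k\<in>J. ?h i * ((\<delta> j * X i j) * (\<delta> k * X i k)))"
    by (intro sum.cong refl sum.swap)
  also have "\<dots> = (\<Sum>i=1..n. \<Sum>j\<in>J. \<Sum>k\<in>J. ?h i * ((\<delta> j * X i j) * (\<delta> k * X i k)))"
    by (rule sum.swap)
  also have "\<dots> = (\<Sum>i=1..n. ?h i * (lin_pred p X \<delta> i * lin_pred p X \<delta> i))"
  proof (intro sum.cong refl)
    fix i
    have "lin_pred p X \<delta> i * lin_pred p X \<delta> i = (\<Sum>j\<in>J. \<Sum>k\<in>J. (\<delta> j * X i j) * (\<delta> k * X i k))"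
      unfolding l by (rule sum_product)
    then show "(\<Sum>j\<in>J. \<Sum>k\<in>J. ?h i * ((\<delta> j * X i j) * (\<delta> k * X i k)))
        = ?h i * (lin_pred p X \<delta> i * lin_pred p X \<delta> i)"
      by (simp only: sum_distrib_left)
  qed
  finally show ?thesis .
qed

lemma loewner_le_scaled_id:
  assumes "loewner_le J (\<lambda>j k. c * id_mat j k) A" "finite J"
  shows "c * (L2_set \<delta> J)\<^sup>2 \<le> (\<Sum>j\<in>J. \<Sum>k\<in>J. \<delta> j * A j k * \<delta> k)"
proof -
  have "(\<Sum>j\<in>J. \<Sum>k\<in>J. \<delta> j * (c * id_mat j k) * \<delta> k) = c * (\<Sum>j\<in>J. (\<delta> j)\<^sup>2)"
    unfolding id_mat_def using assms(2)
    by (simp add: if_distrib[of "\<lambda>x. _ * x"] if_distrib[of "\<lambda>x. x * _"] sum_distrib_left power2_eq_square mult_ac cong: if_cong)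
  moreover have "0 \<le> (\<Sum>j\<in>J. \<Sum>k\<in>J. \<delta> j * (A j k - c * id_mat j k) * \<delta> k)"
    using assms(1) by (simp add: loewner_le_def psd_on_def)
  ultimately show ?thesis
    by (simp add: L2_set_square algebra_simps sum_subtractf)
qed

lemma loewner_ge_scaled_id:
  assumes "loewner_le J A (\<lambda>j k. c * id_mat j k)" "finite J"
  shows "(\<Sum>j\<in>J. \<Sum>k\<in>J. \<delta> j * A j k * \<delta> k) \<le> c * (L2_set \<delta> J)\<^sup>2"
proof -
  have "loewner_le J (\<lambda>j k. - c * id_mat j k) (\<lambda>j k. - A j k)"
    using assms(1) by (simp add: loewner_le_def psd_on_def)
  from loewner_le_scaled_id[OF this assms(2), of \<delta>] show ?thesis
    by (simp add: sum_negf)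
qed

text \<open>Scaling \<delta> to the unit ball gives the operator bound on the length of
  \<open>A \<delta>\<close>; Cauchy-Schwarz then bounds the quadratic form.\<close>

lemma spectral_norm_quad_form:
  assumes fin: "finite J"
  shows "\<bar>\<Sum>j\<in>J. \<Sum>k\<in>J. \<delta> j * A j k * \<delta> k\<bar> \<le> spectral_norm J A * (L2_set \<delta> J)\<^sup>2"
proof -
  let ?A = "\<lambda>v j. \<Sum>k\<in>J. A j k * v k"
  let ?S = "(\<lambda>v. L2_set (?A v) J) ` {v. L2_set v J \<le> 1}"
  \<comment> \<open>A real supremum is informative only for a bounded set, so boundedness comes
    first; the sum of the absolute entries serves.\<close>
  have bdd: "bdd_above ?S"
  proof (rule bdd_aboveI2)
    fix v :: "nat \<Rightarrow> real" assume v: "v \<in> {v. L2_set v J \<le> 1}"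
    have "L2_set (\<lambda>j. \<bar>v j\<bar>) J = L2_set v J" by (simp add: L2_set_def)
    then have v1: "\<bar>v k\<bar> \<le> 1" if "k \<in> J" for k
      using member_le_L2_set[OF fin that, of "\<lambda>j. \<bar>v j\<bar>"] v by simp
    have "L2_set (?A v) J \<le> (\<Sum>j\<in>J. \<bar>?A v j\<bar>)" by (rule L2_set_le_sum_abs)
    also have "\<dots> \<le> (\<Sum>j\<in>J. \<Sum>k\<in>J. \<bar>A j k\<bar>)"
      using v1 by (intro sum_mono order_trans[OF sum_abs]) (simp add: abs_mult mult_left_le)
    finally show "L2_set (?A v) J \<le> (\<Sum>j\<in>J. \<Sum>k\<in>J. \<bar>A j k\<bar>)" .
  qed
  have op: "L2_set (?A \<delta>) J \<le> spectral_norm J A * L2_set \<delta> J"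
  proof (cases "L2_set \<delta> J = 0")
    case True
    then have "\<forall>k\<in>J. \<delta> k = 0" using L2_set_eq_0_iff[OF fin] by blast
    then show ?thesis using True by (simp add: L2_set_def)
  next
    case False
    then have pos: "L2_set \<delta> J > 0" using L2_set_nonneg[of \<delta> J] by linarith
    define v where "v = (\<lambda>k. (1 / L2_set \<delta> J) * \<delta> k)"
    have "L2_set v J \<le> 1" unfolding v_def L2_set_scale using pos by simp
    then have "L2_set (?A v) J \<le> spectral_norm J A"
      unfolding spectral_norm_def by (intro cSup_upper bdd) auto
    moreover have "?A v = (\<lambda>j. (1 / L2_set \<delta> J) * ?A \<delta> j)"
      by (auto simp: v_def sum_distrib_left mult_ac)
    then have "L2_set (?A v) J = L2_set (?A \<delta>) J / L2_set \<delta> J"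
      using pos L2_set_scale[of "1 / L2_set \<delta> J" "?A \<delta>" J] by simp
    ultimately show ?thesis using pos_divide_le_eq[OF pos] by metis
  qed
  have "\<bar>\<Sum>j\<in>J. \<Sum>k\<in>J. \<delta> j * A j k * \<delta> k\<bar> = \<bar>\<Sum>j\<in>J. \<delta> j * ?A \<delta> j\<bar>"
    by (simp add: sum_distrib_left mult.assoc)
  also have "\<dots> \<le> (\<Sum>j\<in>J. \<bar>\<delta> j\<bar> * \<bar>?A \<delta> j\<bar>)"
    by (intro order_trans[OF sum_abs]) (simp add: abs_mult)
  also have "\<dots> \<le> L2_set \<delta> J * L2_set (?A \<delta>) J" by (rule L2_set_mult_ineq)
  also have "\<dots> \<le> L2_set \<delta> J * (spectral_norm J A * L2_set \<delta> J)"
    by (intro mult_left_mono op L2_set_nonneg)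
  finally show ?thesis by (simp add: power2_eq_square mult_ac)
qed

text \<open>Vectors within distance 1 of \<beta>0 have norm at most \<open>rad\<close>, so bounds
  for the two functions on the interval from 0 to \<open>rad\<close> yield the constants.
  Nonnegativity far out comes from the positivity of \<open>c_lower\<close>.\<close>

lemma local_glm_curvI:
  assumes glm: "local_glm \<mu> n p q \<beta>0 cl cu ch"
    and hess: "\<And>J. J \<subseteq> {1..p} \<Longrightarrow> supp \<beta>0 \<subseteq> J \<Longrightarrow> card J \<le> 2 * q \<Longrightarrow>
        hessian_bounds c_lower c_upper ch \<mu> n p X J"
    and lo_pos: "\<And>r. r \<ge> 0 \<Longrightarrow> c_lower r > 0"
    and lo: "\<And>r. 0 \<le> r \<Longrightarrow> r \<le> rad \<Longrightarrow> cl \<le> c_lower r"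
    and up: "\<And>r. 0 \<le> r \<Longrightarrow> r \<le> rad \<Longrightarrow> c_upper r \<le> cu"
    and rad: "L2_set \<beta>0 {1..p} + 1 \<le> rad"
  shows "local_glm_curv \<mu> n p q X \<beta>0 cl cu ch"
proof -
  interpret local_glm \<mu> n p q X \<beta>0 cl cu ch by fact
  have n0: "real n > 0" using n_pos by simp
  have div: "(\<Sum>j\<in>J. \<Sum>k\<in>J. \<delta> j * (neg_hessian \<mu> n p X \<beta> j k / real n) * \<delta> k) = quad \<beta> \<delta> \<delta> / real n"
    if "J \<subseteq> {1..p}" "\<delta> \<in> coord_space J" for J \<beta> \<delta>
    unfolding quad_def quad_form_neg_hessian[OF that, symmetric] by (simp add: sum_divide_distrib)
  have hb: "hessian_bounds c_lower c_upper ch \<mu> n p X J" if "adm J" for J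
    using that hess by (simp add: adm_def)
  have nJ: "L2_set \<delta> {1..p} = L2_set \<delta> J" if "adm J" "\<delta> \<in> coord_space J" for J \<delta>
    by (rule L2_set_coord_space[OF that(2) admD(1)[OF that(1)]]) simp
  have bound: "L2_set \<beta> {1..p} \<le> rad" if "L2_set (\<lambda>j. \<beta> j - \<beta>0 j) {1..p} \<le> 1" for \<beta>
    using L2_set_triangle_ineq[of "\<lambda>j. \<beta> j - \<beta>0 j" \<beta>0 "{1..p}"] that rad by simp
  have lower: "c_lower (L2_set \<beta> {1..p}) * real n * (L2_set \<delta> {1..p})\<^sup>2 \<le> quad \<beta> \<delta> \<delta>"
    if "adm J" "\<beta> \<in> coord_space J" "\<delta> \<in> coord_space J" for J \<beta> \<delta>
  proof -
    have "loewner_le J (\<lambda>j k. c_lower (L2_set \<beta> {1..p}) * id_mat j k) (\<lambda>j k. neg_hessian \<mu> n p X \<beta> j k / real n)"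
      using hb[OF that(1)] that(2) unfolding hessian_bounds_def by blast
    from loewner_le_scaled_id[OF this admD(3)[OF that(1)], of \<delta>]
    show ?thesis unfolding div[OF admD(1)[OF that(1)] that(3)] nJ[OF that(1,3)] using n0 by (simp add: field_simps)
  qed
  have upper: "quad \<beta> \<delta> \<delta> \<le> c_upper (L2_set \<beta> {1..p}) * real n * (L2_set \<delta> {1..p})\<^sup>2"
    if "adm J" "\<beta> \<in> coord_space J" "\<delta> \<in> coord_space J" for J \<beta> \<delta>
  proof -
    have "loewner_le J (\<lambda>j k. neg_hessian \<mu> n p X \<beta> j k / real n) (\<lambda>j k. c_upper (L2_set \<beta> {1..p}) * id_mat j k)"
      using hb[OF that(1)] that(2) unfolding hessian_bounds_def by blast
    from loewner_ge_scaled_id[OF this admD(3)[OF that(1)], of \<delta>]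
    show ?thesis unfolding div[OF admD(1)[OF that(1)] that(3)] nJ[OF that(1,3)] using n0 by (simp add: field_simps)
  qed
  show ?thesis
  proof (unfold_locales)
    fix J \<beta> \<delta>
    assume J: "adm J" and b: "\<beta> \<in> coord_space J" and d: "\<delta> \<in> coord_space J"
    show "0 \<le> quad \<beta> \<delta> \<delta>"
    proof -
      have "0 \<le> c_lower (L2_set \<beta> {1..p}) * real n * (L2_set \<delta> {1..p})\<^sup>2"
        using lo_pos[of "L2_set \<beta> {1..p}"] by (simp add: L2_set_nonneg)
      then show ?thesis using lower[OF J b d] by linarith
    qed
    have "spectral_norm J (\<lambda>j k. neg_hessian \<mu> n p X \<beta> j k - neg_hessian \<mu> n p X \<beta>0 j k) / real n
        \<le> ch * L2_set (\<lambda>j. \<beta> j - \<beta>0 j) {1..p}"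
      using hb[OF J] b beta0_adm[OF J] unfolding hessian_bounds_def by blast
    then have sp: "spectral_norm J (\<lambda>j k. neg_hessian \<mu> n p X \<beta> j k - neg_hessian \<mu> n p X \<beta>0 j k)
        \<le> ch * real n * L2_set (\<lambda>j. \<beta> j - \<beta>0 j) {1..p}" using n0 by (simp add: field_simps)
    have "quad \<beta> \<delta> \<delta> - quad \<beta>0 \<delta> \<delta>
        = (\<Sum>j\<in>J. \<Sum>k\<in>J. \<delta> j * (neg_hessian \<mu> n p X \<beta> j k - neg_hessian \<mu> n p X \<beta>0 j k) * \<delta> k)"
      unfolding quad_def quad_form_neg_hessian[OF admD(1)[OF J] d, symmetric]
      by (simp add: algebra_simps sum_subtractf)
    then have "\<bar>quad \<beta> \<delta> \<delta> - quad \<beta>0 \<delta> \<delta>\<bar>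
        \<le> spectral_norm J (\<lambda>j k. neg_hessian \<mu> n p X \<beta> j k - neg_hessian \<mu> n p X \<beta>0 j k) * (L2_set \<delta> J)\<^sup>2"
      using spectral_norm_quad_form[OF admD(3)[OF J]] by simp
    also have "\<dots> \<le> ch * real n * L2_set (\<lambda>j. \<beta> j - \<beta>0 j) {1..p} * (L2_set \<delta> J)\<^sup>2"
      by (intro mult_right_mono sp) simp
    finally show "\<bar>quad \<beta> \<delta> \<delta> - quad \<beta>0 \<delta> \<delta>\<bar>
        \<le> ch * real n * L2_set (\<lambda>j. \<beta> j - \<beta>0 j) {1..p} * (L2_set \<delta> {1..p})\<^sup>2"
      unfolding nJ[OF J d] .
  next
    fix J \<beta> \<delta>
    assume J: "adm J" and b: "\<beta> \<in> coord_space J" and near: "L2_set (\<lambda>j. \<beta> j - \<beta>0 j) {1..p} \<le> 1"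
      and d: "\<delta> \<in> coord_space J"
    have "cl \<le> c_lower (L2_set \<beta> {1..p})" by (intro lo bound near L2_set_nonneg)
    then have "cl * real n * (L2_set \<delta> {1..p})\<^sup>2 \<le> c_lower (L2_set \<beta> {1..p}) * real n * (L2_set \<delta> {1..p})\<^sup>2"
      by (intro mult_right_mono) auto
    then show "cl * real n * (L2_set \<delta> {1..p})\<^sup>2 \<le> quad \<beta> \<delta> \<delta>" using lower[OF J b d] by linarith
    have "c_upper (L2_set \<beta> {1..p}) \<le> cu" by (intro up bound near L2_set_nonneg)
    then have "c_upper (L2_set \<beta> {1..p}) * real n * (L2_set \<delta> {1..p})\<^sup>2 \<le> cu * real n * (L2_set \<delta> {1..p})\<^sup>2"
      by (intro mult_right_mono) auto
    then show "quad \<beta> \<delta> \<delta> \<le> cu * real n * (L2_set \<delta> {1..p})\<^sup>2" using upper[OF J b d] by linarith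
  qed
qed

subsection \<open>The Gaussian model and the constant \<open>a_MLE\<close>\<close>

definition std_normal :: "real measure" where
  "std_normal = density lborel (\<lambda>x. ennreal (std_normal_density x))"

lemma exp_times_normal_density:
  "exp (y * \<theta>) * normal_density 0 1 y = exp (\<theta>\<^sup>2 / 2) * normal_density \<theta> 1 y"
proof -
  have nd: "normal_density m 1 y = exp (- (y - m)\<^sup>2 / 2) / sqrt (2 * pi)" for m
    by (simp add: normal_density_def)
  have "y * \<theta> + - (y - 0)\<^sup>2 / 2 = \<theta>\<^sup>2 / 2 + - (y - \<theta>)\<^sup>2 / 2"
    by (simp add: power2_eq_square algebra_simps diff_divide_distrib add_divide_distrib)
  then have "exp (y * \<theta>) * exp (- (y - 0)\<^sup>2 / 2) = exp (\<theta>\<^sup>2 / 2) * exp (- (y - \<theta>)\<^sup>2 / 2)"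
    by (simp only: exp_add[symmetric])
  then show ?thesis by (simp only: nd times_divide_eq_right)
qed

lemma std_normal_mgf:
  "integrable std_normal (\<lambda>y. exp (y * \<theta>))" "(\<integral>y. exp (y * \<theta>) \<partial>std_normal) = exp (\<theta>\<^sup>2 / 2)"
proof -
  have e: "std_normal_density y * exp (y * \<theta>) = exp (\<theta>\<^sup>2 / 2) * normal_density \<theta> 1 y" for y
    using exp_times_normal_density[of y \<theta>] by (simp add: mult.commute)
  show "integrable std_normal (\<lambda>y. exp (y * \<theta>))"
    unfolding std_normal_def by (subst integrable_density) (auto simp: e)
  show "(\<integral>y. exp (y * \<theta>) \<partial>std_normal) = exp (\<theta>\<^sup>2 / 2)"
    unfolding std_normal_def by (subst integral_density) (auto simp: e)
qed

lemma std_normal_exp_family: "exp_family std_normal"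
proof -
  interpret prob_space std_normal unfolding std_normal_def by (rule prob_space_normal_density) simp
  have "emeasure std_normal UNIV = 1" using emeasure_space_1 by (simp add: std_normal_def)
  moreover have "sets std_normal = sets borel" by (simp add: std_normal_def)
  ultimately show ?thesis unfolding exp_family_def using std_normal_mgf(1) by simp
qed

lemma std_normal_cumulant: "cumulant std_normal = (\<lambda>\<theta>. \<theta>\<^sup>2 / 2)"
  by (simp add: fun_eq_iff cumulant_def std_normal_mgf(2))

lemma std_normal_cumulant_deriv2: "deriv (deriv (cumulant std_normal)) = (\<lambda>_. 1)"
proof -
  have "deriv (cumulant std_normal) = (\<lambda>\<theta>. \<theta>)"
    unfolding std_normal_cumulant fun_eq_iff
    by (intro allI DERIV_imp_deriv) (auto intro!: derivative_eq_intros)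
  then have "deriv (deriv (cumulant std_normal)) = deriv (\<lambda>\<theta>. \<theta>)" by simp
  also have "\<dots> = (\<lambda>_. 1)" by (simp add: fun_eq_iff)
  finally show ?thesis .
qed

text \<open>Tilting the standard normal law moves its mean to \<theta>, so this family is the
  Gaussian linear model with unit variance.\<close>

lemma std_normal_tilt:
  "density std_normal (\<lambda>y. ennreal (exp_density std_normal \<theta> y)) = density lborel (\<lambda>y. ennreal (normal_density \<theta> 1 y))"
proof -
  have "density std_normal (\<lambda>y. ennreal (exp_density std_normal \<theta> y)) =
    density lborel (\<lambda>y. ennreal (std_normal_density y) * ennreal (exp_density std_normal \<theta> y))"
    unfolding std_normal_def by (subst density_density_eq) (auto simp: exp_density_def)
  also have "\<dots> = density lborel (\<lambda>y. ennreal (normal_density \<theta> 1 y))"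
  proof (intro arg_cong[where f = "density lborel"] ext)
    fix y
    have "std_normal_density y * exp_density std_normal \<theta> y
        = exp (- (\<theta>\<^sup>2 / 2)) * (exp (y * \<theta>) * normal_density 0 1 y)"
    proof -
      have "exp (y * \<theta> - \<theta>\<^sup>2 / 2) = exp (y * \<theta>) * exp (- (\<theta>\<^sup>2 / 2))"
        by (simp only: exp_add[symmetric] diff_conv_add_uminus)
      then show ?thesis by (simp only: exp_density_def std_normal_cumulant mult_ac)
    qed
    also have "\<dots> = normal_density \<theta> 1 y"
      unfolding exp_times_normal_density by (simp only: mult.assoc[symmetric] exp_add[symmetric]) simp
    finally show "ennreal (std_normal_density y) * ennreal (exp_density std_normal \<theta> y) = ennreal (normal_density \<theta> 1 y)"
      by (simp add: ennreal_mult'[symmetric])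
  qed
  finally show ?thesis .
qed

text \<open>A positive constant free of \<theta> is all that is wanted, so the density is bounded
  below on one unit interval by its value at the right end.\<close>

lemma normal_upper_half:
  "ennreal (std_normal_density 1) \<le> emeasure (density lborel (\<lambda>y. ennreal (normal_density \<theta> 1 y))) {\<theta><..}"
proof -
  have "ennreal (std_normal_density 1) = (\<integral>\<^sup>+y. ennreal (std_normal_density 1) * indicator {\<theta><..\<theta> + 1} y \<partial>lborel)"
    by (subst nn_integral_cmult_indicator) auto
  also have "\<dots> \<le> (\<integral>\<^sup>+y. ennreal (normal_density \<theta> 1 y) * indicator {\<theta><..} y \<partial>lborel)"
  proof (intro nn_integral_mono)
    fix y :: real
    show "ennreal (std_normal_density 1) * indicator {\<theta><..\<theta> + 1} y \<le> ennreal (normal_density \<theta> 1 y) * indicator {\<theta><..} y"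
    proof (cases "y \<in> {\<theta><..\<theta> + 1}")
      case True
      then have "(y - \<theta>)\<^sup>2 \<le> 1" by (intro power_le_one) auto
      then have "std_normal_density 1 \<le> normal_density \<theta> 1 y"
        by (simp add: normal_density_def divide_right_mono)
      then show ?thesis using True by (simp add: ennreal_leI)
    qed simp
  qed
  also have "\<dots> = emeasure (density lborel (\<lambda>y. ennreal (normal_density \<theta> 1 y))) {\<theta><..}"
    by (subst emeasure_density) auto
  finally show ?thesis .
qed

text \<open>To be used with as many covariates as observations, so that a growing sample also makes
  \<open>p powr (- \<nu>)\<close> small.\<close>

definition gauss_design :: "real \<Rightarrow> nat \<Rightarrow> nat \<Rightarrow> real" where
  "gauss_design s i j = (if i = j then s else 0)"

lemma gauss_lin_pred: "i \<in> {1..N} \<Longrightarrow> lin_pred N (gauss_design s) \<beta> i = s * \<beta> i"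
  by (simp add: lin_pred_def gauss_design_def if_distrib[of "\<lambda>x. x * _"] cong: if_cong)

text \<open>The Gaussian Hessian does not depend on \<beta>, and the scaling \<open>s\<close> makes
  it \<open>C\<close> times the identity after division by \<open>N\<close>; its change is therefore
  zero.\<close>

lemma gauss_hessian_bounds:
  assumes C: "C \<ge> 0" and N: "N \<ge> 1" and s: "s = sqrt (real N * C)" and J: "J \<subseteq> {1..N}"
    and bounds: "\<And>r. r \<ge> 0 \<Longrightarrow> c_lower r \<le> C" "\<And>r. r \<ge> 0 \<Longrightarrow> C \<le> c_upper r" and ch: "ch \<ge> 0"
  shows "hessian_bounds c_lower c_upper ch std_normal N N (gauss_design s) J"
proof -
  have fin: "finite J" using J by (rule finite_subset) simp
  have H: "neg_hessian std_normal N N (gauss_design s) \<beta> j k / real N = C * id_mat j k"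
    if "j \<in> J" "k \<in> J" for \<beta> j k
  proof -
    have "neg_hessian std_normal N N (gauss_design s) \<beta> j k = (\<Sum>i=1..N. if i = j then s * (if j = k then s else 0) else 0)"
      unfolding neg_hessian_def std_normal_cumulant_deriv2 gauss_design_def by (intro sum.cong) auto
    also have "\<dots> = (if j = k then s\<^sup>2 else 0)" using that J by (auto simp: power2_eq_square)
    finally show ?thesis using C N s by (auto simp: id_mat_def)
  qed
  have psd: "psd_on J A" if "d \<ge> 0" "\<And>j k. j \<in> J \<Longrightarrow> k \<in> J \<Longrightarrow> A j k = d * id_mat j k" for d A
  proof -
    have "(\<Sum>j\<in>J. \<Sum>k\<in>J. v j * A j k * v k) = d * (\<Sum>j\<in>J. (v j)\<^sup>2)" for v
    proof -
      have "(\<Sum>j\<in>J. \<Sum>k\<in>J. v j * A j k * v k) = (\<Sum>j\<in>J. \<Sum>k\<in>J. if k = j then d * (v j)\<^sup>2 else 0)"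
        using that(2) by (intro sum.cong refl) (auto simp: id_mat_def power2_eq_square)
      then show ?thesis using fin by (simp add: sum_distrib_left)
    qed
    then show ?thesis using that by (auto simp: psd_on_def id_mat_def sum_nonneg)
  qed
  show ?thesis
    unfolding hessian_bounds_def
  proof (intro ballI conjI)
    fix \<beta> \<beta>'
    show "loewner_le J (\<lambda>j k. c_lower (L2_set \<beta> {1..N}) * id_mat j k)
        (\<lambda>j k. neg_hessian std_normal N N (gauss_design s) \<beta> j k / real N)"
      unfolding loewner_le_def
      by (rule psd[of "C - c_lower (L2_set \<beta> {1..N})"])
        (simp_all only: H left_diff_distrib diff_ge_0_iff_ge bounds L2_set_nonneg)
    show "loewner_le J (\<lambda>j k. neg_hessian std_normal N N (gauss_design s) \<beta> j k / real N)
        (\<lambda>j k. c_upper (L2_set \<beta> {1..N}) * id_mat j k)"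
      unfolding loewner_le_def
      by (rule psd[of "c_upper (L2_set \<beta> {1..N}) - C"])
        (simp_all only: H left_diff_distrib diff_ge_0_iff_ge bounds L2_set_nonneg)
    have "neg_hessian std_normal N N (gauss_design s) \<beta> = neg_hessian std_normal N N (gauss_design s) \<beta>'"
      by (simp add: neg_hessian_def fun_eq_iff std_normal_cumulant_deriv2)
    moreover have "spectral_norm J (\<lambda>j k. 0) = 0"
    proof -
      have "(\<lambda>v. L2_set (\<lambda>j. \<Sum>k\<in>J. 0 * v k) J) ` {v. L2_set v J \<le> 1} = {0}"
        by (auto simp: L2_set_def intro!: image_eqI[of _ _ "\<lambda>_. 0"])
      then show ?thesis unfolding spectral_norm_def by (simp only: cSup_singleton)
    qed
    ultimately show "spectral_norm J (\<lambda>j k. neg_hessian std_normal N N (gauss_design s) \<beta> j k -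
        neg_hessian std_normal N N (gauss_design s) \<beta>' j k) / real N \<le> ch * L2_set (\<lambda>j. \<beta> j - \<beta>' j) {1..N}"
      using ch by (simp add: L2_set_nonneg)
  qed
qed

text \<open>With only the first covariate the log-likelihood is a parabola in \<open>s * b 1\<close>
  with vertex at \<open>y 1\<close>.\<close>

lemma gauss_mle:
  assumes s: "s > 0" and N: "N \<ge> 1"
    and \<beta>: "mle_set std_normal N N (gauss_design s) y {1} = {\<beta>}"
  shows "s * \<beta> 1 = y 1"
proof -
  have ll: "loglik std_normal N N (gauss_design s) y b = y 1 * (s * b 1) - (s * b 1)\<^sup>2 / 2"
    if "b \<in> coord_space {1}" for b
  proof -
    have "loglik std_normal N N (gauss_design s) y b = (\<Sum>i=1..N. y i * (s * b i) - (s * b i)\<^sup>2 / 2)"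
      unfolding loglik_def std_normal_cumulant by (intro sum.cong refl) (simp add: gauss_lin_pred)
    also have "\<dots> = (\<Sum>i\<in>{1}. y i * (s * b i) - (s * b i)\<^sup>2 / 2)"
      using that N by (intro sum.mono_neutral_right) (auto simp: coord_space_def)
    finally show ?thesis by simp
  qed
  have m: "is_arg_max (\<lambda>b. exp (loglik std_normal N N (gauss_design s) y b)) (\<lambda>b. b \<in> coord_space {1}) \<beta>"
    using \<beta> unfolding mle_set_def by blast
  then have bc: "\<beta> \<in> coord_space {1}" by (simp add: is_arg_max_def)
  define b where "b = (\<lambda>j::nat. if j = 1 then y 1 / s else (0::real))"
  have b: "b \<in> coord_space {1}" by (simp add: b_def coord_space_def)
  have "loglik std_normal N N (gauss_design s) y b \<le> loglik std_normal N N (gauss_design s) y \<beta>"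
    using m b by (auto simp: is_arg_max_def not_less)
  then have "(y 1 - s * \<beta> 1)\<^sup>2 \<le> 0"
    unfolding ll[OF b] ll[OF bc] using s by (simp add: b_def power2_eq_square algebra_simps)
  then show ?thesis by simp
qed

text \<open>
  In the Gaussian linear model with orthogonal design and \<open>\<parallel>\<beta>0\<parallel> = a0\<close> attained on a single
  coordinate, the estimator of that coordinate exceeds \<open>a0\<close> with a probability bounded away
  from \<open>0\<close>, whereas \<open>p powr - \<nu>\<close> tends to \<open>0\<close>.
\<close>

lemma mle_bound_imp_greater:
  assumes mle: "mle_bound a0 c_lower c_upper ch \<nu> c_sample a_MLE"
    and pos: "\<nu> > 0" "c_sample > 0" "a0 > 0" "ch \<ge> 0" "C > 0"
    and bounds: "\<And>r. r \<ge> 0 \<Longrightarrow> c_lower r \<le> C" "\<And>r. r \<ge> 0 \<Longrightarrow> C \<le> c_upper r"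
  shows "a0 < a_MLE"
proof -
  define c where "c = std_normal_density 1"
  have c: "c > 0" by (simp add: c_def normal_density_pos)
  \<comment> \<open>\<open>N\<close> is taken so large that the exceptional probability falls below
    \<open>c\<close> and the sample size condition holds for \<open>q = 1\<close>.\<close>
  have "eventually (\<lambda>N. real N powr - \<nu> < c) at_top" using c pos(1) by real_asymp
  moreover have "eventually (\<lambda>N. c_sample * ln (real N) \<le> real N) at_top" using pos(2) by real_asymp
  moreover have "eventually (\<lambda>N. c_sample * ln (real N) ^ 3 \<le> real N) at_top" using pos(2) by real_asymp
  ultimately have "eventually (\<lambda>N. real N powr - \<nu> < c \<and> c_sample * ln (real N) \<le> real N \<and>
      c_sample * ln (real N) ^ 3 \<le> real N \<and> N \<ge> 2) at_top"
    using eventually_ge_at_top[of 2] by eventually_elim simp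
  then obtain N where N: "real N powr - \<nu> < c" "c_sample * ln (real N) \<le> real N"
      "c_sample * ln (real N) ^ 3 \<le> real N" "N \<ge> 2"
    unfolding eventually_at_top_linorder by blast
  define s where "s = sqrt (real N * C)"
  have s: "s > 0" using N(4) pos(5) by (simp add: s_def)
  define \<beta> where "\<beta> = (\<lambda>j::nat. if j = 1 then a0 else 0)"
  define D where "D = (\<lambda>i::nat. density lborel (\<lambda>y. ennreal (normal_density (s * \<beta> i) 1 y)))"
  have D_prob: "prob_space (D i)" for i unfolding D_def by (rule prob_space_normal_density) simp
  have D_sets[simp, measurable_cong]: "sets (D i) = sets borel" for i by (simp add: D_def)
  define \<Omega> where "\<Omega> = Pi\<^sub>M {1..N} D"
  interpret O: prob_space \<Omega> unfolding \<Omega>_def by (rule prob_space_PiM) (rule D_prob)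
  define Y where "Y = (\<lambda>i (\<omega>::nat \<Rightarrow> real). \<omega> i)"
  have distr: "distr \<Omega> (D i) (Y i) = D i" if "i \<in> {1..N}" for i
    unfolding \<Omega>_def Y_def by (rule distr_PiM_component[OF D_prob that])
  have Ym: "Y i \<in> measurable \<Omega> borel" if "i \<in> {1..N}" for i
  proof -
    have "Y i \<in> measurable \<Omega> (D i)"
      unfolding \<Omega>_def Y_def using that by (rule measurable_component_singleton)
    also have "measurable \<Omega> (D i) = measurable \<Omega> borel" by (rule measurable_cong_sets) auto
    finally show ?thesis .
  qed
  have glm: "glm_problem \<Omega> Y std_normal N N 1 (gauss_design s) \<beta>"
    unfolding glm_problem_def
  proof (intro conjI ballI)
    have "supp \<beta> \<subseteq> {1}" by (auto simp: supp_def \<beta>_def)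
    then show "card (supp \<beta>) \<le> 1" using card_mono[of "{1}" "supp \<beta>"] by simp
    show "\<beta> \<in> coord_space {1..N}" using N(4) by (auto simp: coord_space_def \<beta>_def)
    show "O.indep_vars (\<lambda>_. borel) Y {1..N}"
    proof (subst O.indep_vars_iff_distr_eq_PiM')
      show "{1..N} \<noteq> {}" using N(4) by simp
      show "O.random_variable borel (Y i)" if "i \<in> {1..N}" for i by (rule Ym[OF that])
      have 1: "Pi\<^sub>M {1..N} (\<lambda>i. distr \<Omega> borel (Y i)) = \<Omega>"
        unfolding \<Omega>_def
      proof (intro PiM_cong refl)
        fix i assume i: "i \<in> {1..N}"
        have "distr \<Omega> borel (Y i) = distr \<Omega> (D i) (Y i)" by (intro distr_cong) auto
        then show "distr (Pi\<^sub>M {1..N} D) borel (Y i) = D i" using distr[OF i] by (simp add: \<Omega>_def)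
      qed
      have 2: "distr \<Omega> (Pi\<^sub>M {1..N} (\<lambda>_. borel)) (\<lambda>x. \<lambda>i\<in>{1..N}. Y i x) = distr \<Omega> \<Omega> (\<lambda>x. x)"
      proof (intro distr_cong refl)
        show "sets (Pi\<^sub>M {1..N} (\<lambda>_. borel)) = sets \<Omega>" unfolding \<Omega>_def by (intro sets_PiM_cong) auto
        show "(\<lambda>i\<in>{1..N}. Y i x) = x" if "x \<in> space \<Omega>" for x
          using that by (auto simp: \<Omega>_def space_PiM Y_def PiE_def extensional_def)
      qed
      show "distr \<Omega> (Pi\<^sub>M {1..N} (\<lambda>_. borel)) (\<lambda>x. \<lambda>i\<in>{1..N}. Y i x) = Pi\<^sub>M {1..N} (\<lambda>i. distr \<Omega> borel (Y i))"
        unfolding 1 2 by (rule distr_id)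
    qed
    fix i assume i: "i \<in> {1..N}"
    have "distr \<Omega> std_normal (Y i) = distr \<Omega> (D i) (Y i)" by (intro distr_cong) (auto simp: std_normal_def)
    also have "\<dots> = D i" by (rule distr[OF i])
    also have "\<dots> = density std_normal (\<lambda>y. ennreal (exp_density std_normal (lin_pred N (gauss_design s) \<beta> i) y))"
      unfolding std_normal_tilt gauss_lin_pred[OF i] D_def ..
    finally show "distributed \<Omega> std_normal (Y i) (\<lambda>y. ennreal (exp_density std_normal (lin_pred N (gauss_design s) \<beta> i) y))"
      using Ym[OF i] unfolding distributed_def
      by (auto simp: exp_density_def std_normal_def cong: measurable_cong_sets)
  qed (use std_normal_exp_family O.prob_space_axioms in auto)
  have nrm: "L2_set \<beta> {1..N} \<le> a0"
  proof -
    have "L2_set \<beta> {1..N} \<le> (\<Sum>j=1..N. \<bar>\<beta> j\<bar>)" by (rule L2_set_le_sum_abs)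
    also have "\<dots> = a0" using N(4) pos(3) by (simp add: \<beta>_def if_distrib[of abs] cong: if_cong)
    finally show ?thesis .
  qed
  define E where "E = {\<omega> \<in> space \<Omega>. \<forall>J. J \<subseteq> {1..N} \<and> card J \<le> 1 \<longrightarrow>
     (\<exists>b. mle_set std_normal N N (gauss_design s) (\<lambda>i. Y i \<omega>) J = {b} \<and> L2_set b {1..N} \<le> a_MLE)}"
  have PE: "1 - real N powr - \<nu> \<le> measure \<Omega> E"
    unfolding E_def
  proof (rule mle[unfolded mle_bound_def, rule_format, OF _ _ glm nrm])
    show "hessian_bounds c_lower c_upper ch std_normal N N (gauss_design s) J"
      if "J \<subseteq> {1..N} \<and> card J \<le> 2 * 1" for J
      using that pos N(4) bounds by (intro gauss_hessian_bounds[of C]) (auto simp: s_def)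
    show "c_sample * real 1 ^ 3 * max (ln (real N)) (ln (real N) ^ 3) \<le> real N"
      using N(2,3) by (simp add: max_def)
  qed (use N(4) in auto)
  define F where "F = Y 1 -` {s * a0<..} \<inter> space \<Omega>"
  have one: "1 \<in> {1..N}" using N(4) by simp
  have F: "F \<in> O.events" unfolding F_def using Ym[OF one] by (rule measurable_sets) simp
  have "ennreal c \<le> emeasure (D 1) {s * a0<..}"
    unfolding c_def D_def using normal_upper_half[of "s * a0"] by (simp add: \<beta>_def)
  also have "\<dots> = emeasure (distr \<Omega> (D 1) (Y 1)) {s * a0<..}" unfolding distr[OF one] ..
  also have "\<dots> = emeasure \<Omega> F"
    unfolding F_def using Ym[OF one] by (intro emeasure_distr) (auto cong: measurable_cong_sets)
  finally have PF: "c \<le> measure \<Omega> F" by (simp add: O.emeasure_eq_measure)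
  have "real N powr - \<nu> < 1" using N(4) pos(1) by (simp add: powr_less_one)
  then have "measure \<Omega> E > 0" using PE by linarith
  \<comment> \<open>The measure of a nonmeasurable set is 0 by convention, so positive measure
    yields measurability.\<close>
  then have E: "E \<in> O.events" using measure_notin_sets by fastforce
  \<comment> \<open>The two probabilities add up to more than 1, so some outcome has both a bounded
    estimator and a large first response.\<close>
  have "E \<inter> F \<noteq> {}"
  proof
    assume "E \<inter> F = {}"
    then have "measure \<Omega> E + measure \<Omega> F = measure \<Omega> (E \<union> F)"
      using E F by (intro O.finite_measure_Union[symmetric]) auto
    also have "\<dots> \<le> 1" by (rule O.prob_le_1)
    finally show False using PE PF N(1) by linarith
  qed
  then obtain \<omega> where \<omega>: "\<omega> \<in> E" "\<omega> \<in> F" by auto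
  have all: "\<forall>J. J \<subseteq> {1..N} \<and> card J \<le> 1 \<longrightarrow>
     (\<exists>b. mle_set std_normal N N (gauss_design s) (\<lambda>i. Y i \<omega>) J = {b} \<and> L2_set b {1..N} \<le> a_MLE)"
    using \<omega>(1) unfolding E_def mem_Collect_eq by (rule conjunct2)
  have "{1} \<subseteq> {1..N} \<and> card {1::nat} \<le> 1" using one by simp
  from all[THEN spec, THEN mp, OF this] obtain b where b: "mle_set std_normal N N (gauss_design s) (\<lambda>i. Y i \<omega>) {1} = {b}"
      "L2_set b {1..N} \<le> a_MLE"
    by (elim exE conjE)
  have "s * b 1 = Y 1 \<omega>" by (rule gauss_mle[OF s _ b(1)]) (use N(4) in simp)
  moreover have "s * a0 < Y 1 \<omega>" using \<omega>(2) unfolding F_def by simp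
  ultimately have "s * a0 < s * b 1" by simp
  then have "a0 < b 1" using s by simp
  also have "b 1 \<le> \<bar>b 1\<bar>" by simp
  also have "\<dots> \<le> L2_set (\<lambda>j. \<bar>b j\<bar>) {1..N}" by (intro member_le_L2_set) (use one in auto)
  also have "\<dots> \<le> a_MLE" using b(2) by (simp add: L2_set_def)
  finally show ?thesis .
qed

subsection \<open>Choice of the radii and thresholds\<close>

text \<open>Spells out how large \<open>n\<close> must be. \<open>P1\<close> caps the radius,
  \<open>P2\<close> makes the cubic errors at most 1, \<open>P3\<close> puts the radius below the
  signal strength, \<open>P4\<close> separates \<open>p\<close> from \<open>q\<close>,
  \<open>P5\<close> absorbs constants, \<open>P6\<close> and \<open>P7\<close> make the net gain of
  extra covariates small, and \<open>P8\<close> admits the Chernoff parameter.\<close>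

locale tuning =
  fixes n p q :: nat and \<kappa> \<psi> \<phi> \<gamma> A K \<Lambda> cl cu ch F3 F4 m \<epsilon> :: real
  assumes n3: "n \<ge> 3" and q1: "q \<ge> 1" and q_le: "real q \<le> 2 * real n powr \<psi>"
    and p_le: "real p \<le> 2 * real n powr \<kappa>" and p_ge: "real n powr \<kappa> \<le> 2 * real p"
    and cpos: "A > 0" "K \<ge> 1" "\<Lambda> \<ge> 1" "cl > 0" "cu > 0" "ch \<ge> 0" "F3 > 0" "F4 > 0" "m > 0"
    and exps: "\<psi> \<ge> 0" "\<psi> < \<kappa>" "\<gamma> \<ge> 0" "\<epsilon> > 0" "\<phi> \<ge> 0" "\<psi> \<le> 1 / 3"
    and eps: "2 * \<epsilon> = \<gamma> * (\<kappa> - \<psi>) - \<kappa> + 1 / 2"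
    and KA: "8 * A \<le> cl * K" and KG: "3 + (\<kappa> + 1) * \<gamma> \<le> cl * K\<^sup>2 / 4"
    and m: "m * (1 + \<Lambda>) \<le> 1" "cl * m \<le> 2"
    and P1: "2 * K\<^sup>2 * ln (real n) \<le> m\<^sup>2 * real n powr (1 - \<psi>)"
    and P2: "(ch * (1 + (1 + \<Lambda>) ^ 3) / 2)\<^sup>2 * (8 * K ^ 6) * ln (real n) ^ 3 \<le> real n powr (1 - 3 * \<psi>)"
    and P3: "2 * K\<^sup>2 * ln (real n) \<le> real n powr (1 - \<phi> - \<psi>)"
    and P4: "8 \<le> real n powr (\<kappa> - \<psi>)"
    and P5: "cu \<le> real n" "8 \<le> real n" "2 * exp 1 < F4 * real n"
    and P6: "8 powr \<gamma> * real n powr (- \<epsilon>) \<le> min 1 (F4 / (2 * exp 1 * F3)) / 2"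
    and P7: "8 powr \<gamma> * sqrt (4 * pi / (cl * real n)) \<le> min 1 (F4 / (2 * exp 1 * F3)) / 2"
    and P8: "ln (real n) * \<Lambda>\<^sup>2 \<le> real n"
begin

text \<open>\<open>B\<close> is the score threshold. \<open>R\<close> is the Taylor radius, just
  large enough for the quadratic term to beat a score of size \<open>B\<close> outside. The cube
  half-width \<eta> only has to be polynomially small. \<open>s\<close> is the Markov threshold per
  extra coordinate, with margin \<epsilon> in the exponent, and \<tau> is the Chernoff
  parameter.\<close>

definition "B = A * sqrt (real n * ln (real n))"
definition "R = K * sqrt (real q * ln (real n) / real n)"
definition "\<eta> = 1 / (real n)\<^sup>2"
definition "s = real n powr (\<kappa> - 1 / 2 + \<epsilon>)"
definition "g = (real q / (real p - real q)) powr \<gamma>"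
definition "\<sigma> = sqrt (4 * pi / (cl * real n))"
definition "\<tau> = sqrt (ln (real n) / real n)"

lemma n_pos: "real n > 0" using n3 by simp

lemma ln_ge_1: "ln (real n) \<ge> 1"
proof -
  have "exp 1 \<le> real n" using exp_le n3 by (meson of_nat_mono of_nat_numeral order_trans numeral_le_real_of_nat_iff)
  then show ?thesis using n_pos by (simp add: ln_ge_iff)
qed

lemma ln_pos: "ln (real n) > 0" using ln_ge_1 by linarith

lemma B_pos: "B > 0"
  using cpos n_pos ln_pos by (simp add: B_def)

lemma R_pos: "R > 0"
  using cpos n_pos ln_pos q1 by (simp add: R_def)

lemma R_square: "R\<^sup>2 = K\<^sup>2 * (real q * ln (real n) / real n)"
  using n_pos ln_ge_1 by (simp add: R_def power_mult_distrib)

lemma R_square_le: "R\<^sup>2 \<le> 2 * K\<^sup>2 * ln (real n) * real n powr \<psi> / real n"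
proof -
  have "K\<^sup>2 * (real q * ln (real n) / real n) \<le> K\<^sup>2 * ((2 * real n powr \<psi>) * ln (real n) / real n)"
    using q_le ln_ge_1 n_pos by (intro mult_left_mono divide_right_mono mult_right_mono) auto
  then show ?thesis unfolding R_square by (simp add: mult_ac)
qed

lemma R_le_m: "R \<le> m"
proof -
  have "2 * K\<^sup>2 * ln (real n) * real n powr \<psi> \<le> m\<^sup>2 * real n powr (1 - \<psi>) * real n powr \<psi>"
    by (intro mult_right_mono P1) simp
  also have "\<dots> = m\<^sup>2 * real n" using n_pos by (simp add: powr_add[symmetric] mult.assoc)
  finally have "2 * K\<^sup>2 * ln (real n) * real n powr \<psi> / real n \<le> m\<^sup>2"
    using n_pos by (simp add: pos_divide_le_eq)
  then have "R\<^sup>2 \<le> m\<^sup>2" using R_square_le by linarith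
  then show ?thesis by (rule power2_le_imp_le) (use cpos in simp)
qed

lemma R_le_1: "R \<le> 1" "(1 + \<Lambda>) * R \<le> 1" "(1 + \<Lambda>) * R \<le> m * (1 + \<Lambda>)"
proof -
  show "(1 + \<Lambda>) * R \<le> m * (1 + \<Lambda>)" using R_le_m cpos by (simp add: mult.commute)
  then show "(1 + \<Lambda>) * R \<le> 1" using m by linarith
  moreover have "R \<le> (1 + \<Lambda>) * R" using R_pos cpos by (simp add: algebra_simps)
  ultimately show "R \<le> 1" by linarith
qed

text \<open>Compared after squaring, so that only integer powers of \<open>R\<^sup>2\<close> occur;
  the square of \<open>n * R ^ 3\<close> is of order \<open>q ^ 3 * ln n ^ 3 / n\<close>, whence the
  exponent \<open>1 - 3 * \<psi>\<close> in \<open>P2\<close>.\<close>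

lemma cubic_error: "ch * real n * (R ^ 3 + ((1 + \<Lambda>) * R) ^ 3) / 2 \<le> 1"
  "ch * real n * (\<Lambda> * R) ^ 3 / 2 \<le> 1"
proof -
  define D where "D = ch * (1 + (1 + \<Lambda>) ^ 3) / 2"
  let ?l = "ln (real n)" and ?u = "real n powr \<psi>"
  have D: "D \<ge> 0" using cpos by (simp add: D_def)
  have u3: "?u ^ 3 = real n powr (3 * \<psi>)" using n_pos by (simp add: powr_power mult.commute)
  have "(D * real n * R ^ 3)\<^sup>2 = D\<^sup>2 * (real n)\<^sup>2 * (R\<^sup>2) ^ 3"
    by (simp add: power_mult_distrib flip: power_mult)
  also have "\<dots> \<le> D\<^sup>2 * (real n)\<^sup>2 * (2 * K\<^sup>2 * ?l * ?u / real n) ^ 3"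
    by (intro mult_left_mono power_mono R_square_le) auto
  also have "\<dots> = (D\<^sup>2 * (8 * K ^ 6) * ?l ^ 3) * ?u ^ 3 / real n"
    using n_pos by (simp add: power_mult_distrib power_divide flip: power_mult) (simp add: field_simps power2_eq_square power3_eq_cube)
  also have "\<dots> \<le> real n powr (1 - 3 * \<psi>) * ?u ^ 3 / real n"
    using P2 n_pos by (intro divide_right_mono mult_right_mono) (auto simp: D_def)
  also have "\<dots> = 1" unfolding u3 using n_pos by (simp add: powr_add[symmetric])
  finally have "(D * real n * R ^ 3)\<^sup>2 \<le> 1\<^sup>2" by simp
  then have 1: "D * real n * R ^ 3 \<le> 1" by (rule power2_le_imp_le) simp
  then show "ch * real n * (R ^ 3 + ((1 + \<Lambda>) * R) ^ 3) / 2 \<le> 1"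
  proof -
    have "ch * real n * (x + c * x) / 2 = ch * (1 + c) / 2 * real n * x" for x c
      by (simp add: algebra_simps)
    then show ?thesis using 1 by (simp only: D_def power_mult_distrib)
  qed
  have "(\<Lambda> * R) ^ 3 \<le> R ^ 3 + ((1 + \<Lambda>) * R) ^ 3"
  proof -
    have "(\<Lambda> * R) ^ 3 \<le> ((1 + \<Lambda>) * R) ^ 3" using cpos R_pos by (intro power_mono mult_right_mono) auto
    then show ?thesis using R_pos by (simp add: add_increasing)
  qed
  then have "ch * real n * (\<Lambda> * R) ^ 3 / 2 \<le> ch * real n * (R ^ 3 + ((1 + \<Lambda>) * R) ^ 3) / 2"
    using cpos by (intro divide_right_mono mult_left_mono) auto
  then show "ch * real n * (\<Lambda> * R) ^ 3 / 2 \<le> 1"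
    using \<open>ch * real n * (R ^ 3 + ((1 + \<Lambda>) * R) ^ 3) / 2 \<le> 1\<close> by linarith
qed

text \<open>Both sides are multiples of \<open>sqrt (q * n * ln n)\<close>, and \<open>KA\<close>
  compares the constants.\<close>

lemma B_dominated: "B * sqrt (2 * real q) \<le> cl * real n * R / 4"
proof -
  let ?l = "ln (real n)"
  have nR: "real n * R = K * sqrt (real q * ?l * real n)"
  proof -
    have "real n * sqrt (real q * ?l / real n) = sqrt ((real n)\<^sup>2 * (real q * ?l / real n))"
      using n_pos by (subst real_sqrt_mult) simp
    also have "(real n)\<^sup>2 * (real q * ?l / real n) = real q * ?l * real n"
      using n_pos by (simp add: power2_eq_square)
    finally show ?thesis by (simp add: R_def mult_ac)
  qed
  have "B * sqrt (2 * real q) = sqrt 2 * A * sqrt (real q * ?l * real n)"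
    by (simp add: B_def real_sqrt_mult mult_ac)
  also have "\<dots> \<le> 2 * A * sqrt (real q * ?l * real n)"
  proof -
    have "sqrt 2 \<le> 2" by (simp add: real_le_lsqrt)
    then show ?thesis using cpos ln_ge_1 by (intro mult_right_mono) auto
  qed
  also have "\<dots> \<le> cl * K / 4 * sqrt (real q * ?l * real n)"
    using KA ln_ge_1 by (intro mult_right_mono) auto
  also have "\<dots> = cl * real n * R / 4" using nR by (simp add: mult.assoc)
  finally show ?thesis .
qed

lemma R_le_signal: "R \<le> real n powr (- \<phi> / 2)"
proof -
  have "2 * K\<^sup>2 * ln (real n) * real n powr \<psi> \<le> real n powr (1 - \<phi> - \<psi>) * real n powr \<psi>"
    by (intro mult_right_mono P3) simp
  also have "\<dots> = real n powr (1 - \<phi>)" using n_pos by (simp add: powr_add[symmetric])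
  also have "\<dots> = real n powr (- \<phi>) * real n" using n_pos powr_add[of "real n" "- \<phi>" 1] by (simp add: add.commute)
  finally have "2 * K\<^sup>2 * ln (real n) * real n powr \<psi> / real n \<le> real n powr (- \<phi>)"
    using n_pos by (simp add: pos_divide_le_eq)
  then have "R\<^sup>2 \<le> real n powr (- \<phi>)" using R_square_le by linarith
  also have "\<dots> = (real n powr (- \<phi> / 2))\<^sup>2" using n_pos by (simp add: powr_power)
  finally show ?thesis by (rule power2_le_imp_le) simp
qed

lemma signal_le_1: "real n powr (- \<phi> / 2) \<le> 1"
  using n3 exps powr_mono[of "- \<phi> / 2" 0 "real n"] by simp

lemma q_le_n: "real q \<le> real n"
proof -
  have "real n powr \<psi> \<le> real n powr (1 / 3)" using exps n3 by (intro powr_mono) auto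
  moreover have "2 * real n powr (1 / 3) \<le> real n powr (2 / 3) * real n powr (1 / 3)"
  proof (intro mult_right_mono)
    have eight: "(8::real) = 2 powr 3" by simp
    have "(8::real) powr (1 / 3) = 2" unfolding eight powr_powr by simp
    then have "2 \<le> real n powr (1 / 3)" using powr_mono2[of "1 / 3" 8 "real n"] P5 by simp
    also have "\<dots> \<le> real n powr (2 / 3)" using n3 by (intro powr_mono) auto
    finally show "2 \<le> real n powr (2 / 3)" .
  qed simp
  moreover have "real n powr (2 / 3) * real n powr (1 / 3) = real n" using n_pos by (simp add: powr_add[symmetric])
  ultimately show ?thesis using q_le by linarith
qed

lemma q_eta: "real q * \<eta> \<le> 1 / real n"
proof -
  have "real q * \<eta> = real q / real n / real n" by (simp add: \<eta>_def power2_eq_square)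
  also have "\<dots> \<le> 1 / real n" using q_le_n n_pos by (intro divide_right_mono) auto
  finally show ?thesis .
qed

lemma eta_bounds: "\<eta> > 0" "2 * \<eta> \<le> 1" "real q * \<eta> \<le> R"
  "B * sqrt (2 * real q) * (real q * \<eta>) + cu * real n * (real q * \<eta>)\<^sup>2 / 2 \<le> 1"
proof -
  show "\<eta> > 0" using n_pos by (simp add: \<eta>_def)
  have "(3::real)\<^sup>2 \<le> (real n)\<^sup>2" using n3 by (intro power_mono) auto
  then show "2 * \<eta> \<le> 1" using n_pos by (simp add: \<eta>_def)
  have "1 / real n \<le> sqrt (1 / real n)"
    using n3 by (intro real_le_rsqrt) (auto simp: power2_eq_square field_simps)
  also have "\<dots> \<le> sqrt (real q * ln (real n) / real n)"
    using mult_mono[of 1 "real q" 1 "ln (real n)"] q1 ln_ge_1 n_pos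
    by (intro real_sqrt_le_mono divide_right_mono) auto
  also have "\<dots> \<le> K * sqrt (real q * ln (real n) / real n)"
    using cpos ln_ge_1 mult_right_mono[of 1 K "sqrt (real q * ln (real n) / real n)"] by simp
  finally show "real q * \<eta> \<le> R" using q_eta unfolding R_def by linarith
  have qe: "0 \<le> real q * \<eta>" using \<open>\<eta> > 0\<close> by simp
  have "B * sqrt (2 * real q) * (real q * \<eta>) \<le> (cl * real n * R / 4) * (1 / real n)"
    using B_dominated q_eta qe cpos R_pos by (intro mult_mono) auto
  also have "\<dots> = cl * R / 4" using n_pos by simp
  also have "\<dots> \<le> 1 / 2"
  proof -
    have "cl * R \<le> cl * m" using R_le_m cpos by (intro mult_left_mono) auto
    then show ?thesis using m(2) by linarith
  qed
  finally have 1: "B * sqrt (2 * real q) * (real q * \<eta>) \<le> 1 / 2" .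
  have "cu * real n * (real q * \<eta>)\<^sup>2 / 2 \<le> cu * real n * (1 / real n)\<^sup>2 / 2"
    using q_eta qe cpos by (intro divide_right_mono mult_left_mono power_mono) auto
  also have "\<dots> = cu / real n / 2" using n_pos by (simp add: power2_eq_square)
  also have "\<dots> \<le> 1 / 2" using P5(1) n_pos by simp
  finally show "B * sqrt (2 * real q) * (real q * \<eta>) + cu * real n * (real q * \<eta>)\<^sup>2 / 2 \<le> 1"
    using 1 by linarith
qed

lemma p2q: "2 * q \<le> p" "8 * real n powr \<psi> \<le> real n powr \<kappa>"
proof -
  have "8 * real n powr \<psi> \<le> real n powr (\<kappa> - \<psi>) * real n powr \<psi>"
    by (intro mult_right_mono P4) simp
  also have "\<dots> = real n powr \<kappa>" using n_pos by (simp add: powr_add[symmetric])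
  finally show *: "8 * real n powr \<psi> \<le> real n powr \<kappa>" .
  then have "2 * real q \<le> real p" using q_le p_ge by linarith
  then show "2 * q \<le> p" by linarith
qed

text \<open>Up to constants the right-hand side is at least \<open>exp (- (G * q * ln n))\<close>,
  where the cube contributes 2 to \<open>G\<close> and the binomial bound
  \<open>(\<kappa> + 1) * \<gamma>\<close>. The exponent on the left is
  \<open>cl * K\<^sup>2 / 4\<close> times \<open>q * ln n\<close>, and \<open>KG\<close> leaves a
  spare factor \<open>1 / n\<close> to absorb the constants.\<close>

lemma far: "exp (- (cl * real n * R\<^sup>2 / 4)) < F4 * exp (- 1) * (2 * \<eta>) ^ q * (real p ^ q) powr (- \<gamma>) / 2"
proof -
  let ?l = "ln (real n)"
  define G where "G = 2 + (\<kappa> + 1) * \<gamma>"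
  have p_pos: "real p > 0" using p2q q1 by simp
  have pn: "real p \<le> real n powr (\<kappa> + 1)"
  proof -
    have "2 * real n powr \<kappa> \<le> real n * real n powr \<kappa>" using n3 by (intro mult_right_mono) auto
    moreover have "real n powr (\<kappa> + 1) = real n * real n powr \<kappa>"
      using n_pos by (simp add: powr_add mult.commute)
    ultimately show ?thesis using p_le by linarith
  qed
  have e1: "exp (- 2 * ?l) ^ q \<le> (2 * \<eta>) ^ q"
  proof (rule power_mono)
    have "exp (- 2 * ?l) = \<eta>"
      using n_pos by (simp add: \<eta>_def exp_minus exp_double divide_inverse power_inverse)
    then show "exp (- 2 * ?l) \<le> 2 * \<eta>" using eta_bounds(1) by simp
  qed simp
  have e2: "exp (- ((\<kappa> + 1) * \<gamma> * ?l)) ^ q \<le> (real p ^ q) powr (- \<gamma>)"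
  proof -
    have "exp (- ((\<kappa> + 1) * \<gamma> * ?l)) = (real n powr (\<kappa> + 1)) powr (- \<gamma>)"
      using n_pos by (simp add: powr_powr powr_def mult_ac)
    also have "\<dots> \<le> real p powr (- \<gamma>)" using pn p_pos exps by (intro powr_mono2') auto
    finally have "exp (- ((\<kappa> + 1) * \<gamma> * ?l)) ^ q \<le> (real p powr (- \<gamma>)) ^ q" by (rule power_mono) simp
    also have "\<dots> = (real p ^ q) powr (- \<gamma>)" using p_pos by (simp add: powr_power powr_powr powr_realpow[symmetric] mult.commute)
    finally show ?thesis .
  qed
  have e3: "exp (- (G * real q * ?l)) \<le> (2 * \<eta>) ^ q * (real p ^ q) powr (- \<gamma>)"
  proof -
    have "exp (- (G * real q * ?l)) = exp (- 2 * ?l) ^ q * exp (- ((\<kappa> + 1) * \<gamma> * ?l)) ^ q"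
      by (simp add: exp_of_nat_mult[symmetric] exp_add[symmetric] G_def algebra_simps)
    also have "\<dots> \<le> (2 * \<eta>) ^ q * (real p ^ q) powr (- \<gamma>)"
      using eta_bounds(1) by (intro mult_mono e1 e2) auto
    finally show ?thesis .
  qed
  have nR: "cl * real n * R\<^sup>2 / 4 = cl * K\<^sup>2 / 4 * (real q * ?l)"
    unfolding R_square using n_pos by simp
  have "(G + 1) * (real q * ?l) \<le> cl * real n * R\<^sup>2 / 4"
    unfolding nR using KG ln_ge_1 by (intro mult_right_mono) (auto simp: G_def)
  moreover have "1 * ?l \<le> real q * ?l" using q1 ln_ge_1 by (intro mult_right_mono) auto
  ultimately have "- (cl * real n * R\<^sup>2 / 4) \<le> - (G * real q * ?l) + - ?l" by (simp add: algebra_simps)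
  then have "exp (- (cl * real n * R\<^sup>2 / 4)) \<le> exp (- (G * real q * ?l)) * exp (- ?l)"
    by (simp add: exp_add[symmetric])
  also have "exp (- ?l) = 1 / real n" using n_pos by (simp add: exp_minus divide_inverse)
  also have "exp (- (G * real q * ?l)) * (1 / real n) < exp (- (G * real q * ?l)) * (F4 * exp (- 1) / 2)"
    using P5(3) n_pos by (intro mult_strict_left_mono) (auto simp: exp_minus field_simps)
  also have "\<dots> \<le> ((2 * \<eta>) ^ q * (real p ^ q) powr (- \<gamma>)) * (F4 * exp (- 1) / 2)"
    using cpos by (intro mult_right_mono e3) auto
  finally show ?thesis by (simp add: mult_ac)
qed

text \<open>Reduces to \<open>far\<close>, because the signal strength is at least
  \<open>R\<close>.\<close>

lemma under: "exp (- (cl * real n * (real n powr (- \<phi> / 2))\<^sup>2 / 4))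
    < F4 * exp (- 1) * (2 * \<eta>) ^ q * (real p ^ q) powr (- \<gamma>)"
proof -
  let ?r = "F4 * exp (- 1) * (2 * \<eta>) ^ q * (real p ^ q) powr (- \<gamma>)"
  have "cl * real n * R\<^sup>2 / 4 \<le> cl * real n * (real n powr (- \<phi> / 2))\<^sup>2 / 4"
    using R_le_signal R_pos cpos by (intro divide_right_mono mult_left_mono power_mono) auto
  then have "exp (- (cl * real n * (real n powr (- \<phi> / 2))\<^sup>2 / 4)) \<le> exp (- (cl * real n * R\<^sup>2 / 4))" by simp
  also note far
  also have "?r / 2 \<le> ?r" using cpos eta_bounds(1) by simp
  finally show ?thesis .
qed

lemma s_pos: "s > 0" using n_pos by (simp add: s_def)

text \<open>The prior factor \<open>g\<close> is at most a constant times
  \<open>n powr (- \<gamma> * (\<kappa> - \<psi>))\<close>; against \<open>s\<close> this leaves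
  \<open>n powr (- \<epsilon>)\<close>. Against \<sigma>, the Gaussian contribution of order
  \<open>1 / sqrt n\<close>, boundedness of \<open>g\<close> is enough.\<close>

lemma gains: "g * s \<le> 1" "g * \<sigma> \<le> 1" "F3 * exp 1 * (g * s + g * \<sigma>) \<le> F4 / 2"
proof -
  define \<theta> where "\<theta> = min 1 (F4 / (2 * exp 1 * F3))"
  note P6' = P6[folded \<theta>_def] and P7' = P7[folded \<theta>_def]
  have pq: "real p - real q \<ge> real n powr \<kappa> / 4" "real p - real q > 0"
    using p2q p_ge q1 by linarith+
  have ratio: "real q / (real p - real q) \<le> 8 * real n powr (\<psi> - \<kappa>)"
  proof -
    have "real q / (real p - real q) \<le> (2 * real n powr \<psi>) / (real n powr \<kappa> / 4)"
      using q_le pq n_pos by (intro frac_le) auto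
    then show ?thesis using n_pos by (simp add: powr_diff)
  qed
  have g_le: "g \<le> 8 powr \<gamma> * real n powr (- \<gamma> * (\<kappa> - \<psi>))"
  proof -
    have "g \<le> (8 * real n powr (\<psi> - \<kappa>)) powr \<gamma>"
      unfolding g_def using ratio pq exps by (intro powr_mono2) auto
    also have "\<dots> = 8 powr \<gamma> * real n powr (- \<gamma> * (\<kappa> - \<psi>))"
      using n_pos by (simp add: powr_mult powr_powr algebra_simps)
    finally show ?thesis .
  qed
  have gs: "g * s \<le> \<theta> / 2"
  proof -
    have "g * s \<le> 8 powr \<gamma> * real n powr (- \<gamma> * (\<kappa> - \<psi>)) * s"
      using s_pos by (intro mult_right_mono g_le) auto
    also have "\<dots> = 8 powr \<gamma> * real n powr (- \<gamma> * (\<kappa> - \<psi>) + (\<kappa> - 1 / 2 + \<epsilon>))"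
      by (simp only: s_def mult.assoc powr_add[symmetric])
    also have "- \<gamma> * (\<kappa> - \<psi>) + (\<kappa> - 1 / 2 + \<epsilon>) = - \<epsilon>" using eps by simp
    finally show ?thesis using P6' by linarith
  qed
  have g\<sigma>: "g * \<sigma> \<le> \<theta> / 2"
  proof -
    have "real n powr (- \<gamma> * (\<kappa> - \<psi>)) \<le> real n powr 0"
      using n3 exps by (intro powr_mono) auto
    then have "8 powr \<gamma> * real n powr (- \<gamma> * (\<kappa> - \<psi>)) \<le> 8 powr \<gamma> * 1"
      using n_pos by (intro mult_left_mono) auto
    then have "g \<le> 8 powr \<gamma>" using g_le by linarith
    then have "g * \<sigma> \<le> 8 powr \<gamma> * \<sigma>" using cpos by (intro mult_right_mono) (auto simp: \<sigma>_def)
    then show ?thesis using P7' by (simp add: \<sigma>_def)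
  qed
  have \<theta>: "\<theta> \<le> 1" "\<theta> \<le> F4 / (2 * exp 1 * F3)" unfolding \<theta>_def by (rule min.cobounded1, rule min.cobounded2)
  show "g * s \<le> 1" using gs \<theta>(1) by linarith
  show "g * \<sigma> \<le> 1" using g\<sigma> \<theta>(1) by linarith
  have "F3 * exp 1 * (g * s + g * \<sigma>) \<le> F3 * exp 1 * (F4 / (2 * exp 1 * F3))"
    using gs g\<sigma> \<theta>(2) cpos by (intro mult_left_mono) auto
  also have "\<dots> = F4 / 2" using cpos by simp
  finally show "F3 * exp 1 * (g * s + g * \<sigma>) \<le> F4 / 2" .
qed

lemma tau: "\<tau> > 0" "\<tau> * \<Lambda> \<le> 1"
proof -
  show "\<tau> > 0" using ln_pos n_pos by (simp add: \<tau>_def)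
  have "(\<tau> * \<Lambda>)\<^sup>2 = ln (real n) * \<Lambda>\<^sup>2 / real n"
    using ln_ge_1 n_pos by (simp add: \<tau>_def power_mult_distrib)
  also have "\<dots> \<le> 1\<^sup>2" using P8 n_pos by simp
  finally show "\<tau> * \<Lambda> \<le> 1" by (rule power2_le_imp_le) simp
qed

text \<open>The Chernoff exponent is a multiple of \<open>ln n\<close>, and \<open>A\<close> is
  chosen to make that multiple \<open>- (\<kappa> + 1)\<close>, which outweighs the union over at
  most \<open>2 * p\<close> directions by a factor \<open>n\<close>.\<close>

lemma score_failure:
  assumes A: "A = \<kappa> + 1 + cu * \<Lambda>\<^sup>2 / 2"
  shows "4 * real p * exp (cu * real n * (\<tau> * \<Lambda>)\<^sup>2 / 2 - \<tau> * B) \<le> 8 / real n"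
proof -
  let ?l = "ln (real n)"
  have "\<tau> * B = A * (sqrt (?l / real n) * sqrt (real n * ?l))" by (simp add: \<tau>_def B_def)
  also have "sqrt (?l / real n) * sqrt (real n * ?l) = ?l"
    using n_pos ln_ge_1 by (simp add: real_sqrt_mult[symmetric])
  finally have tB: "\<tau> * B = A * ?l" .
  have "cu * real n * (\<tau> * \<Lambda>)\<^sup>2 / 2 = cu * \<Lambda>\<^sup>2 / 2 * ?l"
    using n_pos ln_ge_1 by (simp add: \<tau>_def power_mult_distrib)
  then have "cu * real n * (\<tau> * \<Lambda>)\<^sup>2 / 2 - \<tau> * B = - (\<kappa> + 1) * ?l"
  proof -
    have "A * ?l = (\<kappa> + 1) * ?l + cu * \<Lambda>\<^sup>2 / 2 * ?l" by (simp only: A distrib_right)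
    then show ?thesis
      unfolding tB \<open>cu * real n * (\<tau> * \<Lambda>)\<^sup>2 / 2 = cu * \<Lambda>\<^sup>2 / 2 * ?l\<close> by (simp add: algebra_simps)
  qed
  then have e: "exp (cu * real n * (\<tau> * \<Lambda>)\<^sup>2 / 2 - \<tau> * B) = real n powr (- (\<kappa> + 1))"
    using n_pos by (simp add: powr_def)
  have "4 * real p * real n powr (- (\<kappa> + 1)) \<le> 4 * (2 * real n powr \<kappa>) * real n powr (- (\<kappa> + 1))"
    using p_le by (intro mult_right_mono) auto
  also have "\<dots> = 8 * (real n powr \<kappa> * real n powr (- (\<kappa> + 1)))" by simp
  also have "real n powr \<kappa> * real n powr (- (\<kappa> + 1)) = real n powr (- 1)"
    unfolding powr_add[symmetric] by simp
  also have "8 * real n powr (- 1) = 8 / real n" using n_pos by (simp add: powr_minus divide_inverse)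
  finally show ?thesis unfolding e .
qed

definition "\<rho> = 4 * B / (cl * real n)"
definition "\<alpha> = 1 / (2 * \<rho>\<^sup>2)"

lemma rho_pos: "\<rho> > 0" "\<alpha> > 0"
  using B_pos cpos n_pos by (auto simp: \<rho>_def \<alpha>_def)

text \<open>Per coordinate the Gaussian integral with weight \<alpha> is of order \<rho>, that is
  \<open>sqrt (ln n / n)\<close>. Multiplied by \<open>p\<close> and divided by \<open>s\<close>, it
  leaves \<open>n powr (- \<epsilon>)\<close> and a logarithm.\<close>

lemma excess_failure:
  "real p * (exp (1 / 2) * sqrt (pi / \<alpha>) / s)
    \<le> (2 * exp (1 / 2) * sqrt (2 * pi) * (4 * A / cl)) * (sqrt (ln (real n)) * real n powr (- \<epsilon>))"
proof -
  let ?l = "ln (real n)"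
  have "sqrt (pi / \<alpha>) = sqrt (2 * pi * \<rho>\<^sup>2)" by (simp add: \<alpha>_def mult_ac)
  also have "\<dots> = sqrt (2 * pi) * \<rho>" using rho_pos by (simp add: real_sqrt_mult)
  finally have sa: "sqrt (pi / \<alpha>) = sqrt (2 * pi) * \<rho>" .
  have "\<rho> = 4 * A / cl * (sqrt ?l * (sqrt (real n) / real n))"
    by (simp add: \<rho>_def B_def real_sqrt_mult)
  also have "sqrt (real n) / real n = real n powr (- 1 / 2)"
    using n_pos powr_half_sqrt[of "real n"] powr_diff[of "real n" "1 / 2" 1] by simp
  finally have \<rho>: "\<rho> = 4 * A / cl * (sqrt ?l * real n powr (- 1 / 2))" .
  have si: "1 / s = real n powr (- (\<kappa> - 1 / 2 + \<epsilon>))" 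
    unfolding s_def by (rule powr_minus_divide[symmetric])
  have "real p * (exp (1 / 2) * sqrt (pi / \<alpha>) / s)
      = real p * (exp (1 / 2) * sqrt (2 * pi) * (4 * A / cl) * sqrt ?l *
          (real n powr (- 1 / 2) * (1 / s)))"
    unfolding sa \<rho> by simp
  also have "\<dots> \<le> (2 * real n powr \<kappa>) * (exp (1 / 2) * sqrt (2 * pi) * (4 * A / cl) * sqrt ?l *
          (real n powr (- 1 / 2) * (1 / s)))"
    using p_le cpos ln_ge_1 s_pos by (intro mult_right_mono) auto
  also have "\<dots> = (2 * exp (1 / 2) * sqrt (2 * pi) * (4 * A / cl)) * (sqrt ?l *
        (real n powr \<kappa> * (real n powr (- 1 / 2) * real n powr (- (\<kappa> - 1 / 2 + \<epsilon>)))))"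
    unfolding si by (simp only: mult_ac)
  also have "real n powr \<kappa> * (real n powr (- 1 / 2) * real n powr (- (\<kappa> - 1 / 2 + \<epsilon>))) = real n powr (- \<epsilon>)"
    unfolding powr_add[symmetric] by (simp add: algebra_simps)
  finally show ?thesis .
qed

end

subsection \<open>Consistency\<close>

lemma (in selection_problem) selection_bound:
  assumes tuning: "tuning n p q \<kappa> \<psi> \<phi> \<gamma> A K \<Lambda> cl cu ch F3 F4 m \<epsilon>"
    and A: "A = \<kappa> + 1 + cu * \<Lambda>\<^sup>2 / 2" and \<Lambda>: "sqrt (cu / cl) \<le> \<Lambda>"
    and am: "L2_set \<beta>0 {1..p} + m * (1 + \<Lambda>) \<le> am"
    and signal: "\<And>j. j \<in> supp \<beta>0 \<Longrightarrow> real n powr (- \<phi> / 2) \<le> \<bar>\<beta>0 j\<bar>"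
  shows "1 - 8 / real n - exp 1 * (exp ((2 * exp (1 / 2) * sqrt (2 * pi) * (4 * A / cl)) *
      (sqrt (ln (real n)) * real n powr (- \<epsilon>))) - 1) \<le> prob selected"
proof -
  interpret T: tuning n p q \<kappa> \<psi> \<phi> \<gamma> A K \<Lambda> cl cu ch F3 F4 m \<epsilon> by fact
  have \<Lambda>1: "1 \<le> \<Lambda>" using T.cpos by simp
  have sel: "\<omega> \<in> selected" if "\<omega> \<in> space M" "\<omega> \<notin> bad_score T.B" "\<omega> \<notin> bad_excess T.R T.\<alpha> T.s" for \<omega>
  proof (rule correct_selection[OF \<Lambda> \<Lambda>1 T.R_pos T.R_le_1(1) _ T.cubic_error(1) T.B_pos T.B_dominated
        T.R_le_signal T.signal_le_1 signal T.eta_bounds T.p2q(1) T.under T.far T.g_def T.\<sigma>_def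
        T.s_pos T.gains T.\<rho>_def T.\<alpha>_def that])
    show "L2_set \<beta>0 {1..p} + (1 + \<Lambda>) * T.R \<le> am" using T.R_le_1(3) am by linarith
  qed
  note bs = bad_score[OF \<Lambda> \<Lambda>1 T.tau(2,1), of T.B]
  note be = bad_excess[OF less_imp_le[OF T.R_pos] T.rho_pos(2) T.s_pos \<Lambda> T.cubic_error(2)]
  have "prob (bad_score T.B) \<le> 8 / real n"
    using bs(2) T.score_failure[OF A] by linarith
  moreover have "prob (bad_excess T.R T.\<alpha> T.s) \<le> exp 1 * (exp ((2 * exp (1 / 2) * sqrt (2 * pi) * (4 * A / cl)) *
      (sqrt (ln (real n)) * real n powr (- \<epsilon>))) - 1)"
  proof -
    have "exp (real p * (exp (1 / 2) * sqrt (pi / T.\<alpha>) / T.s)) \<le>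
        exp ((2 * exp (1 / 2) * sqrt (2 * pi) * (4 * A / cl)) * (sqrt (ln (real n)) * real n powr (- \<epsilon>)))"
      by (rule exp_le_cancel_iff[THEN iffD2, OF T.excess_failure])
    then have "exp 1 * (exp (real p * (exp (1 / 2) * sqrt (pi / T.\<alpha>) / T.s)) - 1) \<le> exp 1 *
        (exp ((2 * exp (1 / 2) * sqrt (2 * pi) * (4 * A / cl)) * (sqrt (ln (real n)) * real n powr (- \<epsilon>))) - 1)"
      by (intro mult_left_mono diff_right_mono) auto
    then show ?thesis using be(2) by linarith
  qed
  moreover have "1 - prob (bad_score T.B) - prob (bad_excess T.R T.\<alpha> T.s) \<le> prob selected"
    by (rule selection_prob[OF sel bs(1) be(1)])
  ultimately show ?thesis by linarith
qed

lemma selection_problemI: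
  assumes glm: "glm_problem M Y \<mu> n p q X \<beta>0"
    and curv: "local_glm_curv \<mu> n p q X \<beta>0 cl cu ch"
    and "\<And>J. J \<subseteq> {1..p} \<Longrightarrow> card J \<le> q \<Longrightarrow> prior_density J (f J)"
    and "F3 > 0" "F4 > 0" "\<gamma> \<ge> 0"
    and "\<And>J \<beta>. J \<subseteq> {1..p} \<Longrightarrow> card J \<le> q \<Longrightarrow> \<beta> \<in> coord_space J \<Longrightarrow> f J \<beta> \<le> F3"
    and "\<And>J \<beta>. J \<subseteq> {1..p} \<Longrightarrow> card J \<le> q \<Longrightarrow> \<beta> \<in> coord_space J \<Longrightarrow>
        L2_set \<beta> {1..p} \<le> am \<Longrightarrow> F4 \<le> f J \<beta>"
  shows "selection_problem \<mu> n p q X \<beta>0 cl cu ch M Y f F3 F4 am \<gamma>"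
proof -
  have "random_glm \<mu> n p q X \<beta>0 cl cu ch M Y"
    using glm curv unfolding glm_problem_def
    by (intro random_glm.intro random_glm_axioms.intro) auto
  then show ?thesis
    using assms by (intro selection_problem.intro selection_problem_axioms.intro) auto
qed

text \<open>Rounding either way changes a number that is at least 1 by at most a factor 2, so only
  constants depend on the direction.\<close>

lemma rounded_bounds:
  assumes "rounded x k" "x \<ge> 1"
  shows "x \<le> 2 * real k" "real k \<le> 2 * x" "k \<ge> 1"
proof -
  have "1 \<le> \<lfloor>x\<rfloor>" using assms(2) by simp
  then have "int k \<ge> 1" using assms(1) floor_le_ceiling[of x] unfolding rounded_def by linarith
  then show "k \<ge> 1" by simp
  have "real k \<le> x + 1" "x - 1 \<le> real k"
    using assms(1) unfolding rounded_def by linarith+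
  then show "x \<le> 2 * real k" "real k \<le> 2 * x" using assms(2) \<open>k \<ge> 1\<close> by linarith+
qed

lemma eventually_ln_le_powr:
  fixes c d \<delta> :: real
  assumes "d > 0" "\<delta> > 0"
  shows "\<forall>\<^sub>F n in sequentially. c * ln (real n) \<le> d * real n powr \<delta>"
    "\<forall>\<^sub>F n in sequentially. c * ln (real n) ^ 3 \<le> d * real n powr \<delta>"
proof -
  have "(\<lambda>n. ln (real n) / real n powr \<delta>) \<longlonglongrightarrow> 0" using assms(2) by real_asymp
  from order_tendstoD(2)[OF tendsto_mult_right_zero[OF this] assms(1)]
  have ev1: "\<forall>\<^sub>F n in sequentially. c * (ln (real n) / real n powr \<delta>) < d" .
  have "(\<lambda>n. ln (real n) ^ 3 / real n powr \<delta>) \<longlonglongrightarrow> 0" using assms(2) by real_asymp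
  from order_tendstoD(2)[OF tendsto_mult_right_zero[OF this] assms(1)]
  have ev2: "\<forall>\<^sub>F n in sequentially. c * (ln (real n) ^ 3 / real n powr \<delta>) < d" .
  show "\<forall>\<^sub>F n in sequentially. c * ln (real n) \<le> d * real n powr \<delta>"
    using ev1 eventually_gt_at_top[of 0]
    by eventually_elim (simp add: pos_divide_less_eq)
  show "\<forall>\<^sub>F n in sequentially. c * ln (real n) ^ 3 \<le> d * real n powr \<delta>"
    using ev2 eventually_gt_at_top[of 0]
    by eventually_elim (simp add: pos_divide_less_eq)
qed

theorem corollary5p1:
  fixes \<Omega> :: "nat \<Rightarrow> 'w measure"
    and Y :: "nat \<Rightarrow> nat \<Rightarrow> 'w \<Rightarrow> real"
    and \<mu> :: "nat \<Rightarrow> real measure"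
    and p q :: "nat \<Rightarrow> nat"
    and X :: "nat \<Rightarrow> nat \<Rightarrow> nat \<Rightarrow> real"
    and \<beta>0 :: "nat \<Rightarrow> nat \<Rightarrow> real"
    and f :: "nat \<Rightarrow> nat set \<Rightarrow> (nat \<Rightarrow> real) \<Rightarrow> real"
    and c_lower c_upper :: "real \<Rightarrow> real"
    and \<kappa> \<psi> \<phi> a0 c_change \<nu> c_sample a_MLE F3 F4 \<gamma> :: real
  assumes problem: "\<And>n. n \<ge> 1 \<Longrightarrow> glm_problem (\<Omega> n) (Y n) (\<mu> n) n (p n) (q n) (X n) (\<beta>0 n)"
    and "\<kappa> > 0" and "0 \<le> \<psi>" and "\<psi> < 1 / 3" and "0 \<le> \<phi>" and "\<phi> < 1 - \<psi>" and "\<kappa> > \<psi>"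
    and p: "\<And>n. n \<ge> 1 \<Longrightarrow> rounded (real n powr \<kappa>) (p n)"
    and q: "\<And>n. n \<ge> 1 \<Longrightarrow> rounded (real n powr \<psi>) (q n)"
    and support: "\<And>n. n \<ge> 1 \<Longrightarrow> supp (\<beta>0 n) \<noteq> {}"
    and signal: "\<And>n. n \<ge> 1 \<Longrightarrow> beta_min (\<beta>0 n) = real n powr (- \<phi> / 2)"
    and "a0 > 0" and "c_change > 0"
    and "\<And>r. r \<ge> 0 \<Longrightarrow> c_lower r > 0" and "antimono_on {0..} c_lower"
    and "\<And>r. r \<ge> 0 \<Longrightarrow> c_upper r > 0" and "mono_on {0..} c_upper"
    and norm: "\<And>n. n \<ge> 1 \<Longrightarrow> L2_set (\<beta>0 n) {1..p n} \<le> a0"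
    and hessian: "\<And>n J. n \<ge> 1 \<Longrightarrow> J \<subseteq> {1..p n} \<Longrightarrow> supp (\<beta>0 n) \<subseteq> J \<Longrightarrow> card J \<le> 2 * q n \<Longrightarrow>
        hessian_bounds c_lower c_upper c_change (\<mu> n) n (p n) (X n) J"
    and "\<nu> > 0" and "c_sample > 0" and "a_MLE > 0"
    and mle: "mle_bound a0 c_lower c_upper c_change \<nu> c_sample a_MLE"
    and prior: "\<And>n J. n \<ge> 1 \<Longrightarrow> J \<subseteq> {1..p n} \<Longrightarrow> card J \<le> q n \<Longrightarrow> prior_density J (f n J)"
    and "F3 > 0" and "F4 > 0"
    and prior_upper: "\<And>n J \<beta>. n \<ge> 1 \<Longrightarrow> J \<subseteq> {1..p n} \<Longrightarrow> card J \<le> q n \<Longrightarrow>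
        \<beta> \<in> coord_space J \<Longrightarrow> f n J \<beta> \<le> F3"
    and prior_lower: "\<And>n J \<beta>. n \<ge> 1 \<Longrightarrow> J \<subseteq> {1..p n} \<Longrightarrow> card J \<le> q n \<Longrightarrow>
        \<beta> \<in> coord_space J \<Longrightarrow> L2_set \<beta> {1..p n} \<le> a_MLE \<Longrightarrow> F4 \<le> f n J \<beta>"
    and "\<gamma> \<ge> 0" and "\<gamma> > 1 - (1 - 2 * \<psi>) / (2 * (\<kappa> - \<psi>))"
  shows "(\<lambda>n. measure (\<Omega> n) {\<omega> \<in> space (\<Omega> n).
            {J. is_arg_max (bayes \<gamma> (\<mu> n) n (p n) (X n) (\<lambda>i. Y n i \<omega>) (f n))
                  (\<lambda>J. J \<subseteq> {1..p n} \<and> card J \<le> q n) J} = {supp (\<beta>0 n)}})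
          \<longlonglongrightarrow> 1"
proof -
  let ?prob = "\<lambda>n. measure (\<Omega> n) {\<omega> \<in> space (\<Omega> n).
            {J. is_arg_max (bayes \<gamma> (\<mu> n) n (p n) (X n) (\<lambda>i. Y n i \<omega>) (f n))
                  (\<lambda>J. J \<subseteq> {1..p n} \<and> card J \<le> q n) J} = {supp (\<beta>0 n)}}"
  note lower_pos = \<open>\<And>r. r \<ge> 0 \<Longrightarrow> c_lower r > 0\<close> and upper_pos = \<open>\<And>r. r \<ge> 0 \<Longrightarrow> c_upper r > 0\<close>
  have lower_mono: "c_lower y \<le> c_lower x" if "0 \<le> x" "x \<le> y" for x y
    using \<open>antimono_on {0..} c_lower\<close> that by (auto simp: monotone_on_def)
  have upper_mono: "c_upper x \<le> c_upper y" if "0 \<le> x" "x \<le> y" for x y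
    using \<open>mono_on {0..} c_upper\<close> that by (auto simp: monotone_on_def)
  have basic: "p n \<ge> 1 \<and> q n \<ge> 1 \<and> real (q n) \<le> 2 * real n powr \<psi> \<and> real (p n) \<le> 2 * real n powr \<kappa> \<and>
      real n powr \<kappa> \<le> 2 * real (p n)" if "n \<ge> 1" for n
  proof -
    have "1 \<le> real n powr \<kappa>" "1 \<le> real n powr \<psi>"
      using that \<open>\<kappa> > 0\<close> \<open>0 \<le> \<psi>\<close> by (auto intro!: ge_one_powr_ge_zero)
    then show ?thesis using rounded_bounds[OF p[OF that]] rounded_bounds[OF q[OF that]] by auto
  qed
  have glmD: "exp_family (\<mu> n)" "\<beta>0 n \<in> coord_space {1..p n}" "card (supp (\<beta>0 n)) \<le> q n" if "n \<ge> 1" for n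
    using problem[OF that] by (auto simp: glm_problem_def)
  have suppD: "supp (\<beta>0 n) \<subseteq> {1..p n}" "finite (supp (\<beta>0 n))" if "n \<ge> 1" for n
  proof -
    show "supp (\<beta>0 n) \<subseteq> {1..p n}" using glmD(2)[OF that] by (auto simp: supp_def coord_space_def)
    then show "finite (supp (\<beta>0 n))" by (rule finite_subset) simp
  qed
  \<comment> \<open>The Gaussian test problem needs a constant lying between the two functions. The
    problem with \<open>n = 1\<close> supplies it: its support is nonempty, so the Hessian bounds
    can be tested on a unit vector.\<close>
  have crossing: "c_lower 0 \<le> c_upper 0"
  proof -
    let ?J = "supp (\<beta>0 1)"
    obtain j where j: "j \<in> ?J" using support[of 1] by auto
    have fJ: "finite ?J" using suppD(2)[of 1] by simp
    have one: "L2_set (unit_vec j) ?J = 1" by (rule L2_set_unit_vec[OF fJ j])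
    have hb: "hessian_bounds c_lower c_upper c_change (\<mu> 1) 1 (p 1) (X 1) ?J"
      using suppD(1)[of 1] glmD(3)[of 1] by (intro hessian) auto
    have zero: "(\<lambda>_. 0) \<in> coord_space ?J" by (simp add: coord_space_def)
    have z: "L2_set (\<lambda>_. 0::real) {1..p 1} = 0" by (simp add: L2_set_def)
    let ?H = "\<lambda>j k. neg_hessian (\<mu> 1) 1 (p 1) (X 1) (\<lambda>_. 0) j k / real 1"
    note h0 = hb[unfolded hessian_bounds_def, THEN bspec, OF zero, THEN bspec, OF zero, unfolded z]
    have "loewner_le ?J (\<lambda>j k. c_lower 0 * id_mat j k) ?H" "loewner_le ?J ?H (\<lambda>j k. c_upper 0 * id_mat j k)"
      by (rule h0[THEN conjunct1], rule h0[THEN conjunct2, THEN conjunct1])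
    from loewner_le_scaled_id[OF this(1) fJ, of "unit_vec j"] loewner_ge_scaled_id[OF this(2) fJ, of "unit_vec j"]
    show ?thesis unfolding one by simp
  qed
  have a_gt: "a0 < a_MLE"
  proof (rule mle_bound_imp_greater[OF mle])
    show "c_lower r \<le> c_lower 0" if "r \<ge> 0" for r using lower_mono[of 0 r] that by simp
    show "c_lower 0 \<le> c_upper r" if "r \<ge> 0" for r using crossing upper_mono[of 0 r] that by simp
  qed (use \<open>\<nu> > 0\<close> \<open>c_sample > 0\<close> \<open>a0 > 0\<close> \<open>c_change > 0\<close> lower_pos in auto)

  \<comment> \<open>For every \<open>n\<close> the unit ball about the true parameter lies in the
    ball of radius \<open>a0 + 1\<close>, so monotonicity makes these constants valid for all
    \<open>n\<close>.\<close>
  define cl where "cl = c_lower (a0 + 1)"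
  define cu where "cu = c_upper (a0 + 1)"
  define \<Lambda> where "\<Lambda> = max 1 (sqrt (cu / cl))"
  define A where "A = \<kappa> + 1 + cu * \<Lambda>\<^sup>2 / 2"
  \<comment> \<open>The three summands provide \<open>KA\<close>, \<open>KG\<close> and
    \<open>K \<ge> 1\<close>.\<close>
  define K where "K = 8 * A / cl + 4 * (3 + (\<kappa> + 1) * \<gamma>) / cl + 1"
  \<comment> \<open>\<open>m\<close> caps \<open>R\<close>. The three terms keep the enlarged ball
    of radius at most 1, keep it where the prior is bounded below, and keep the score on the small
    cube at most \<open>1 / 2\<close>.\<close>
  define m where "m = min (min (1 / (1 + \<Lambda>)) ((a_MLE - a0) / (1 + \<Lambda>))) (2 / cl)"
  define \<epsilon> where "\<epsilon> = (\<gamma> * (\<kappa> - \<psi>) - \<kappa> + 1 / 2) / 2"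
  define \<theta> where "\<theta> = min 1 (F4 / (2 * exp 1 * F3)) / 2"
  define c where "c = 2 * exp (1 / 2) * sqrt (2 * pi) * (4 * A / cl)"
  have cl: "cl > 0" and cu: "cu > 0" using lower_pos upper_pos \<open>a0 > 0\<close> by (auto simp: cl_def cu_def)
  have \<Lambda>: "\<Lambda> \<ge> 1" "sqrt (cu / cl) \<le> \<Lambda>" by (auto simp: \<Lambda>_def)
  have A: "A > 0" using \<open>\<kappa> > 0\<close> cu by (simp add: A_def add_pos_nonneg)
  have G: "3 + (\<kappa> + 1) * \<gamma> > 0" using \<open>\<kappa> > 0\<close> \<open>\<gamma> \<ge> 0\<close> by (simp add: add_pos_nonneg)
  have K1: "K \<ge> 1" "8 * A / cl \<le> K" "4 * (3 + (\<kappa> + 1) * \<gamma>) / cl \<le> K"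
    using A G cl by (simp_all add: K_def)
  have KA: "8 * A \<le> cl * K" using K1(2) cl by (simp add: field_simps)
  have KG: "3 + (\<kappa> + 1) * \<gamma> \<le> cl * K\<^sup>2 / 4"
  proof -
    have "K * 1 \<le> K * K" using K1(1) by (intro mult_left_mono) auto
    then have "cl * K \<le> cl * K\<^sup>2" using cl by (simp add: power2_eq_square)
    moreover have "4 * (3 + (\<kappa> + 1) * \<gamma>) \<le> cl * K" using K1(3) cl by (simp add: pos_divide_le_eq mult.commute)
    ultimately have "4 * (3 + (\<kappa> + 1) * \<gamma>) \<le> cl * K\<^sup>2" by (rule order_trans[rotated])
    then show ?thesis by simp
  qed
  have m: "m > 0" "m * (1 + \<Lambda>) \<le> 1" "m * (1 + \<Lambda>) \<le> a_MLE - a0" "cl * m \<le> 2"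
  proof -
    have pos: "1 + \<Lambda> > 0" using \<Lambda> by simp
    show "m > 0" using pos cl a_gt by (simp add: m_def)
    have "m \<le> 1 / (1 + \<Lambda>)" "m \<le> (a_MLE - a0) / (1 + \<Lambda>)" "m \<le> 2 / cl" by (auto simp: m_def)
    then show "m * (1 + \<Lambda>) \<le> 1" "m * (1 + \<Lambda>) \<le> a_MLE - a0" "cl * m \<le> 2"
      using pos cl by (simp_all only: pos_le_divide_eq mult.commute)
  qed
  \<comment> \<open>Multiplied by \<open>\<kappa> - \<psi> > 0\<close>, the condition on \<gamma>
    reads \<open>\<gamma> * (\<kappa> - \<psi>) > \<kappa> - 1 / 2\<close>; \<epsilon> is half of
    the slack, so that the other half survives in \<open>gains\<close>.\<close>
  have eps: "\<epsilon> > 0"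
  proof -
    have kp: "\<kappa> - \<psi> > 0" using \<open>\<kappa> > \<psi>\<close> by simp
    have "(1 - (1 - 2 * \<psi>) / (2 * (\<kappa> - \<psi>))) * (\<kappa> - \<psi>) < \<gamma> * (\<kappa> - \<psi>)"
      using kp \<open>\<gamma> > 1 - (1 - 2 * \<psi>) / (2 * (\<kappa> - \<psi>))\<close> by (intro mult_strict_right_mono)
    moreover have "(1 - (1 - 2 * \<psi>) / (2 * (\<kappa> - \<psi>))) * (\<kappa> - \<psi>) = \<kappa> - \<psi> - (1 - 2 * \<psi>) / 2"
      using kp by (simp add: field_simps)
    ultimately have "\<kappa> - \<psi> - (1 - 2 * \<psi>) / 2 < \<gamma> * (\<kappa> - \<psi>)" by (simp only:)
    moreover have "(1 - 2 * \<psi>) / 2 = 1 / 2 - \<psi>" by (simp add: diff_divide_distrib)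
    moreover have "0 < t - \<kappa> + 1 / 2" if "\<kappa> - \<psi> - (1 / 2 - \<psi>) < t" for t
      using that by linarith
    ultimately have "0 < \<gamma> * (\<kappa> - \<psi>) - \<kappa> + 1 / 2" by metis
    then show ?thesis unfolding \<epsilon>_def by simp
  qed
  have eps2: "2 * \<epsilon> = \<gamma> * (\<kappa> - \<psi>) - \<kappa> + 1 / 2" by (simp add: \<epsilon>_def)
  have \<theta>: "\<theta> > 0" using \<open>F3 > 0\<close> \<open>F4 > 0\<close> by (simp add: \<theta>_def)

  have "\<forall>\<^sub>F n in sequentially. tuning n (p n) (q n) \<kappa> \<psi> \<phi> \<gamma> A K \<Lambda> cl cu c_change F3 F4 m \<epsilon>"
  proof -
    have "\<forall>\<^sub>F n in sequentially. 2 * K\<^sup>2 * ln (real n) \<le> m\<^sup>2 * real n powr (1 - \<psi>)"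
      using m(1) \<open>\<psi> < 1 / 3\<close> by (intro eventually_ln_le_powr) auto
    moreover have "\<forall>\<^sub>F n in sequentially. (c_change * (1 + (1 + \<Lambda>) ^ 3) / 2)\<^sup>2 * (8 * K ^ 6) * ln (real n) ^ 3
        \<le> 1 * real n powr (1 - 3 * \<psi>)"
      using \<open>\<psi> < 1 / 3\<close> by (intro eventually_ln_le_powr) auto
    moreover have "\<forall>\<^sub>F n in sequentially. 2 * K\<^sup>2 * ln (real n) \<le> 1 * real n powr (1 - \<phi> - \<psi>)"
      using \<open>\<phi> < 1 - \<psi>\<close> by (intro eventually_ln_le_powr) auto
    moreover have "\<forall>\<^sub>F n in sequentially. 8 \<le> real n powr (\<kappa> - \<psi>)"
      using \<open>\<kappa> > \<psi>\<close> by real_asymp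
    moreover have "\<forall>\<^sub>F n in sequentially. cu \<le> real n" "\<forall>\<^sub>F n in sequentially. 8 \<le> real n"
      using filterlim_real_sequentially unfolding filterlim_at_top by blast+
    moreover have "\<forall>\<^sub>F n in sequentially. 2 * exp 1 / F4 < real n"
      using filterlim_real_sequentially unfolding filterlim_at_top_dense by blast
    moreover have "\<forall>\<^sub>F n in sequentially. 8 powr \<gamma> * real n powr (- \<epsilon>) < \<theta>"
    proof (rule order_tendstoD(2)[OF _ \<theta>])
      have "(\<lambda>n. real n powr (- \<epsilon>)) \<longlonglongrightarrow> 0" using eps by real_asymp
      then show "(\<lambda>n. 8 powr \<gamma> * real n powr (- \<epsilon>)) \<longlonglongrightarrow> 0" by (rule tendsto_mult_right_zero)
    qed
    moreover have "\<forall>\<^sub>F n in sequentially. 8 powr \<gamma> * sqrt (4 * pi / (cl * real n)) < \<theta>"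
    proof (rule order_tendstoD(2)[OF _ \<theta>])
      have "(\<lambda>n. sqrt (4 * pi / (cl * real n))) \<longlonglongrightarrow> 0" using cl by real_asymp
      then show "(\<lambda>n. 8 powr \<gamma> * sqrt (4 * pi / (cl * real n))) \<longlonglongrightarrow> 0" by (rule tendsto_mult_right_zero)
    qed
    moreover have "\<forall>\<^sub>F n in sequentially. \<Lambda>\<^sup>2 * ln (real n) \<le> 1 * real n powr 1"
      by (intro eventually_ln_le_powr) auto
    ultimately show ?thesis using eventually_ge_at_top[of 3]
    proof eventually_elim
      case (elim n)
      then have n1: "n \<ge> 1" by simp
      show ?case
      proof
        show "2 * exp 1 < F4 * real n" using elim \<open>F4 > 0\<close> by (simp add: pos_divide_less_eq mult.commute)
        show "8 powr \<gamma> * real n powr - \<epsilon> \<le> min 1 (F4 / (2 * exp 1 * F3)) / 2"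
          "8 powr \<gamma> * sqrt (4 * pi / (cl * real n)) \<le> min 1 (F4 / (2 * exp 1 * F3)) / 2"
          using elim unfolding \<theta>_def by linarith+
        show "ln (real n) * \<Lambda>\<^sup>2 \<le> real n" using elim by (simp add: mult.commute)
      qed (use elim basic[OF n1] A K1(1) \<Lambda>(1) cl cu m KA KG eps eps2 \<open>c_change > 0\<close> \<open>F3 > 0\<close> \<open>F4 > 0\<close>
          \<open>0 \<le> \<psi>\<close> \<open>\<psi> < 1 / 3\<close> \<open>0 \<le> \<phi>\<close> \<open>\<kappa> > \<psi>\<close> \<open>\<gamma> \<ge> 0\<close> in \<open>simp_all\<close>)
    qed
  qed
  then have lower: "\<forall>\<^sub>F n in sequentially. 1 - 8 / real n -
      exp 1 * (exp (c * (sqrt (ln (real n)) * real n powr (- \<epsilon>))) - 1)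
      \<le> ?prob n"
    using eventually_ge_at_top[of 1]
  proof eventually_elim
    case (elim n)
    have glm: "local_glm (\<mu> n) n (p n) (q n) (\<beta>0 n) cl cu c_change"
      using glmD[OF elim(2)] basic[OF elim(2)] elim(2) cl cu \<open>c_change > 0\<close>
      by unfold_locales auto
    have curv: "local_glm_curv (\<mu> n) n (p n) (q n) (X n) (\<beta>0 n) cl cu c_change"
    proof (rule local_glm_curvI[OF glm hessian[OF elim(2)] lower_pos, where rad = "a0 + 1"])
      show "cl \<le> c_lower r" if "0 \<le> r" "r \<le> a0 + 1" for r unfolding cl_def by (rule lower_mono[OF that])
      show "c_upper r \<le> cu" if "0 \<le> r" "r \<le> a0 + 1" for r unfolding cu_def by (rule upper_mono[OF that])
      show "L2_set (\<beta>0 n) {1..p n} + 1 \<le> a0 + 1" using norm[OF elim(2)] by simp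
    qed
    interpret S: selection_problem "\<mu> n" n "p n" "q n" "X n" "\<beta>0 n" cl cu c_change "\<Omega> n" "Y n" "f n" F3 F4 a_MLE \<gamma>
      by (rule selection_problemI[OF problem[OF elim(2)] curv prior[OF elim(2)] \<open>F3 > 0\<close> \<open>F4 > 0\<close> \<open>\<gamma> \<ge> 0\<close>
            prior_upper[OF elim(2)] prior_lower[OF elim(2)]])
    show ?case
      unfolding S.selected_def[symmetric] c_def
    proof (rule S.selection_bound[OF elim(1) A_def \<Lambda>(2)])
      show "L2_set (\<beta>0 n) {1..p n} + m * (1 + \<Lambda>) \<le> a_MLE" using norm[OF elim(2)] m(3) by linarith
      show "real n powr (- \<phi> / 2) \<le> \<bar>\<beta>0 n j\<bar>" if "j \<in> supp (\<beta>0 n)" for j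
        unfolding signal[OF elim(2), symmetric] beta_min_def using suppD(2)[OF elim(2)] that by (intro Min_le) auto
    qed
  qed
  have limit: "(\<lambda>n. 1 - 8 / real n - exp 1 * (exp (c * (sqrt (ln (real n)) * real n powr (- \<epsilon>))) - 1)) \<longlonglongrightarrow> 1"
  proof -
    have "(\<lambda>n. sqrt (ln (real n)) * real n powr (- \<epsilon>)) \<longlonglongrightarrow> 0" using eps by real_asymp
    moreover have "(\<lambda>n. 8 / real n) \<longlonglongrightarrow> 0" by real_asymp
    ultimately have "(\<lambda>n. 1 - 8 / real n - exp 1 * (exp (c * (sqrt (ln (real n)) * real n powr (- \<epsilon>))) - 1)) \<longlonglongrightarrow>
      1 - 0 - exp 1 * (exp (c * 0) - 1)"
      by (intro tendsto_intros)
    then show ?thesis by simp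
  qed
  have upper: "\<forall>\<^sub>F n in sequentially. ?prob n \<le> 1"
    using eventually_ge_at_top[of 1]
  proof eventually_elim
    case (elim n)
    interpret prob_space "\<Omega> n" using problem[OF elim] by (simp add: glm_problem_def)
    show ?case by (rule prob_le_1)
  qed
  show ?thesis by (rule tendsto_sandwich[OF lower upper limit tendsto_const])
qed

end
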